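(* The monoid $\mathrm{Cl}(\mathfrak O)$ is a Clifford semigroup, namely $\mathrm{Reg}\,\mathrm{Cl}(\mathfrak O)=\mathrm{Cl}(\mathfrak O)$, if and only if the ring $\mathfrak O$ has the finite character property. Moreover, if $\mathfrak O$ has the finite character property, then there is an isomorphism of monoids $$\mathrm{Cl}(\mathfrak O)/\mathrm{Pic}(\mathfrak O)\simeq\bigoplus_{\mathfrak P}\left(\{0\}\sqcup\mathbb R/v_{\mathfrak P}(L^\times)\right),$$ where $\mathfrak P$ runs through all maximal ideals of $\mathfrak O$ satisfying $V_{\mathfrak P}=\mathbb R$.
   Context: Setting: $\mathfrak o$ is a Dedekind domain which is not a field, $K$ its fraction field, $L/K$ an algebraic extension of fields (possibly of infinite degree), and $\mathfrak O$ the integral closure of $\mathfrak o$ in $L$. $\mathfrak O$ has the finite character property if every non-zero element of $\mathfrak O$ is contained in at most finitely many maximal ideals. A fractional ideal of $\mathfrak O$ is a non-zero $\mathfrak O$-submodule $I\subseteq L$ with $dI\subseteq\mathfrak O$ for some $d\in L^\times$; it is invertible if $IJ=\mathfrak O$ for some fractional ideal $J$. $\mathcal F(\mathfrak O)$ is the commutative monoid of fractional ideals under multiplication, $\mathcal I(\mathfrak O)$ the group of invertible ones, $\mathcal P(\mathfrak O)$ the group of principal ones $a\mathfrak O$, $a\in L^\times$. $\mathrm{Cl}(\mathfrak O)=\mathcal F(\mathfrak O)/\mathcal P(\mathfrak O)$ is the ideal class semigroup and $\mathrm{Pic}(\mathfrak O)=\mathcal I(\mathfrak O)/\mathcal P(\mathfrak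 O)$ the Picard group. For a commutative monoid $A$ and a submonoid $H$ that is a group, $A/H$ is the quotient monoid of $A$ by the relation: $a\sim b$ iff $a=hb$ for some $h\in H$. For a monoid $A$, $\mathrm{Reg}\,A$ is the set of $a\in A$ such that $a=aba$ for some $b\in A$. For a maximal ideal $\mathfrak P$ of $\mathfrak O$, $v_{\mathfrak P}\colon L^\times\to\mathbb Q$ is the unique additive valuation corresponding to $\mathfrak P$ normalized by $v_{\mathfrak P}(K^\times)=\mathbb Z$, and $V_{\mathfrak P}$ is the closure of $v_{\mathfrak P}(L^\times)$ in $\mathbb R$. $\{0\}\sqcup\mathbb R/v_{\mathfrak P}(L^\times)$ denotes the commutative monoid obtained from the quotient group $\mathbb R/v_{\mathfrak P}(L^\times)$ by adjoining a new identity element $0$. A direct sum of commutative monoids is the submonoid of the product consisting of families with all but finitely many components equal to the identity. *)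

theory Defs
  imports "HOL-Algebra.Algebra" "HOL-Analysis.Analysis"
begin

section \<open>Monoids\<close>

definition Reg :: "('a, 'b) monoid_scheme \<Rightarrow> 'a set"
  where "Reg A = {a \<in> carrier A. \<exists>b \<in> carrier A. a = a \<otimes>\<^bsub>A\<^esub> b \<otimes>\<^bsub>A\<^esub> a}"

text \<open>
  The library's quotient \<^term>\<open>A Mod H\<close> has the cosets \<^term>\<open>H #>\<^bsub>A\<^esub> a\<close> as elements and the
  product of sets as multiplication. For a commutative monoid \<^term>\<open>A\<close> and a submonoid \<^term>\<open>H\<close>
  that is a group, this is the quotient monoid by the relation
  ``\<^prop>\<open>a = h \<otimes>\<^bsub>A\<^esub> b\<close> for some \<^prop>\<open>h \<in> H\<close>''; the next three lemmas record this.
\<close>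

definition coset_rel :: "('a, 'b) monoid_scheme \<Rightarrow> 'a set \<Rightarrow> ('a \<times> 'a) set"
  where "coset_rel A H =
    {(a, b). a \<in> carrier A \<and> b \<in> carrier A \<and> (\<exists>h \<in> H. a = h \<otimes>\<^bsub>A\<^esub> b)}"

lemma coset_rel_class:
  assumes A: "comm_monoid A" and H: "submonoid H A" and G: "group (A\<lparr>carrier := H\<rparr>)"
    and a: "a \<in> carrier A"
  shows "coset_rel A H `` {a} = H #>\<^bsub>A\<^esub> a"
proof -
  interpret comm_monoid A by (rule A)
  interpret H: submonoid H A by (rule H)
  interpret G: group "A\<lparr>carrier := H\<rparr>" by (rule G)
  have inv: "\<exists>k \<in> H. k \<otimes>\<^bsub>A\<^esub> h = \<one>\<^bsub>A\<^esub>" if "h \<in> H" for h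
    using G.l_inv_ex that by auto
  have cancel: "\<exists>k \<in> H. y = k \<otimes>\<^bsub>A\<^esub> x"
    if hy: "h \<in> H" "x = h \<otimes>\<^bsub>A\<^esub> y" "y \<in> carrier A" for h x y
  proof -
    obtain k where k: "k \<in> H" "k \<otimes>\<^bsub>A\<^esub> h = \<one>\<^bsub>A\<^esub>" using inv [OF hy(1)] by blast
    have "k \<otimes>\<^bsub>A\<^esub> x = y"
      using hy k H.mem_carrier by (simp add: m_assoc [symmetric])
    then show ?thesis using k by blast
  qed
  show ?thesis
  proof (rule Set.set_eqI)
    fix y
    show "y \<in> coset_rel A H `` {a} \<longleftrightarrow> y \<in> H #>\<^bsub>A\<^esub> a"
    proof
      assume "y \<in> coset_rel A H `` {a}"
      then obtain h where "h \<in> H" "a = h \<otimes>\<^bsub>A\<^esub> y" "y \<in> carrier A"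
        by (auto simp: coset_rel_def)
      then show "y \<in> H #>\<^bsub>A\<^esub> a" using cancel by (auto simp: r_coset_def)
    next
      assume "y \<in> H #>\<^bsub>A\<^esub> a"
      then obtain h where h: "h \<in> H" "y = h \<otimes>\<^bsub>A\<^esub> a" by (auto simp: r_coset_def)
      then show "y \<in> coset_rel A H `` {a}"
        using cancel [OF h a] a H.mem_carrier by (auto simp: coset_rel_def)
    qed
  qed
qed

lemma carrier_Mod_eq_quotient:
  assumes "comm_monoid A" "submonoid H A" "group (A\<lparr>carrier := H\<rparr>)"
  shows "carrier (A Mod H) = carrier A // coset_rel A H"
  using coset_rel_class [OF assms] by (auto simp: carrier_FactGroup quotient_def)

lemma mult_Mod:
  assumes A: "comm_monoid A" and H: "submonoid H A"
    and a: "a \<in> carrier A" and b: "b \<in> carrier A"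
  shows "(H #>\<^bsub>A\<^esub> a) \<otimes>\<^bsub>A Mod H\<^esub> (H #>\<^bsub>A\<^esub> b) = H #>\<^bsub>A\<^esub> (a \<otimes>\<^bsub>A\<^esub> b)"
proof -
  interpret comm_monoid A by (rule A)
  interpret H: submonoid H A by (rule H)
  have swap: "(h \<otimes>\<^bsub>A\<^esub> a) \<otimes>\<^bsub>A\<^esub> (k \<otimes>\<^bsub>A\<^esub> b) = (h \<otimes>\<^bsub>A\<^esub> k) \<otimes>\<^bsub>A\<^esub> (a \<otimes>\<^bsub>A\<^esub> b)"
    if "h \<in> H" "k \<in> H" for h k
    using that a b H.mem_carrier by (simp add: m_ac)
  have "H #>\<^bsub>A\<^esub> (a \<otimes>\<^bsub>A\<^esub> b) \<subseteq> (H #>\<^bsub>A\<^esub> a) <#>\<^bsub>A\<^esub> (H #>\<^bsub>A\<^esub> b)"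
  proof
    fix x assume "x \<in> H #>\<^bsub>A\<^esub> (a \<otimes>\<^bsub>A\<^esub> b)"
    then obtain h where h: "h \<in> H" "x = h \<otimes>\<^bsub>A\<^esub> (a \<otimes>\<^bsub>A\<^esub> b)" by (auto simp: r_coset_def)
    then have "x = (h \<otimes>\<^bsub>A\<^esub> a) \<otimes>\<^bsub>A\<^esub> (\<one>\<^bsub>A\<^esub> \<otimes>\<^bsub>A\<^esub> b)"
      using swap [of h "\<one>\<^bsub>A\<^esub>"] H.mem_carrier by simp
    then show "x \<in> (H #>\<^bsub>A\<^esub> a) <#>\<^bsub>A\<^esub> (H #>\<^bsub>A\<^esub> b)"
      using h H.one_closed unfolding r_coset_def set_mult_def by blast
  qed
  moreover have "(H #>\<^bsub>A\<^esub> a) <#>\<^bsub>A\<^esub> (H #>\<^bsub>A\<^esub> b) \<subseteq> H #>\<^bsub>A\<^esub> (a \<otimes>\<^bsub>A\<^esub> b)"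
    using swap H.m_closed by (auto simp: r_coset_def set_mult_def)
  ultimately show ?thesis by (auto simp: FactGroup_def)
qed

text \<open>
  The library's \<^const>\<open>sum_group\<close> closes under inverses and so is only meant for groups.
\<close>

definition direct_sum_monoid :: "'i set \<Rightarrow> ('i \<Rightarrow> ('a, 'b) monoid_scheme) \<Rightarrow> ('i \<Rightarrow> 'a) monoid"
  where "direct_sum_monoid I M =
    (product_group I M)
      \<lparr>carrier := {x \<in> carrier (product_group I M). finite {i \<in> I. x i \<noteq> \<one>\<^bsub>M i\<^esub>}}\<rparr>"

text \<open>
  Adjoining an identity is realised on the option type, \<^const>\<open>None\<close> being the new identity element.
\<close>

definition adjoin_identity :: "('a, 'b) monoid_scheme \<Rightarrow> 'a option monoid"
  where "adjoin_identity G =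
    \<lparr>carrier = insert None (Some ` carrier G),
     monoid.mult = (\<lambda>x y. case x of None \<Rightarrow> y
                     | Some a \<Rightarrow> (case y of None \<Rightarrow> x | Some b \<Rightarrow> Some (a \<otimes>\<^bsub>G\<^esub> b))),
     one = None\<rparr>"

definition real_group :: "real monoid"
  where "real_group = \<lparr>carrier = UNIV, monoid.mult = (+), one = 0\<rparr>"


section \<open>Subrings of a field\<close>

text \<open>
  All rings are subrings of one ambient field \<^term>\<open>L\<close>, given by their carriers; the ring with
  carrier \<^term>\<open>A\<close> is \<^term>\<open>L\<lparr>carrier := A\<rparr>\<close>.
\<close>

abbreviation nonzero :: "('a, 'b) ring_scheme \<Rightarrow> 'a set"
  where "nonzero L \<equiv> carrier L - {\<zero>\<^bsub>L\<^esub>}"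

definition fractions :: "('a, 'b) ring_scheme \<Rightarrow> 'a set \<Rightarrow> 'a set \<Rightarrow> 'a set"
  where "fractions L A S = {a \<otimes>\<^bsub>L\<^esub> inv\<^bsub>L\<^esub> s | a s. a \<in> A \<and> s \<in> S}"

definition fraction_field :: "('a, 'b) ring_scheme \<Rightarrow> 'a set \<Rightarrow> 'a set"
  where "fraction_field L A = fractions L A (A - {\<zero>\<^bsub>L\<^esub>})"

definition localization_at :: "('a, 'b) ring_scheme \<Rightarrow> 'a set \<Rightarrow> 'a set \<Rightarrow> 'a set"
  where "localization_at L A P = fractions L A (A - P)"

text \<open>Polynomials are lists of coefficients with the leading coefficient first.\<close>

definition integral_over :: "('a, 'b) ring_scheme \<Rightarrow> 'a set \<Rightarrow> 'a \<Rightarrow> bool"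
  where "integral_over L A x \<longleftrightarrow>
    (\<exists>p. polynomial\<^bsub>L\<^esub> A p \<and> p \<noteq> [] \<and> hd p = \<one>\<^bsub>L\<^esub> \<and> ring.eval L p x = \<zero>\<^bsub>L\<^esub>)"

definition integral_closure :: "('a, 'b) ring_scheme \<Rightarrow> 'a set \<Rightarrow> 'a set \<Rightarrow> 'a set"
  where "integral_closure L A E = {x \<in> E. integral_over L A x}"

text \<open>Fields count as Dedekind domains here.\<close>

definition dedekind_domain :: "('a, 'b) ring_scheme \<Rightarrow> 'a set \<Rightarrow> bool"
  where "dedekind_domain L A \<longleftrightarrow>
    noetherian_domain (L\<lparr>carrier := A\<rparr>) \<and>
    integral_closure L A (fraction_field L A) = A \<and>
    (\<forall>P. primeideal P (L\<lparr>carrier := A\<rparr>) \<and> P \<noteq> {\<zero>\<^bsub>L\<^esub>} \<longrightarrow> maximalideal P (L\<lparr>carrier := A\<rparr>))"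

definition max_ideals :: "('a, 'b) ring_scheme \<Rightarrow> 'a set \<Rightarrow> 'a set set"
  where "max_ideals L B = {P. maximalideal P (L\<lparr>carrier := B\<rparr>)}"

definition finite_character :: "('a, 'b) ring_scheme \<Rightarrow> 'a set \<Rightarrow> bool"
  where "finite_character L B \<longleftrightarrow>
    (\<forall>x \<in> B - {\<zero>\<^bsub>L\<^esub>}. finite {P \<in> max_ideals L B. x \<in> P})"


section \<open>Fractional ideals and class monoids\<close>

definition fractional_ideal :: "('a, 'b) ring_scheme \<Rightarrow> 'a set \<Rightarrow> 'a set \<Rightarrow> bool"
  where "fractional_ideal L B I \<longleftrightarrow>
    subgroup I (add_monoid L) \<and> (\<forall>b \<in> B. \<forall>x \<in> I. b \<otimes>\<^bsub>L\<^esub> x \<in> I) \<and>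
    I \<noteq> {\<zero>\<^bsub>L\<^esub>} \<and> (\<exists>d \<in> nonzero L. d <#\<^bsub>L\<^esub> I \<subseteq> B)"

text \<open>
  \<^term>\<open>ideal_prod L I J\<close> consists of all finite sums of products of elements of \<^term>\<open>I\<close> with
  elements of \<^term>\<open>J\<close>, the operations being those of \<^term>\<open>L\<close>.
\<close>

definition frac_ideal_monoid :: "('a, 'b) ring_scheme \<Rightarrow> 'a set \<Rightarrow> 'a set monoid"
  where "frac_ideal_monoid L B =
    \<lparr>carrier = {I. fractional_ideal L B I}, monoid.mult = ideal_prod L, one = B\<rparr>"

definition invertible_ideals :: "('a, 'b) ring_scheme \<Rightarrow> 'a set \<Rightarrow> 'a set set"
  where "invertible_ideals L B =
    {I. fractional_ideal L B I \<and> (\<exists>J. fractional_ideal L B J \<and> ideal_prod L I J = B)}"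

definition principal_ideals :: "('a, 'b) ring_scheme \<Rightarrow> 'a set \<Rightarrow> 'a set set"
  where "principal_ideals L B = {a <#\<^bsub>L\<^esub> B | a. a \<in> nonzero L}"

definition Cl :: "('a, 'b) ring_scheme \<Rightarrow> 'a set \<Rightarrow> 'a set set monoid"
  where "Cl L B = frac_ideal_monoid L B Mod principal_ideals L B"

definition Pic :: "('a, 'b) ring_scheme \<Rightarrow> 'a set \<Rightarrow> 'a set set monoid"
  where "Pic L B =
    (frac_ideal_monoid L B)\<lparr>carrier := invertible_ideals L B\<rparr> Mod principal_ideals L B"


section \<open>Valuations\<close>

text \<open>
  A valuation corresponds to \<^term>\<open>P\<close> if its valuation ring is the localization of \<^term>\<open>B\<close>
  at \<^term>\<open>P\<close>. Membership in \<^const>\<open>extensional\<close> makes the function, which is only meaningful on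
  the non-zero elements of \<^term>\<open>L\<close>, unique.
\<close>

definition normalized_valuation ::
    "('a, 'b) ring_scheme \<Rightarrow> 'a set \<Rightarrow> 'a set \<Rightarrow> 'a set \<Rightarrow> ('a \<Rightarrow> rat) \<Rightarrow> bool"
  where "normalized_valuation L K B P v \<longleftrightarrow>
    v \<in> extensional (nonzero L) \<and>
    (\<forall>x \<in> nonzero L. \<forall>y \<in> nonzero L. v (x \<otimes>\<^bsub>L\<^esub> y) = v x + v y) \<and>
    (\<forall>x \<in> nonzero L. \<forall>y \<in> nonzero L. x \<oplus>\<^bsub>L\<^esub> y \<noteq> \<zero>\<^bsub>L\<^esub> \<longrightarrow> v (x \<oplus>\<^bsub>L\<^esub> y) \<ge> min (v x) (v y)) \<and>
    insert \<zero>\<^bsub>L\<^esub> {x \<in> nonzero L. v x \<ge> 0} = localization_at L B P \<and>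
    v ` (K - {\<zero>\<^bsub>L\<^esub>}) = \<int>"

definition valuation_at :: "('a, 'b) ring_scheme \<Rightarrow> 'a set \<Rightarrow> 'a set \<Rightarrow> 'a set \<Rightarrow> 'a \<Rightarrow> rat"
  where "valuation_at L K B P = (THE v. normalized_valuation L K B P v)"

definition value_group :: "('a, 'b) ring_scheme \<Rightarrow> 'a set \<Rightarrow> 'a set \<Rightarrow> 'a set \<Rightarrow> real set"
  where "value_group L K B P = (\<lambda>x. of_rat (valuation_at L K B P x)) ` nonzero L"

end

theory Submission
  imports Defs
begin

text \<open>
  The ring \<open>\<OO>\<close> need not be noetherian, but it is the intersection of its localizations at the
  maximal ideals \<open>P\<close>, and these are valuation rings with values in \<open>\<rat>\<close>. Once the valuations \<open>v\<^sub>P\<close>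
  are known, the theorem is a computation with real numbers.

  To find the valuation at \<open>P\<close>, let \<open>p = P \<inter> \<oo>\<close>. A root \<open>x\<close> of a polynomial over \<open>\<oo>\<close> with a coefficient outside
  \<open>p\<close> lies in the localization at \<open>P\<close>, or its inverse does: the values at \<open>x\<close> of the leading segments
  of the polynomial are integral over \<open>\<oo>\<close>, and the coefficients are differences of such values and
  their multiples by \<open>x\<close> (\<open>integral_over_eval_prefix\<close>, \<open>V_total\<close>). Two of the terms of a vanishing
  polynomial expression must have the same value; so a power of \<open>x\<close> has the value of an element of
  \<open>K\<close>, that is of a power of a uniformizer of \<open>\<oo>\<close> at \<open>p\<close>, and the value of \<open>x\<close> is rational
  (\<open>commensurable_or_dominant_term\<close>, \<open>exists_normalized_valuation\<close>).

  A fractional ideal \<open>I\<close> is determined by its sets of values \<open>v\<^sub>P(I)\<close>. Each of these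
  is upward closed in the value group, hence given by its infimum \<open>ord P I\<close> and by whether this
  infimum is attained, \<open>att P I\<close> (\<open>frac_eqI\<close>). For a product of ideals the infima add up, and the
  infimum is attained if and only if it is so for both factors (\<open>ord_ideal_prod\<close>, \<open>att_ideal_prod\<close>).
  An infimum can fail to be attained only if the value group is dense in \<open>\<real>\<close>. If \<open>\<OO>\<close> has finite
  character then, subject to these constraints, all data which are trivial at almost all \<open>P\<close> belong
  to a fractional ideal (\<open>exists_fractional_ideal\<close>).

  Suppose that \<open>\<OO>\<close> has finite character. Negating all infima and keeping the information which of
  them are attained yields for each \<open>I\<close> an ideal \<open>J\<close> with \<open>I J I = I\<close>. The invertible ideals are those
  whose infima are all attained; modulo these there remain, at finitely many \<open>P\<close> with dense value
  group, the classes modulo \<open>v\<^sub>P(L\<^sup>\<times>)\<close> of the infima that are not attained. The adjoined identity stands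
  for an attained infimum. This is the isomorphism (\<open>cut_class\<close>).

  Conversely, let \<open>x \<noteq> 0\<close> lie in infinitely many maximal ideals. As values
  are archimedean, idempotents modulo \<open>x\<close> separate these maximal ideals
  (\<open>separating_idempotent\<close>), so there is an infinite strictly decreasing sequence of supports of
  such idempotents. The elements of \<open>\<OO>\<close> that are divisible by \<open>x\<close> on one of these supports form an
  ideal whose infima are all attained, but no finite set of elements attains all of them. For an ideal
  with a regular class this is impossible (\<open>finitely_attained_if_regular\<close>).
\<close>

section \<open>Noetherian submodules of a ring\<close>

text \<open>
  Ideals of a subring \<open>A\<close>, modules generated over \<open>A\<close> by integral elements and fractional ideals are all
  submodules of one ambient ring, on a par with each other.
\<close>

definition submodule_of :: "('a, 'b) ring_scheme \<Rightarrow> 'a set \<Rightarrow> 'a set \<Rightarrow> bool"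
  where "submodule_of R A N \<longleftrightarrow> N \<subseteq> carrier R \<and> \<zero>\<^bsub>R\<^esub> \<in> N \<and>
    (\<forall>x \<in> N. \<forall>y \<in> N. x \<oplus>\<^bsub>R\<^esub> y \<in> N) \<and> (\<forall>a \<in> A. \<forall>x \<in> N. a \<otimes>\<^bsub>R\<^esub> x \<in> N)"

text \<open>
  The ascending chain condition is used for ideals of the base ring and, through sums and multiples of
  these, for modules generated by finitely many monomials in integral elements.
\<close>

definition noetherian_submodule :: "('a, 'b) ring_scheme \<Rightarrow> 'a set \<Rightarrow> 'a set \<Rightarrow> bool"
  where "noetherian_submodule R A N \<longleftrightarrow> submodule_of R A N \<and>
    (\<forall>C :: nat \<Rightarrow> 'a set. (\<forall>n. submodule_of R A (C n) \<and> C n \<subseteq> C (Suc n) \<and> C n \<subseteq> N) \<longrightarrow>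
      (\<exists>n. \<forall>m \<ge> n. C m = C n))"

lemma submodule_ofD:
  assumes "submodule_of R A N"
  shows "\<And>x. x \<in> N \<Longrightarrow> x \<in> carrier R" "\<zero>\<^bsub>R\<^esub> \<in> N"
    "\<And>x y. x \<in> N \<Longrightarrow> y \<in> N \<Longrightarrow> x \<oplus>\<^bsub>R\<^esub> y \<in> N"
    "\<And>a x. a \<in> A \<Longrightarrow> x \<in> N \<Longrightarrow> a \<otimes>\<^bsub>R\<^esub> x \<in> N"
  using assms by (auto simp: submodule_of_def)

lemma submodule_ofI:
  assumes "\<And>x. x \<in> N \<Longrightarrow> x \<in> carrier R" "\<zero>\<^bsub>R\<^esub> \<in> N"
    "\<And>x y. x \<in> N \<Longrightarrow> y \<in> N \<Longrightarrow> x \<oplus>\<^bsub>R\<^esub> y \<in> N"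
    "\<And>a x. a \<in> A \<Longrightarrow> x \<in> N \<Longrightarrow> a \<otimes>\<^bsub>R\<^esub> x \<in> N"
  shows "submodule_of R A N"
  using assms by (auto simp: submodule_of_def)

lemma noetherian_submoduleD:
  assumes "noetherian_submodule R A N"
    and "\<And>n :: nat. submodule_of R A (C n)" "\<And>n. C n \<subseteq> C (Suc n)" "\<And>n. C n \<subseteq> N"
  shows "\<exists>n. \<forall>m \<ge> n. C m = C n"
  using assms by (simp add: noetherian_submodule_def)

lemma noetherian_submoduleI:
  assumes "submodule_of R A N"
    and "\<And>C. (\<And>n :: nat. submodule_of R A (C n)) \<Longrightarrow> (\<And>n. C n \<subseteq> C (Suc n)) \<Longrightarrow>
      (\<And>m n. m \<le> n \<Longrightarrow> C m \<subseteq> C n) \<Longrightarrow> (\<And>n. C n \<subseteq> N) \<Longrightarrow> \<exists>n. \<forall>m \<ge> n. C m = C n"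
  shows "noetherian_submodule R A N"
  unfolding noetherian_submodule_def
proof (intro conjI allI impI)
  fix C :: "nat \<Rightarrow> 'a set"
  assume C: "\<forall>n. submodule_of R A (C n) \<and> C n \<subseteq> C (Suc n) \<and> C n \<subseteq> N"
  show "\<exists>n. \<forall>m \<ge> n. C m = C n"
  proof (rule assms(2))
    show "C m \<subseteq> C n" if "m \<le> n" for m n
      by (rule lift_Suc_mono_le[of C, OF _ that]) (use C in simp)
  qed (use C in simp_all)
qed (rule assms(1))

lemma noetherian_submodule_imp_submodule_of:
  "noetherian_submodule R A N \<Longrightarrow> submodule_of R A N"
  by (simp add: noetherian_submodule_def)

context ring
begin

lemma submodule_of_uminus:
  assumes A: "subring A R" and N: "submodule_of R A N" and x: "x \<in> N"
  shows "\<ominus> x \<in> N"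
proof -
  have "\<ominus> \<one> \<in> A" using subringE(3,5)[OF A] by simp
  then have "\<ominus> \<one> \<otimes> x \<in> N" using submodule_ofD(4)[OF N] x by blast
  then show ?thesis using submodule_ofD(1)[OF N x] by (simp add: l_minus)
qed

lemma submodule_of_minus:
  assumes A: "subring A R" and N: "submodule_of R A N" and "x \<in> N" "y \<in> N"
  shows "x \<ominus> y \<in> N"
  using submodule_of_uminus[OF A N] submodule_ofD(3)[OF N] assms by (simp add: a_minus_def)

lemma minus_plus_plus_cancel:
  assumes "x \<in> carrier R" "y \<in> carrier R" "z \<in> carrier R"
  shows "(x \<ominus> z) \<oplus> (z \<oplus> y) = x \<oplus> y"
  using assms by (simp add: a_minus_def a_ac r_neg r_neg1 r_neg2)

lemma submodule_of_self:
  assumes A: "subring A R" shows "submodule_of R A A"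
  by (rule submodule_ofI)
     (use subringE(1)[OF A] subringE(2,6,7)[OF A] in auto)

lemma submodule_of_sum:
  assumes M: "submodule_of R A M" and N: "submodule_of R A N" and A: "A \<subseteq> carrier R"
  shows "submodule_of R A {x \<oplus> y | x y. x \<in> M \<and> y \<in> N}"
proof (rule submodule_ofI)
  note D = submodule_ofD[OF M] submodule_ofD[OF N]
  show "x \<in> carrier R" if "x \<in> {x \<oplus> y | x y. x \<in> M \<and> y \<in> N}" for x
    using that D(1,5) by auto
  have "\<zero> = \<zero> \<oplus> \<zero>" by simp
  then show "\<zero> \<in> {x \<oplus> y | x y. x \<in> M \<and> y \<in> N}" using D(2,6) by blast
  show "x \<oplus> y \<in> {x \<oplus> y | x y. x \<in> M \<and> y \<in> N}"
    if xy: "x \<in> {x \<oplus> y | x y. x \<in> M \<and> y \<in> N}" "y \<in> {x \<oplus> y | x y. x \<in> M \<and> y \<in> N}" for x y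
  proof -
    obtain a b c d where e: "a \<in> M" "b \<in> N" "c \<in> M" "d \<in> N" "x = a \<oplus> b" "y = c \<oplus> d" using xy by auto
    have "x \<oplus> y = (a \<oplus> c) \<oplus> (b \<oplus> d)" using e D(1,5) by (simp add: a_ac)
    moreover have "a \<oplus> c \<in> M" "b \<oplus> d \<in> N" using e D(3,7) by auto
    ultimately show ?thesis by blast
  qed
  show "a \<otimes> x \<in> {x \<oplus> y | x y. x \<in> M \<and> y \<in> N}"
    if ax: "a \<in> A" "x \<in> {x \<oplus> y | x y. x \<in> M \<and> y \<in> N}" for a x
  proof -
    obtain c d where e: "c \<in> M" "d \<in> N" "x = c \<oplus> d" using ax by auto
    have "a \<in> carrier R" "c \<in> carrier R" "d \<in> carrier R" using e D(1,5) ax A by auto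
    then have "a \<otimes> x = (a \<otimes> c) \<oplus> (a \<otimes> d)" using e by (simp add: r_distr)
    moreover have "a \<otimes> c \<in> M" "a \<otimes> d \<in> N" using e D(4,8) ax by auto
    ultimately show ?thesis by blast
  qed
qed

text \<open>A chain in \<open>M + N\<close> is governed by its traces on \<open>M\<close> and, modulo \<open>M\<close>, on \<open>N\<close>.\<close>

lemma noetherian_submodule_sum:
  assumes M: "noetherian_submodule R A M" and N: "noetherian_submodule R A N"
    and A: "subring A R"
  shows "noetherian_submodule R A {x \<oplus> y | x y. x \<in> M \<and> y \<in> N}" (is "noetherian_submodule R A ?S")
proof (rule noetherian_submoduleI)
  have AR: "A \<subseteq> carrier R" using subringE(1)[OF A] .
  note sM = noetherian_submodule_imp_submodule_of[OF M] and sN = noetherian_submodule_imp_submodule_of[OF N]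
  show "submodule_of R A ?S" by (rule submodule_of_sum[OF sM sN AR])
  fix C :: "nat \<Rightarrow> 'a set"
  assume C: "\<And>n. submodule_of R A (C n)" "\<And>n. C n \<subseteq> C (Suc n)"
    and mono: "\<And>m n. m \<le> n \<Longrightarrow> C m \<subseteq> C n" and CS: "\<And>n. C n \<subseteq> ?S"
  note cD = submodule_ofD[OF C(1)]
  note D = submodule_ofD[OF sM] submodule_ofD[OF sN]
  define D1 where "D1 n = C n \<inter> M" for n
  define D2 where "D2 n = {y \<in> N. \<exists>x \<in> M. x \<oplus> y \<in> C n}" for n
  have "submodule_of R A (D1 n)" for n
    unfolding D1_def by (rule submodule_ofI) (use cD D(1-4) in auto)
  moreover have "D1 n \<subseteq> D1 (Suc n)" "D1 n \<subseteq> M" for n using C(2)[of n] by (auto simp: D1_def)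
  ultimately obtain n1 where n1: "\<forall>m\<ge>n1. D1 m = D1 n1" using noetherian_submoduleD[OF M, of D1] by blast
  have sub2: "submodule_of R A (D2 n)" for n
  proof (rule submodule_ofI)
    show "\<zero> \<in> D2 n" unfolding D2_def using D(2,6) cD(2)[of n] r_zero[OF zero_closed] by force
    show "x \<oplus> y \<in> D2 n" if xy: "x \<in> D2 n" "y \<in> D2 n" for x y
    proof -
      obtain a b where e: "a \<in> M" "b \<in> M" "a \<oplus> x \<in> C n" "b \<oplus> y \<in> C n" "x \<in> N" "y \<in> N"
        using xy by (auto simp: D2_def)
      have "a \<in> carrier R" "b \<in> carrier R" "x \<in> carrier R" "y \<in> carrier R" using e D(1,5) by auto
      then have "(a \<oplus> b) \<oplus> (x \<oplus> y) = (a \<oplus> x) \<oplus> (b \<oplus> y)" by (simp add: a_ac)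
      then have "(a \<oplus> b) \<oplus> (x \<oplus> y) \<in> C n" using cD(3) e by simp
      moreover have "a \<oplus> b \<in> M" "x \<oplus> y \<in> N" using e D(3,7) by auto
      ultimately show ?thesis unfolding D2_def by blast
    qed
    show "a \<otimes> x \<in> D2 n" if xy: "a \<in> A" "x \<in> D2 n" for a x
    proof -
      obtain b where e: "b \<in> M" "b \<oplus> x \<in> C n" "x \<in> N"
        using xy by (auto simp: D2_def)
      have "a \<in> carrier R" "b \<in> carrier R" "x \<in> carrier R" using e D(1,5) AR xy by auto
      then have "(a \<otimes> b) \<oplus> (a \<otimes> x) = a \<otimes> (b \<oplus> x)" by (simp add: r_distr)
      then have "(a \<otimes> b) \<oplus> (a \<otimes> x) \<in> C n" using cD(4) e xy by simp
      moreover have "a \<otimes> b \<in> M" "a \<otimes> x \<in> N" using e D(4,8) xy by auto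
      ultimately show ?thesis unfolding D2_def by blast
    qed
  qed (use D(5) in \<open>auto simp: D2_def\<close>)
  have "D2 n \<subseteq> D2 (Suc n)" "D2 n \<subseteq> N" for n using C(2)[of n] by (auto simp: D2_def)
  then obtain n2 where n2: "\<forall>m\<ge>n2. D2 m = D2 n2" using noetherian_submoduleD[OF N, of D2] sub2 by blast
  define k where "k = max n1 n2"
  have "C m = C k" if m: "m \<ge> k" for m
  proof
    show "C k \<subseteq> C m" using mono m by simp
    show "C m \<subseteq> C k"
    proof
      fix z assume z: "z \<in> C m"
      then obtain x y where xy: "x \<in> M" "y \<in> N" "z = x \<oplus> y" using CS[of m] by blast
      then have "y \<in> D2 m" using z by (auto simp: D2_def)
      also have "D2 m = D2 k" using n2 m k_def by (metis max.bounded_iff order.refl)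
      finally obtain x' where x': "x' \<in> M" "x' \<oplus> y \<in> C k" by (auto simp: D2_def)
      have c: "x \<in> carrier R" "y \<in> carrier R" "x' \<in> carrier R" using xy x' D(1,5) by auto
      have "z \<ominus> (x' \<oplus> y) \<in> C m"
        using submodule_of_minus[OF A C(1) z] x' mono[OF m] by blast
      moreover have "z \<ominus> (x' \<oplus> y) = x \<ominus> x'"
        using c unfolding xy by (simp add: a_minus_def minus_add a_ac r_neg r_neg1 r_neg2)
      ultimately have "x \<ominus> x' \<in> D1 m"
        using submodule_of_minus[OF A sM] xy x' by (auto simp: D1_def)
      also have "D1 m = D1 k" using n1 m k_def by (metis max.bounded_iff order.refl)
      finally have "x \<ominus> x' \<in> C k" by (simp add: D1_def)
      then have "(x \<ominus> x') \<oplus> (x' \<oplus> y) \<in> C k" using cD(3) x' by simp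
      moreover have "(x \<ominus> x') \<oplus> (x' \<oplus> y) = z"
        using minus_plus_plus_cancel c unfolding xy by simp
      ultimately show "z \<in> C k" by simp
    qed
  qed
  then show "\<exists>n. \<forall>m\<ge>n. C m = C n" by blast
qed

end

context cring
begin

text \<open>
  Additive inverses in a submodule are multiples by \<open>-1\<close>, so closure under negation follows.
\<close>

lemma ideal_iff_submodule_of:
  assumes A: "subring A R"
  shows "ideal I (R\<lparr>carrier := A\<rparr>) \<longleftrightarrow> submodule_of R A I \<and> I \<subseteq> A"
proof
  interpret S: ring "R\<lparr>carrier := A\<rparr>" by (rule subring_is_ring[OF A])
  have AR: "A \<subseteq> carrier R" using subringE(1)[OF A] .
  {
    assume I: "ideal I (R\<lparr>carrier := A\<rparr>)"
    interpret I: ideal I "R\<lparr>carrier := A\<rparr>" by (rule I)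
    have "I \<subseteq> A" using I.a_subset by simp
    moreover have "submodule_of R A I"
      using \<open>I \<subseteq> A\<close> AR I.zero_closed I.a_closed I.I_l_closed by (intro submodule_ofI) auto
    ultimately show "submodule_of R A I \<and> I \<subseteq> A" by simp
  }
  assume I: "submodule_of R A I \<and> I \<subseteq> A"
  note D = submodule_ofD[OF conjunct1[OF I]]
  show "ideal I (R\<lparr>carrier := A\<rparr>)"
  proof (rule idealI[OF S.ring_axioms])
    have "inv\<^bsub>add_monoid (R\<lparr>carrier := A\<rparr>)\<^esub> x \<in> I" if x: "x \<in> I" for x
    proof -
      have "\<ominus> x \<in> I" using submodule_of_uminus[OF A conjunct1[OF I] x] .
      moreover have "\<ominus>\<^bsub>R\<lparr>carrier := A\<rparr>\<^esub> x = \<ominus> x"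
      proof (rule S.minus_equality)
        show "\<ominus> x \<oplus>\<^bsub>R\<lparr>carrier := A\<rparr>\<^esub> x = \<zero>\<^bsub>R\<lparr>carrier := A\<rparr>\<^esub>" using D(1)[OF x] by (simp add: l_neg)
      qed (use I x \<open>\<ominus> x \<in> I\<close> in auto)
      ultimately show ?thesis by (simp add: a_inv_def)
    qed
    then show "subgroup I (add_monoid (R\<lparr>carrier := A\<rparr>))"
      using I D by (auto intro!: subgroup.intro)
    show xa: "a \<otimes>\<^bsub>R\<lparr>carrier := A\<rparr>\<^esub> x \<in> I" if "x \<in> I" "a \<in> carrier (R\<lparr>carrier := A\<rparr>)" for x a
      using D(4) that by simp
    show "x \<otimes>\<^bsub>R\<lparr>carrier := A\<rparr>\<^esub> a \<in> I" if "x \<in> I" "a \<in> carrier (R\<lparr>carrier := A\<rparr>)" for x a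
    proof -
      have "x \<in> carrier R" "a \<in> carrier R" using that D(1) AR by auto
      then show ?thesis using xa[OF that] by (simp add: m_comm)
    qed
  qed
qed

lemma noetherian_submodule_self:
  assumes A: "subring A R" and N: "noetherian_ring (R\<lparr>carrier := A\<rparr>)"
  shows "noetherian_submodule R A A"
proof (rule noetherian_submoduleI)
  show "submodule_of R A A" by (rule submodule_of_self[OF A])
  fix C :: "nat \<Rightarrow> 'a set"
  assume C: "\<And>n. submodule_of R A (C n)" "\<And>n. C n \<subseteq> C (Suc n)"
    and mono: "\<And>m n. m \<le> n \<Longrightarrow> C m \<subseteq> C n" and CS: "\<And>n. C n \<subseteq> A"
  have "subset.chain {I. ideal I (R\<lparr>carrier := A\<rparr>)} (range C)"
  proof -
    have "range C \<subseteq> {I. ideal I (R\<lparr>carrier := A\<rparr>)}"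
      using C CS by (simp add: ideal_iff_submodule_of[OF A] image_subset_iff)
    moreover have "C m \<subset> C n \<or> C m = C n \<or> C n \<subset> C m" for m n
      using mono[of m n] mono[of n m] linear[of m n] by blast
    ultimately show ?thesis unfolding subset.chain_def by auto
  qed
  then have "\<Union> (range C) \<in> range C"
    using noetherian_ring.ideal_chain_is_trivial[OF N] by blast
  then obtain n where "\<Union> (range C) = C n" by auto
  then have "\<forall>m\<ge>n. C m = C n" using mono by blast
  then show "\<exists>n. \<forall>m\<ge>n. C m = C n" by blast
qed

lemma submodule_of_scale:
  assumes N: "submodule_of R A N" and x: "x \<in> carrier R" and A: "A \<subseteq> carrier R"
  shows "submodule_of R A ((\<otimes>) x ` N)"
proof (rule submodule_ofI)
  note D = submodule_ofD[OF N]
  show "z \<in> carrier R" if "z \<in> (\<otimes>) x ` N" for z using that D(1) x by auto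
  have "\<zero> = x \<otimes> \<zero>" using x by simp
  then show "\<zero> \<in> (\<otimes>) x ` N" using D(2) by blast
  show "y \<oplus> z \<in> (\<otimes>) x ` N" if yz: "y \<in> (\<otimes>) x ` N" "z \<in> (\<otimes>) x ` N" for y z
  proof -
    obtain a b where e: "a \<in> N" "b \<in> N" "y = x \<otimes> a" "z = x \<otimes> b" using yz by auto
    then have "y \<oplus> z = x \<otimes> (a \<oplus> b)" using D(1) x by (simp add: r_distr)
    then show ?thesis using e D(3) by blast
  qed
  show "a \<otimes> z \<in> (\<otimes>) x ` N" if az: "a \<in> A" "z \<in> (\<otimes>) x ` N" for a z
  proof -
    obtain y where y: "y \<in> N" "z = x \<otimes> y" using az by blast
    have "a \<in> carrier R" "y \<in> carrier R" using y az A D(1) by auto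
    then have "a \<otimes> z = x \<otimes> (a \<otimes> y)" using y x by (simp add: m_lcomm)
    then show ?thesis using y D(4) az by blast
  qed
qed

lemma noetherian_submodule_scale:
  assumes N: "noetherian_submodule R A N" and x: "x \<in> carrier R" and A: "A \<subseteq> carrier R"
  shows "noetherian_submodule R A ((\<otimes>) x ` N)"
proof (rule noetherian_submoduleI)
  note sN = noetherian_submodule_imp_submodule_of[OF N]
  note D = submodule_ofD[OF sN]
  show "submodule_of R A ((\<otimes>) x ` N)" by (rule submodule_of_scale[OF sN x A])
  fix C :: "nat \<Rightarrow> 'a set"
  assume C: "\<And>n. submodule_of R A (C n)" "\<And>n. C n \<subseteq> C (Suc n)"
    and mono: "\<And>m n. m \<le> n \<Longrightarrow> C m \<subseteq> C n" and CS: "\<And>n. C n \<subseteq> (\<otimes>) x ` N"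
  note cD = submodule_ofD[OF C(1)]
  define E where "E n = {y \<in> N. x \<otimes> y \<in> C n}" for n
  have CE: "C n = (\<otimes>) x ` E n" for n
  proof -
    have "C n \<subseteq> (\<otimes>) x ` N" using CS .
    then show ?thesis unfolding E_def by blast
  qed
  have "submodule_of R A (E n)" for n
  proof (rule submodule_ofI)
    show "\<zero> \<in> E n" using D(2) cD(2) x by (simp add: E_def)
    show "y \<oplus> z \<in> E n" if "y \<in> E n" "z \<in> E n" for y z
      using that D(1,3) cD(3) x by (simp add: E_def r_distr)
    show "a \<otimes> y \<in> E n" if "a \<in> A" "y \<in> E n" for a y
    proof -
      have "a \<in> carrier R" "y \<in> carrier R" using that D A by (auto simp: E_def)
      then have "x \<otimes> (a \<otimes> y) = a \<otimes> (x \<otimes> y)" using x by (simp add: m_lcomm)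
      then show ?thesis using that D(4) cD(4) by (simp add: E_def)
    qed
  qed (use D(1) in \<open>auto simp: E_def\<close>)
  moreover have "E n \<subseteq> E (Suc n)" "E n \<subseteq> N" for n using C(2)[of n] by (auto simp: E_def)
  ultimately obtain n where "\<forall>m\<ge>n. E m = E n" using noetherian_submoduleD[OF N, of E] by blast
  then show "\<exists>n. \<forall>m\<ge>n. C m = C n" unfolding CE by metis
qed

end

section \<open>Integral elements over a noetherian ring\<close>

text \<open>
  This is the span \<open>N + x N + \<dots> + x\<^bsup>n-1\<^esup> N\<close>; the recursion follows Horner's scheme.
\<close>

primrec power_span :: "('a, 'b) ring_scheme \<Rightarrow> 'a set \<Rightarrow> 'a \<Rightarrow> nat \<Rightarrow> 'a set"
  where "power_span R N x 0 = {\<zero>\<^bsub>R\<^esub>}"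
  | "power_span R N x (Suc n) = {a \<oplus>\<^bsub>R\<^esub> b | a b. a \<in> N \<and> b \<in> (\<otimes>\<^bsub>R\<^esub>) x ` power_span R N x n}"

declare power_span.simps(2) [simp del]

context cring
begin

text \<open>
  The span is built from the zero module by multiplication by \<open>x\<close> and addition of \<open>N\<close>, both of which
  preserve the chain condition.
\<close>

lemma noetherian_power_span:
  assumes "noetherian_submodule R A N" and "subring A R" and "x \<in> carrier R"
  shows "noetherian_submodule R A (power_span R N x n)"
proof (induction n)
  case 0
  show ?case
  proof (rule noetherian_submoduleI)
    show "submodule_of R A (power_span R N x 0)"
      using subringE(1)[OF assms(2)] by (intro submodule_ofI) auto
    fix C :: "nat \<Rightarrow> 'a set"
    assume C: "\<And>n. submodule_of R A (C n)" "\<And>n. C n \<subseteq> power_span R N x 0"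
    have "C n = {\<zero>}" for n using C(2)[of n] submodule_ofD(2)[OF C(1)[of n]] by auto
    then show "\<exists>n. \<forall>m\<ge>n. C m = C n" by simp
  qed
next
  case (Suc n)
  show ?case
    using noetherian_submodule_sum[OF assms(1)
        noetherian_submodule_scale[OF Suc assms(3) subringE(1)[OF assms(2)]] assms(2)] by (simp add: power_span.simps(2))
qed

lemma submodule_of_power_span:
  assumes N: "submodule_of R A N" and A: "A \<subseteq> carrier R" and x: "x \<in> carrier R"
  shows "submodule_of R A (power_span R N x n)"
proof (induction n)
  case 0
  show ?case using A by (intro submodule_ofI) auto
next
  case (Suc n)
  show ?case using submodule_of_sum[OF N submodule_of_scale[OF Suc x A] A] by (simp add: power_span.simps(2))
qed

lemma power_span_closed:
  assumes N: "N \<subseteq> carrier R" and x: "x \<in> carrier R"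
  shows "power_span R N x n \<subseteq> carrier R"
proof (induction n)
  case (Suc n)
  have "a \<oplus> x \<otimes> b \<in> carrier R" if "a \<in> N" "b \<in> power_span R N x n" for a b
    using that Suc x N by (auto intro!: a_closed m_closed)
  then show ?case by (auto simp: power_span.simps(2))
qed simp

lemma power_span_SucI:
  "a \<in> N \<Longrightarrow> b \<in> power_span R N x n \<Longrightarrow> a \<oplus> x \<otimes> b \<in> power_span R N x (Suc n)"
  by (auto simp: power_span.simps(2))

lemma power_span_SucE:
  assumes "z \<in> power_span R N x (Suc n)"
  obtains a b where "a \<in> N" "b \<in> power_span R N x n" "z = a \<oplus> x \<otimes> b"
  using assms by (auto simp: power_span.simps(2))

text \<open>
  Multiplication by \<open>y\<close> commutes with \<open>x\<close>, so it acts on the coefficients in \<open>N\<close> only.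
\<close>

lemma scale_power_span:
  assumes y: "y \<in> carrier R" and N: "N \<subseteq> carrier R" and x: "x \<in> carrier R"
    and st: "\<And>a. a \<in> N \<Longrightarrow> y \<otimes> a \<in> M"
  shows "c \<in> power_span R N x n \<Longrightarrow> y \<otimes> c \<in> power_span R M x n"
proof (induction n arbitrary: c)
  case 0
  then show ?case using y by simp
next
  case (Suc n)
  obtain a b where ab: "a \<in> N" "b \<in> power_span R N x n" "c = a \<oplus> x \<otimes> b"
    using Suc.prems by (rule power_span_SucE)
  have "a \<in> carrier R" "b \<in> carrier R" using ab N power_span_closed[OF N x] by auto
  then have "y \<otimes> c = y \<otimes> a \<oplus> x \<otimes> (y \<otimes> b)" using ab x y by (simp add: r_distr m_lcomm)
  then show ?case using power_span_SucI[OF st Suc.IH] ab by simp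
qed

lemma power_span_mult_mono:
  assumes N: "submodule_of R A N" and x: "x \<in> carrier R" and A: "A \<subseteq> carrier R"
    and c: "c \<in> power_span R A x n" and a: "a \<in> N"
  shows "c \<otimes> a \<in> power_span R N x n"
proof -
  have aR: "a \<in> carrier R" using submodule_ofD(1)[OF N a] .
  have cR: "c \<in> carrier R" using power_span_closed[OF A x] c by auto
  have "a \<otimes> b \<in> N" if "b \<in> A" for b
    using submodule_ofD(4)[OF N that a] m_comm[of a b] aR that A by auto
  from scale_power_span[OF aR A x this c] show ?thesis using m_comm[OF aR cR] by simp
qed

text \<open>The defining recursion peels off the lowest power of \<open>x\<close>; this lemma peels off the highest one.\<close>

lemma power_span_Suc_top:
  assumes N: "submodule_of R A N" and x: "x \<in> carrier R"
  shows "z \<in> power_span R N x (Suc n) \<Longrightarrow>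
    \<exists>a \<in> N. \<exists>b \<in> power_span R N x n. z = x [^] n \<otimes> a \<oplus> b"
proof (induction n arbitrary: z)
  case 0
  then obtain a where "a \<in> N" "z = a \<oplus> x \<otimes> \<zero>" by (auto simp: power_span.simps)
  then show ?case using submodule_ofD(1)[OF N] x by simp
next
  case (Suc n)
  have NR: "N \<subseteq> carrier R" using submodule_ofD(1)[OF N] by auto
  obtain a b where ab: "a \<in> N" "b \<in> power_span R N x (Suc n)" "z = a \<oplus> x \<otimes> b"
    using Suc.prems by (rule power_span_SucE)
  obtain c d where cd: "c \<in> N" "d \<in> power_span R N x n" "b = x [^] n \<otimes> c \<oplus> d"
    using Suc.IH[OF ab(2)] by auto
  have R: "a \<in> carrier R" "c \<in> carrier R" "d \<in> carrier R"
    using ab cd NR power_span_closed[OF NR x] by auto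
  have "x \<otimes> (x [^] n \<otimes> c) = x [^] Suc n \<otimes> c"
    using x R by (simp add: m_assoc[symmetric] m_comm)
  then have "z = x [^] Suc n \<otimes> c \<oplus> (a \<oplus> x \<otimes> d)"
    using ab cd R x by (simp add: r_distr a_lcomm)
  then show ?case using cd ab power_span_SucI by blast
qed

lemma eval_mem_power_span:
  assumes A: "subring A R" and x: "x \<in> carrier R"
  shows "set p \<subseteq> A \<Longrightarrow> eval p x \<in> power_span R A x (length p)"
proof (induction p rule: rev_induct)
  case Nil
  then show ?case by simp
next
  case (snoc a p)
  have AR: "A \<subseteq> carrier R" using subringE(1)[OF A] .
  have p: "set p \<subseteq> carrier R" and a: "a \<in> A" using snoc.prems AR by auto
  have e: "eval p x \<in> carrier R" using eval_in_carrier[OF p x] .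
  have "eval (p @ [a]) x = a \<oplus> x \<otimes> eval p x"
    using eval_append_aux[OF p _ x, of a] a AR e x by (auto simp: m_comm a_comm)
  moreover have "eval p x \<in> power_span R A x (length p)" using snoc by simp
  ultimately show ?case using power_span_SucI[OF a] by simp
qed

lemma power_span_eval:
  assumes A: "subring A R" and x: "x \<in> carrier R"
  shows "z \<in> power_span R A x n \<Longrightarrow> \<exists>p. set p \<subseteq> A \<and> length p = n \<and> eval p x = z"
proof (induction n arbitrary: z)
  case (Suc n)
  have AR: "A \<subseteq> carrier R" using subringE(1)[OF A] .
  obtain a b where ab: "a \<in> A" "b \<in> power_span R A x n" "z = a \<oplus> x \<otimes> b"
    using Suc.prems by (rule power_span_SucE)
  obtain p where p: "set p \<subseteq> A" "length p = n" "eval p x = b" using Suc.IH ab by blast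
  have "b \<in> carrier R" using ab power_span_closed[OF AR x] by auto
  then have "eval (p @ [a]) x = z"
    using eval_append_aux[of p a x] p ab AR x by (auto simp: m_comm a_comm)
  then show ?case using p ab by (intro exI[of _ "p @ [a]"]) auto
qed simp

lemma integral_over_power_mem:
  assumes A: "subring A R" and x: "x \<in> carrier R" and i: "integral_over R A x" and nz: "\<one> \<noteq> \<zero>"
  obtains n where "x [^] (Suc n) \<in> power_span R A x (Suc n)"
proof -
  obtain p where p: "polynomial A p" "p \<noteq> []" "hd p = \<one>" "eval p x = \<zero>"
    using i by (auto simp: integral_over_def)
  obtain q where q: "p = \<one> # q" using p(2,3) by (cases p) auto
  have qA: "set q \<subseteq> A" using p(1) q by (auto simp: polynomial_def)
  have qR: "eval q x \<in> carrier R" using qA subringE(1)[OF A] eval_in_carrier x by auto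
  have "x [^] length q \<oplus> eval q x = \<zero>" using p(4) x by (simp add: q)
  then have e: "x [^] length q = \<ominus> eval q x" using qR x by (metis minus_equality a_comm nat_pow_closed minus_minus)
  have m: "x [^] length q \<in> power_span R A x (length q)"
    unfolding e using submodule_of_uminus[OF A submodule_of_power_span[OF submodule_of_self[OF A]
        subringE(1)[OF A] x] eval_mem_power_span[OF A x qA]] .
  then obtain n where "length q = Suc n" using nz by (cases "length q") auto
  then show ?thesis using m that by auto
qed

lemma integral_overI_power_mem:
  assumes A: "subring A R" and x: "x \<in> carrier R" and m: "x [^] n \<in> power_span R A x n"
    and nz: "\<one> \<noteq> \<zero>"
  shows "integral_over R A x"
proof -
  have s: "submodule_of R A (power_span R A x n)"
    by (rule submodule_of_power_span[OF submodule_of_self[OF A] subringE(1)[OF A] x])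
  obtain p where p: "set p \<subseteq> A" "length p = n" "eval p x = \<ominus> (x [^] n)"
    using power_span_eval[OF A x submodule_of_uminus[OF A s m]] by blast
  have "polynomial A (\<one> # p)" using p subringE(3)[OF A] nz by (simp add: polynomial_def)
  moreover have "eval (\<one> # p) x = \<zero>" using p x by (simp add: r_neg)
  ultimately show ?thesis unfolding integral_over_def by (intro exI[of _ "\<one> # p"]) auto
qed

text \<open>A monic relation of degree \<open>n\<close> rewrites the only new power \<open>x\<^sup>n\<close> that multiplication by \<open>x\<close> creates.\<close>

lemma power_span_stable:
  assumes A: "subring A R" and N: "submodule_of R A N" and x: "x \<in> carrier R"
    and m: "x [^] n \<in> power_span R A x n" and z: "z \<in> power_span R N x n"
  shows "x \<otimes> z \<in> power_span R N x n"
proof -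
  have AR: "A \<subseteq> carrier R" using subringE(1)[OF A] .
  have NR: "N \<subseteq> carrier R" using submodule_ofD(1)[OF N] by auto
  have zR: "z \<in> carrier R" using z power_span_closed[OF NR x] by auto
  have s: "submodule_of R A (power_span R N x n)" by (rule submodule_of_power_span[OF N AR x])
  have "x \<otimes> z = \<zero> \<oplus> x \<otimes> z" using x zR by simp
  then have "x \<otimes> z \<in> power_span R N x (Suc n)"
    using power_span_SucI[OF submodule_ofD(2)[OF N] z] by simp
  then obtain a b where ab: "a \<in> N" "b \<in> power_span R N x n" "x \<otimes> z = x [^] n \<otimes> a \<oplus> b"
    using power_span_Suc_top[OF N x] by blast
  show ?thesis unfolding ab(3)
    by (rule submodule_ofD(3)[OF s power_span_mult_mono[OF N x AR m ab(1)] ab(2)])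
qed

lemma subset_power_span_Suc:
  assumes N: "submodule_of R A N" and A: "A \<subseteq> carrier R" and x: "x \<in> carrier R"
  shows "N \<subseteq> power_span R N x (Suc n)"
proof
  fix a assume a: "a \<in> N"
  have "a \<oplus> x \<otimes> \<zero> \<in> power_span R N x (Suc n)"
    using power_span_SucI[OF a submodule_ofD(2)[OF submodule_of_power_span[OF N A x]]] .
  then show "a \<in> power_span R N x (Suc n)" using a x submodule_ofD(1)[OF N] by simp
qed

lemma power_span_mono:
  assumes N: "submodule_of R A N" and x: "x \<in> carrier R"
  shows "power_span R N x n \<subseteq> power_span R N x (Suc n)"
proof (induction n)
  case 0
  have "\<zero> \<oplus> x \<otimes> \<zero> \<in> power_span R N x (Suc 0)"
    by (rule power_span_SucI) (use submodule_ofD(2)[OF N] in auto)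
  then show ?case using x by simp
next
  case (Suc n)
  show ?case
  proof
    fix z assume "z \<in> power_span R N x (Suc n)"
    then obtain a b where "a \<in> N" "b \<in> power_span R N x n" "z = a \<oplus> x \<otimes> b"
      by (rule power_span_SucE)
    then show "z \<in> power_span R N x (Suc (Suc n))" using Suc power_span_SucI by blast
  qed
qed

end

context domain
begin

text \<open>
  The chain of the modules \<open>m A + m x A + \<dots> + m x\<^sup>n A\<close> runs inside \<open>N\<close>, hence becomes stationary, which
  expresses a power of \<open>x\<close> by lower ones.
\<close>

theorem integral_over_if_stable:
  assumes A: "subring A R" and N: "noetherian_submodule R A N" and x: "x \<in> carrier R"
    and m: "m \<in> N" "m \<noteq> \<zero>" and st: "\<And>a. a \<in> N \<Longrightarrow> x \<otimes> a \<in> N"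
  shows "integral_over R A x"
proof -
  have AR: "A \<subseteq> carrier R" using subringE(1)[OF A] .
  note sN = noetherian_submodule_imp_submodule_of[OF N]
  have mR: "m \<in> carrier R" using submodule_ofD(1)[OF sN m(1)] .
  have sA: "submodule_of R A A" by (rule submodule_of_self[OF A])
  define C where "C n = (\<otimes>) m ` power_span R A x n" for n
  have sub: "power_span R A x n \<subseteq> carrier R" for n by (rule power_span_closed[OF AR x])
  have CN: "m \<otimes> z \<in> N" if "z \<in> power_span R A x n" for z n
    using that
  proof (induction n arbitrary: z)
    case 0
    then show ?case using mR submodule_ofD(2)[OF sN] by simp
  next
    case (Suc n)
    obtain a b where ab: "a \<in> A" "b \<in> power_span R A x n" "z = a \<oplus> x \<otimes> b"
      using Suc.prems by (rule power_span_SucE)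
    have R: "a \<in> carrier R" "b \<in> carrier R" using ab AR sub by auto
    have "m \<otimes> z = a \<otimes> m \<oplus> x \<otimes> (m \<otimes> b)"
      using R mR x ab(3) by (simp add: r_distr m_lcomm m_comm)
    then show ?case
      using submodule_ofD(3,4)[OF sN] st[OF Suc.IH[OF ab(2)]] ab(1) m(1) by simp
  qed
  have "submodule_of R A (C n)" for n
    unfolding C_def by (rule submodule_of_scale[OF submodule_of_power_span[OF sA AR x] mR AR])
  moreover have "C n \<subseteq> C (Suc n)" for n
    unfolding C_def by (rule image_mono[OF power_span_mono[OF sA x]])
  moreover have "C n \<subseteq> N" for n using CN by (auto simp: C_def)
  ultimately obtain n where n: "\<forall>k\<ge>n. C k = C n" using noetherian_submoduleD[OF N, of C] by blast
  have one: "\<one> \<in> power_span R A x (Suc 0)" 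
    using subset_power_span_Suc[OF sA AR x] subringE(3)[OF A] by blast
  have "x [^] k \<in> power_span R A x (Suc k)" for k
  proof (induction k)
    case 0
    then show ?case using one by simp
  next
    case (Suc k)
    have "\<zero> \<oplus> x \<otimes> x [^] k \<in> power_span R A x (Suc (Suc k))"
      by (rule power_span_SucI[OF submodule_ofD(2)[OF sA] Suc])
    then show ?case using x by (simp add: m_comm)
  qed
  then have "m \<otimes> x [^] n \<in> C (Suc n)" by (simp add: C_def)
  moreover have "C (Suc n) = C n" by (rule n[rule_format]) simp
  ultimately have "m \<otimes> x [^] n \<in> C n" by simp
  then obtain z where z: "z \<in> power_span R A x n" "m \<otimes> x [^] n = m \<otimes> z" by (auto simp: C_def)
  then have "x [^] n = z" using m_lcancel[OF m(2) mR, of "x [^] n" z] x sub by auto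
  then have "x [^] n \<in> power_span R A x n" using z(1) by simp
  then show ?thesis by (rule integral_overI_power_mem[OF A x _ one_not_zero])
qed

text \<open>
  The two elements stabilise a common finitely generated module, namely the one spanned by the
  monomials \<open>x\<^sup>i y\<^sup>j\<close> of bounded degree; so does everything they generate.
\<close>

lemma integral_over_common_module:
  assumes A: "subring A R" and AN: "noetherian_ring (R\<lparr>carrier := A\<rparr>)"
    and x: "x \<in> carrier R" "integral_over R A x" and y: "y \<in> carrier R" "integral_over R A y"
  obtains N where "noetherian_submodule R A N" "\<one> \<in> N"
    "\<And>a. a \<in> N \<Longrightarrow> x \<otimes> a \<in> N" "\<And>a. a \<in> N \<Longrightarrow> y \<otimes> a \<in> N"
proof -
  have AR: "A \<subseteq> carrier R" using subringE(1)[OF A] .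
  have sA: "submodule_of R A A" by (rule submodule_of_self[OF A])
  obtain n where n: "y [^] (Suc n) \<in> power_span R A y (Suc n)"
    using integral_over_power_mem[OF A y one_not_zero] .
  obtain k where k: "x [^] (Suc k) \<in> power_span R A x (Suc k)"
    using integral_over_power_mem[OF A x one_not_zero] .
  define M where "M = power_span R A y (Suc n)"
  define N where "N = power_span R M x (Suc k)"
  have nM: "noetherian_submodule R A M"
    unfolding M_def by (rule noetherian_power_span[OF noetherian_submodule_self[OF A AN] A y(1)])
  note sM = noetherian_submodule_imp_submodule_of[OF nM]
  have MR: "M \<subseteq> carrier R" using submodule_ofD(1)[OF sM] by auto
  show ?thesis
  proof (rule that)
    show "noetherian_submodule R A N"
      unfolding N_def by (rule noetherian_power_span[OF nM A x(1)])
    show "\<one> \<in> N"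
      using subset_power_span_Suc[OF sM AR x(1)] subset_power_span_Suc[OF sA AR y(1)]
        subringE(3)[OF A] unfolding N_def M_def by blast
    show "x \<otimes> a \<in> N" if "a \<in> N" for a
      using power_span_stable[OF A sM x(1) k] that unfolding N_def by blast
    have "y \<otimes> a \<in> M" if "a \<in> M" for a
      using power_span_stable[OF A sA y(1) n] that unfolding M_def by blast
    then show "y \<otimes> a \<in> N" if "a \<in> N" for a
      using scale_power_span[OF y(1) MR x(1)] that unfolding N_def by blast
  qed
qed

lemma integral_over_self:
  assumes A: "subring A R" and x: "x \<in> A"
  shows "integral_over R A x"
proof (rule integral_overI_power_mem[OF A _ _ one_not_zero])
  have AR: "A \<subseteq> carrier R" using subringE(1)[OF A] .
  show xR: "x \<in> carrier R" using x AR by auto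
  show "x [^] (Suc 0) \<in> power_span R A x (Suc 0)"
    using subset_power_span_Suc[OF submodule_of_self[OF A] AR xR] x xR by auto
qed

text \<open>
  Sums, products and negatives of two integral elements stabilise their common module.
\<close>

lemma subring_integral_closure:
  assumes A: "subring A R" and AN: "noetherian_ring (R\<lparr>carrier := A\<rparr>)"
  shows "subring (integral_closure R A (carrier R)) R"
proof (rule subringI)
  show "integral_closure R A (carrier R) \<subseteq> carrier R" by (auto simp: integral_closure_def)
  show "\<one> \<in> integral_closure R A (carrier R)"
    using integral_over_self[OF A] subringE(3)[OF A] by (simp add: integral_closure_def)
next
  fix x y
  assume "x \<in> integral_closure R A (carrier R)" "y \<in> integral_closure R A (carrier R)"
  then have x: "x \<in> carrier R" "integral_over R A x" and y: "y \<in> carrier R" "integral_over R A y"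
    by (auto simp: integral_closure_def)
  obtain N where N: "noetherian_submodule R A N" "\<one> \<in> N"
    "\<And>a. a \<in> N \<Longrightarrow> x \<otimes> a \<in> N" "\<And>a. a \<in> N \<Longrightarrow> y \<otimes> a \<in> N"
    by (rule integral_over_common_module[OF A AN x y]) blast
  note sN = noetherian_submodule_imp_submodule_of[OF N(1)]
  note I = integral_over_if_stable[OF A N(1) _ N(2) one_not_zero]
  have NR: "a \<in> carrier R" if "a \<in> N" for a using submodule_ofD(1)[OF sN that] .
  have "integral_over R A (x \<oplus> y)"
  proof (rule I)
    show "(x \<oplus> y) \<otimes> a \<in> N" if "a \<in> N" for a
      using submodule_ofD(3)[OF sN N(3)[OF that] N(4)[OF that]] NR[OF that] x y by (simp add: l_distr)
  qed (use x y in simp)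
  then show "x \<oplus> y \<in> integral_closure R A (carrier R)" using x y by (simp add: integral_closure_def)
  have "integral_over R A (x \<otimes> y)"
  proof (rule I)
    show "(x \<otimes> y) \<otimes> a \<in> N" if "a \<in> N" for a
      using N(3)[OF N(4)[OF that]] NR[OF that] x y by (simp add: m_assoc)
  qed (use x y in simp)
  then show "x \<otimes> y \<in> integral_closure R A (carrier R)" using x y by (simp add: integral_closure_def)
  have "integral_over R A (\<ominus> x)"
  proof (rule I)
    show "\<ominus> x \<otimes> a \<in> N" if "a \<in> N" for a
      using submodule_of_uminus[OF A sN N(3)[OF that]] NR[OF that] x by (simp add: l_minus)
  qed (use x in simp)
  then show "\<ominus> x \<in> integral_closure R A (carrier R)" using x by (simp add: integral_closure_def)
qed

end

section \<open>Prime ideals and localizations of a subring of a field\<close>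

locale subring_of_field = field +
  fixes A
  assumes subring: "subring A R"
begin

lemma A_carrier: "a \<in> A \<Longrightarrow> a \<in> carrier R"
  using subringE(1)[OF subring] by auto

lemma A_closed [simp]:
  "\<zero> \<in> A" "\<one> \<in> A"
  "a \<in> A \<Longrightarrow> b \<in> A \<Longrightarrow> a \<oplus> b \<in> A"
  "a \<in> A \<Longrightarrow> b \<in> A \<Longrightarrow> a \<otimes> b \<in> A"
  "a \<in> A \<Longrightarrow> \<ominus> a \<in> A"
  "a \<in> A \<Longrightarrow> b \<in> A \<Longrightarrow> a \<ominus> b \<in> A"
  "a \<in> A \<Longrightarrow> a [^] (n :: nat) \<in> A"
proof -
  show p: "\<zero> \<in> A" "\<one> \<in> A" "a \<in> A \<Longrightarrow> b \<in> A \<Longrightarrow> a \<oplus> b \<in> A"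
    "a \<in> A \<Longrightarrow> b \<in> A \<Longrightarrow> a \<otimes> b \<in> A" "a \<in> A \<Longrightarrow> \<ominus> a \<in> A" for a b
    using subringE(2,3,5,6,7)[OF subring] by auto
  show "a \<in> A \<Longrightarrow> b \<in> A \<Longrightarrow> a \<ominus> b \<in> A" by (simp add: a_minus_def p)
  show "a \<in> A \<Longrightarrow> a [^] (n :: nat) \<in> A" by (induction n) (auto simp: p)
qed

text \<open>
  Ideals are handled through the operations of the ambient field, so that no computation takes place in
  the restricted ring.
\<close>

lemma primeideal_iff:
  "primeideal P (R\<lparr>carrier := A\<rparr>) \<longleftrightarrow> submodule_of R A P \<and> P \<subseteq> A \<and> \<one> \<notin> P \<and>
    (\<forall>a \<in> A. \<forall>b \<in> A. a \<otimes> b \<in> P \<longrightarrow> a \<in> P \<or> b \<in> P)" (is "_ \<longleftrightarrow> ?r")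
proof
  have cr: "cring (R\<lparr>carrier := A\<rparr>)"
    using subring_is_domain[OF subring] by (simp add: domain_def)
  {
    assume "primeideal P (R\<lparr>carrier := A\<rparr>)"
    then interpret P: primeideal P "R\<lparr>carrier := A\<rparr>" .
    have "ideal P (R\<lparr>carrier := A\<rparr>)" by (rule P.ideal_axioms)
    moreover have "\<one> \<notin> P" using P.one_imp_carrier P.I_notcarr by auto
    ultimately show ?r using P.I_prime by (auto simp: ideal_iff_submodule_of[OF subring])
  }
  assume r: ?r
  show "primeideal P (R\<lparr>carrier := A\<rparr>)"
    by (rule primeidealI) (use r cr ideal_iff_submodule_of[OF subring] in auto)
qed

lemma max_ideals_iff:
  "P \<in> max_ideals R A \<longleftrightarrow> submodule_of R A P \<and> P \<subset> A \<and>
    (\<forall>J. submodule_of R A J \<longrightarrow> P \<subseteq> J \<longrightarrow> J \<subseteq> A \<longrightarrow> J = P \<or> J = A)" (is "_ \<longleftrightarrow> ?r")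
proof
  {
    assume "P \<in> max_ideals R A"
    then interpret P: maximalideal P "R\<lparr>carrier := A\<rparr>" by (simp add: max_ideals_def)
    have "ideal P (R\<lparr>carrier := A\<rparr>)" by (rule P.ideal_axioms)
    then have "submodule_of R A P" "P \<subseteq> A" by (auto simp: ideal_iff_submodule_of[OF subring])
    moreover have "P \<noteq> A" using P.I_notcarr by auto
    moreover have "J = P \<or> J = A" if "submodule_of R A J" "P \<subseteq> J" "J \<subseteq> A" for J
      using P.I_maximal[of J] that by (auto simp: ideal_iff_submodule_of[OF subring])
    ultimately show ?r by blast
  }
  assume r: ?r
  have "maximalideal P (R\<lparr>carrier := A\<rparr>)"
    by (rule maximalidealI) (use r ideal_iff_submodule_of[OF subring] in auto)
  then show "P \<in> max_ideals R A" by (simp add: max_ideals_def)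
qed

lemma max_ideal_prime:
  assumes "P \<in> max_ideals R A" shows "primeideal P (R\<lparr>carrier := A\<rparr>)"
proof (rule cring.maximalideal_prime)
  show "cring (R\<lparr>carrier := A\<rparr>)" using subring_is_domain[OF subring] by (simp add: domain_def)
qed (use assms in \<open>simp add: max_ideals_def\<close>)

lemma primeidealD:
  assumes "primeideal P (R\<lparr>carrier := A\<rparr>)"
  shows "submodule_of R A P" "P \<subseteq> A" "\<one> \<notin> P" "\<zero> \<in> P"
    "\<And>a b. a \<in> A - P \<Longrightarrow> b \<in> A - P \<Longrightarrow> a \<otimes> b \<in> A - P"
    "\<And>a b. a \<in> P \<Longrightarrow> b \<in> A \<Longrightarrow> a \<otimes> b \<in> P"
    "\<And>a b. a \<in> A \<Longrightarrow> b \<in> P \<Longrightarrow> a \<otimes> b \<in> P"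
proof -
  have *: "submodule_of R A P" "P \<subseteq> A" "\<one> \<notin> P"
    "\<And>a b. a \<in> A \<Longrightarrow> b \<in> A \<Longrightarrow> a \<otimes> b \<in> P \<Longrightarrow> a \<in> P \<or> b \<in> P"
    using assms primeideal_iff by auto
  show "submodule_of R A P" "P \<subseteq> A" "\<one> \<notin> P" by fact+
  show "\<zero> \<in> P" using submodule_ofD(2)[OF *(1)] .
  show "a \<otimes> b \<in> A - P" if "a \<in> A - P" "b \<in> A - P" for a b using *(4)[of a b] that by auto
  show **: "a \<otimes> b \<in> P" if "a \<in> A" "b \<in> P" for a b using submodule_ofD(4)[OF *(1)] that by auto
  show "a \<otimes> b \<in> P" if "a \<in> P" "b \<in> A" for a b
    using **[OF that(2,1)] m_comm[of a b] that A_carrier *(2) by auto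
qed

text \<open>
  Zorn's lemma for the submodules of \<open>A\<close> that do not contain \<open>1\<close>.
\<close>

lemma max_ideal_above:
  assumes I: "submodule_of R A I" "I \<subseteq> A" "\<one> \<notin> I"
  obtains P where "P \<in> max_ideals R A" "I \<subseteq> P"
proof -
  define F where "F = {J. submodule_of R A J \<and> I \<subseteq> J \<and> J \<subseteq> A \<and> \<one> \<notin> J}"
  have "\<Union> C \<in> F" if C: "C \<noteq> {}" "subset.chain F C" for C
  proof -
    have CF: "J \<in> F" if "J \<in> C" for J using C that by (auto simp: subset.chain_def)
    then have sub: "submodule_of R A J" "I \<subseteq> J" "J \<subseteq> A" "\<one> \<notin> J" if "J \<in> C" for J
      using that by (auto simp: F_def)
    have lin: "J \<subseteq> J' \<or> J' \<subseteq> J" if "J \<in> C" "J' \<in> C" for J J'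
      using C(2) that by (auto simp: subset.chain_def)
    have "submodule_of R A (\<Union> C)"
    proof (rule submodule_ofI)
      show "\<zero> \<in> \<Union> C" using C(1) sub(1) submodule_ofD(2) by blast
      show "x \<oplus> y \<in> \<Union> C" if xy: "x \<in> \<Union> C" "y \<in> \<Union> C" for x y
      proof -
        obtain J J' where J: "J \<in> C" "x \<in> J" "J' \<in> C" "y \<in> J'" using xy by blast
        then obtain J'' where "J'' \<in> C" "x \<in> J''" "y \<in> J''" using lin[of J J'] by blast
        then show ?thesis using submodule_ofD(3)[OF sub(1)] by blast
      qed
      show "x \<in> carrier R" if "x \<in> \<Union> C" for x using that sub(3) A_carrier by blast
      show "a \<otimes> x \<in> \<Union> C" if "a \<in> A" "x \<in> \<Union> C" for a x
        using that submodule_ofD(4)[OF sub(1)] by blast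
    qed
    moreover have "I \<subseteq> \<Union> C" "\<Union> C \<subseteq> A" "\<one> \<notin> \<Union> C" using C(1) sub(2-4) by blast+
    ultimately show ?thesis by (simp add: F_def)
  qed
  moreover have "F \<noteq> {}" using I by (auto simp: F_def)
  ultimately obtain M where M: "M \<in> F" "\<forall>J\<in>F. M \<subseteq> J \<longrightarrow> J = M"
    using subset_Zorn_nonempty[of F] by blast
  have "P = A" if P: "submodule_of R A P" "P \<subseteq> A" "\<one> \<in> P" for P
  proof
    show "A \<subseteq> P"
    proof
      fix a assume "a \<in> A"
      then show "a \<in> P" using submodule_ofD(4)[OF P(1) \<open>a \<in> A\<close> P(3)] A_carrier by simp
    qed
  qed (rule P(2))
  moreover have "M \<noteq> A" using M(1) by (auto simp: F_def)
  moreover have "submodule_of R A M" "M \<subseteq> A" "I \<subseteq> M" using M(1) by (auto simp: F_def)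
  moreover have "J = M \<or> \<one> \<in> J" if "submodule_of R A J" "M \<subseteq> J" "J \<subseteq> A" for J
  proof (cases "\<one> \<in> J")
    case False
    then have "J \<in> F" using that \<open>I \<subseteq> M\<close> by (simp add: F_def)
    then show ?thesis using M(2) that by blast
  qed simp
  ultimately have "M \<in> max_ideals R A" unfolding max_ideals_iff by blast
  then show ?thesis using that \<open>I \<subseteq> M\<close> by blast
qed

text \<open>
  Membership is tested by a denominator \<open>s\<close>, which avoids inverses in later computations.
\<close>

lemma localization_at_iff:
  assumes P: "primeideal P (R\<lparr>carrier := A\<rparr>)"
  shows "x \<in> localization_at R A P \<longleftrightarrow> x \<in> carrier R \<and> (\<exists>s \<in> A - P. s \<otimes> x \<in> A)"
proof
  have nz: "s \<noteq> \<zero>" "s \<in> carrier R" "s \<in> Units R" if "s \<in> A - P" for s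
    using that primeidealD(4)[OF P] A_carrier field_Units by auto
  {
    assume "x \<in> localization_at R A P"
    then obtain a s where as: "a \<in> A" "s \<in> A - P" "x = a \<otimes> inv s"
      by (auto simp: localization_at_def fractions_def)
    have "s \<otimes> x = a" using as nz[OF as(2)] A_carrier[OF as(1)] by (simp add: m_lcomm)
    moreover have "x \<in> carrier R" using as nz[OF as(2)] A_carrier[OF as(1)] by simp
    ultimately show "x \<in> carrier R \<and> (\<exists>s \<in> A - P. s \<otimes> x \<in> A)"
      using as(1,2) by blast
  }
  assume "x \<in> carrier R \<and> (\<exists>s \<in> A - P. s \<otimes> x \<in> A)"
  then obtain s where s: "x \<in> carrier R" "s \<in> A - P" "s \<otimes> x \<in> A" by auto
  have "x = s \<otimes> x \<otimes> inv s" using s nz[OF s(2)] by (simp add: m_comm[of s x] m_assoc)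
  then show "x \<in> localization_at R A P"
    using s unfolding localization_at_def fractions_def by blast
qed

lemma fraction_field_iff:
  "x \<in> fraction_field R A \<longleftrightarrow> x \<in> carrier R \<and> (\<exists>s \<in> A - {\<zero>}. s \<otimes> x \<in> A)"
proof
  have nz: "s \<noteq> \<zero>" "s \<in> carrier R" "s \<in> Units R" if "s \<in> A - {\<zero>}" for s
    using that A_carrier field_Units by auto
  {
    assume "x \<in> fraction_field R A"
    then obtain a s where as: "a \<in> A" "s \<in> A - {\<zero>}" "x = a \<otimes> inv s"
      by (auto simp: fraction_field_def fractions_def)
    have "s \<otimes> x = a" using as nz[OF as(2)] A_carrier[OF as(1)] by (simp add: m_lcomm)
    moreover have "x \<in> carrier R" using as nz[OF as(2)] A_carrier[OF as(1)] by simp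
    ultimately show "x \<in> carrier R \<and> (\<exists>s \<in> A - {\<zero>}. s \<otimes> x \<in> A)"
      using as(1,2) by blast
  }
  assume "x \<in> carrier R \<and> (\<exists>s \<in> A - {\<zero>}. s \<otimes> x \<in> A)"
  then obtain s where s: "x \<in> carrier R" "s \<in> A - {\<zero>}" "s \<otimes> x \<in> A" by auto
  have "x = s \<otimes> x \<otimes> inv s" using s nz[OF s(2)] by (simp add: m_comm[of s x] m_assoc)
  then show "x \<in> fraction_field R A"
    using s unfolding fraction_field_def fractions_def by blast
qed

lemma subring_localization_at:
  assumes P: "primeideal P (R\<lparr>carrier := A\<rparr>)"
  shows "subring (localization_at R A P) R" and "A \<subseteq> localization_at R A P"
proof -
  note D = primeidealD[OF P]
  note L = localization_at_iff[OF P]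
  show sub: "A \<subseteq> localization_at R A P"
  proof
    fix a assume a: "a \<in> A"
    have "\<one> \<in> A - P" "\<one> \<otimes> a \<in> A" using a A_carrier D(3) by auto
    then show "a \<in> localization_at R A P" using a A_carrier L by blast
  qed
  show "subring (localization_at R A P) R"
  proof (rule subringI)
    show "localization_at R A P \<subseteq> carrier R" using L by blast
    show "\<one> \<in> localization_at R A P" using sub A_closed(2) by blast
    show "\<ominus> h \<in> localization_at R A P" if h: "h \<in> localization_at R A P" for h
    proof -
      obtain s where s: "s \<in> A - P" "s \<otimes> h \<in> A" "h \<in> carrier R" using h unfolding L by blast
      have "s \<otimes> (\<ominus> h) = \<ominus> (s \<otimes> h)" using s A_carrier by (auto simp: r_minus)
      then have "s \<otimes> (\<ominus> h) \<in> A" using s by simp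
      then show ?thesis unfolding L using s a_inv_closed by blast
    qed
    fix h k assume "h \<in> localization_at R A P" "k \<in> localization_at R A P"
    then obtain s t where s: "s \<in> A - P" "s \<otimes> h \<in> A" "h \<in> carrier R"
      and t: "t \<in> A - P" "t \<otimes> k \<in> A" "k \<in> carrier R" unfolding L by blast
    have c: "s \<in> carrier R" "t \<in> carrier R" using s t A_carrier by auto
    have st: "s \<otimes> t \<in> A - P" by (rule D(5)[OF s(1) t(1)])
    have "(s \<otimes> t) \<otimes> (h \<otimes> k) = (s \<otimes> h) \<otimes> (t \<otimes> k)" using s t c by (simp add: m_ac)
    then have "(s \<otimes> t) \<otimes> (h \<otimes> k) \<in> A" using s t by simp
    then show "h \<otimes> k \<in> localization_at R A P" unfolding L using st s t m_closed a_closed by blast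
    have "(s \<otimes> t) \<otimes> (h \<oplus> k) = t \<otimes> (s \<otimes> h) \<oplus> s \<otimes> (t \<otimes> k)"
      using s t c by (simp add: r_distr m_ac)
    then have "(s \<otimes> t) \<otimes> (h \<oplus> k) \<in> A" using s t by auto
    then show "h \<oplus> k \<in> localization_at R A P" unfolding L using st s t m_closed a_closed by blast
  qed
qed

lemma noetherian_submodule_subset:
  assumes "noetherian_submodule R A N" "submodule_of R A M" "M \<subseteq> N"
  shows "noetherian_submodule R A M"
proof (rule noetherian_submoduleI[OF assms(2)])
  fix C :: "nat \<Rightarrow> 'a set"
  assume C: "\<And>n. submodule_of R A (C n)" "\<And>n. C n \<subseteq> C (Suc n)" "\<And>n. C n \<subseteq> M"
  show "\<exists>n. \<forall>m\<ge>n. C m = C n"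
  proof (rule noetherian_submoduleD[OF assms(1)])
    show "C n \<subseteq> N" for n using C(3)[of n] assms(3) by (rule order_trans)
  qed (rule C)+
qed

end

section \<open>Uniformizers of a Dedekind domain\<close>

locale dedekind_prime = subring_of_field +
  fixes p
  assumes dedekind: "dedekind_domain R A"
    and prime: "primeideal p (R\<lparr>carrier := A\<rparr>)"
    and nonzero: "p \<noteq> {\<zero>}"
begin

lemmas pD = primeidealD[OF prime]

lemma p_carrier: "a \<in> p \<Longrightarrow> a \<in> carrier R"
  using pD(2) A_carrier by auto

lemma noeth: "noetherian_ring (R\<lparr>carrier := A\<rparr>)"
  using dedekind by (simp add: dedekind_domain_def noetherian_domain_def)

lemma maximal_if_prime:
  assumes "primeideal q (R\<lparr>carrier := A\<rparr>)" "q \<noteq> {\<zero>}"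
  shows "q \<in> max_ideals R A"
  using dedekind assms by (simp add: dedekind_domain_def max_ideals_def)

text \<open>
  In a noetherian ring the union of a nonempty chain of ideals belongs to the chain.
\<close>

lemma exists_maximal_member:
  assumes F: "F \<noteq> {}" "\<And>I. I \<in> F \<Longrightarrow> submodule_of R A I \<and> I \<subseteq> A"
  obtains M where "M \<in> F" "\<And>I. I \<in> F \<Longrightarrow> M \<subseteq> I \<Longrightarrow> I = M"
proof -
  have "\<Union> C \<in> F" if C: "C \<noteq> {}" "subset.chain F C" for C
  proof -
    have CF: "C \<subseteq> F" using C(2) by (auto simp: subset.chain_def)
    have "subset.chain {I. ideal I (R\<lparr>carrier := A\<rparr>)} C"
    proof -
      have "C \<subseteq> {I. ideal I (R\<lparr>carrier := A\<rparr>)}"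
        using F(2) CF by (auto simp: ideal_iff_submodule_of[OF subring])
      then show ?thesis using C(2) by (simp add: subset.chain_def)
    qed
    from noetherian_ring.ideal_chain_is_trivial[OF noeth C(1) this] CF show ?thesis by blast
  qed
  then obtain M where "M \<in> F" "\<forall>J\<in>F. M \<subseteq> J \<longrightarrow> J = M"
    using subset_Zorn_nonempty[OF F(1)] by blast
  then show ?thesis using that by blast
qed

text \<open>
  For \<open>a \<in> p\<close> consider the ideals \<open>q b\<close> of those \<open>r\<close> for which \<open>r b\<close> lies in \<open>a A\<close> locally at \<open>p\<close>. A
  maximal proper one among them is prime, like a maximal annihilator. It contains \<open>a \<noteq> 0\<close> and is contained in
  \<open>p\<close>, so it is \<open>p\<close> by dimension one. The quotient \<open>b / a\<close> will be an element outside of the localization at \<open>p\<close>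
  that multiplies \<open>p\<close> into it.
\<close>

lemma exists_multiplier:
  obtains a b where "a \<in> p" "a \<noteq> \<zero>" "b \<in> A" "\<And>t. t \<in> A - p \<Longrightarrow> t \<otimes> b \<notin> (\<otimes>) a ` A"
    "\<And>r. r \<in> p \<Longrightarrow> \<exists>t \<in> A - p. t \<otimes> r \<otimes> b \<in> (\<otimes>) a ` A"
proof -
  obtain a where a: "a \<in> p" "a \<noteq> \<zero>" using nonzero pD(4) by blast
  have aR: "a \<in> carrier R" using p_carrier a by simp
  have aA: "a \<in> A" using pD(2) a by auto
  (* the elements that multiply b into the ideal generated by a, locally at p *)
  define q where "q b = {r \<in> A. \<exists>t \<in> A - p. t \<otimes> r \<otimes> b \<in> (\<otimes>) a ` A}" for b
  have sA: "submodule_of R A ((\<otimes>) a ` A)"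
    by (rule submodule_of_scale[OF submodule_of_self[OF subring] aR subringE(1)[OF subring]])
  have one: "\<one> \<in> A - p" using pD(3) by auto
  have qI: "r \<in> q b" if "r \<in> A" "t \<in> A - p" "t \<otimes> r \<otimes> b \<in> (\<otimes>) a ` A" for r t b
    unfolding q_def using that by blast
  have qs: "submodule_of R A (q b)" if b: "b \<in> A" for b
  proof (rule submodule_ofI)
    show "x \<in> carrier R" if "x \<in> q b" for x using that A_carrier by (auto simp: q_def)
    have "\<one> \<otimes> \<zero> \<otimes> b \<in> (\<otimes>) a ` A" using submodule_ofD(2)[OF sA] A_carrier b by auto
    then show "\<zero> \<in> q b" using qI[OF _ one] A_closed(1) by blast
    show "x \<oplus> y \<in> q b" if xy: "x \<in> q b" "y \<in> q b" for x y
    proof -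
      obtain s t where s: "s \<in> A - p" "s \<otimes> x \<otimes> b \<in> (\<otimes>) a ` A" "x \<in> A"
        and t: "t \<in> A - p" "t \<otimes> y \<otimes> b \<in> (\<otimes>) a ` A" "y \<in> A" using xy unfolding q_def by blast
      have c: "s \<in> carrier R" "t \<in> carrier R" "x \<in> carrier R" "y \<in> carrier R" "b \<in> carrier R"
        using s t b A_carrier by auto
      have "(s \<otimes> t) \<otimes> (x \<oplus> y) \<otimes> b = t \<otimes> (s \<otimes> x \<otimes> b) \<oplus> s \<otimes> (t \<otimes> y \<otimes> b)"
        using c by (simp add: r_distr l_distr m_ac)
      moreover have "t \<otimes> (s \<otimes> x \<otimes> b) \<oplus> s \<otimes> (t \<otimes> y \<otimes> b) \<in> (\<otimes>) a ` A"
        using submodule_ofD(3)[OF sA submodule_ofD(4)[OF sA _ s(2)] submodule_ofD(4)[OF sA _ t(2)]]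
          s(1) t(1) by blast
      ultimately show ?thesis using qI[OF _ pD(5)[OF s(1) t(1)]] s t by simp
    qed
    show "c \<otimes> x \<in> q b" if cx: "c \<in> A" "x \<in> q b" for c x
    proof -
      obtain s where s: "s \<in> A - p" "s \<otimes> x \<otimes> b \<in> (\<otimes>) a ` A" "x \<in> A" using cx unfolding q_def by blast
      have "s \<otimes> (c \<otimes> x) \<otimes> b = c \<otimes> (s \<otimes> x \<otimes> b)"
        using A_carrier s cx b by (simp add: m_ac)
      then show ?thesis using qI[OF _ s(1), of "c \<otimes> x" b] s cx submodule_ofD(4)[OF sA cx(1) s(2)] by simp
    qed
  qed
  have qone: "\<one> \<in> q b \<longleftrightarrow> (\<exists>t \<in> A - p. t \<otimes> b \<in> (\<otimes>) a ` A)" for b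
    using A_carrier by (auto simp: q_def)
  have "q \<one> \<in> {q b | b. b \<in> A \<and> \<one> \<notin> q b}"
  proof -
    have "(\<otimes>) a ` A \<subseteq> p" using pD(6) a by auto
    then have "\<one> \<notin> q \<one>" using A_carrier unfolding qone by auto
    then show ?thesis by auto
  qed
  then obtain M where M: "M \<in> {q b | b. b \<in> A \<and> \<one> \<notin> q b}"
      "\<And>I. I \<in> {q b | b. b \<in> A \<and> \<one> \<notin> q b} \<Longrightarrow> M \<subseteq> I \<Longrightarrow> I = M"
    using exists_maximal_member[of "{q b | b. b \<in> A \<and> \<one> \<notin> q b}"] qs q_def by blast
  then obtain b where b: "b \<in> A" "\<one> \<notin> q b" "M = q b" by blast
  have bR: "b \<in> carrier R" using b A_carrier by simp
  have prime_step: "r \<in> q b \<or> s \<in> q b" if rs: "r \<in> A" "s \<in> A" "r \<otimes> s \<in> q b" for r s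
  proof (cases "r \<in> q b")
    case False
    have rR: "r \<in> carrier R" "s \<in> carrier R" using rs A_carrier by auto
    have rb: "r \<otimes> b \<in> A" using rs b by simp
    have "\<one> \<notin> q (r \<otimes> b)"
    proof
      assume "\<one> \<in> q (r \<otimes> b)"
      then obtain t where t: "t \<in> A - p" "t \<otimes> (r \<otimes> b) \<in> (\<otimes>) a ` A" unfolding qone by blast
      then have "t \<otimes> r \<otimes> b \<in> (\<otimes>) a ` A" using rR bR A_carrier by (auto simp: m_assoc)
      then show False using qI rs t False by blast
    qed
    moreover have "q b \<subseteq> q (r \<otimes> b)"
    proof
      fix x assume "x \<in> q b"
      then obtain t where t: "t \<in> A - p" "t \<otimes> x \<otimes> b \<in> (\<otimes>) a ` A" "x \<in> A" unfolding q_def by blast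
      have "t \<otimes> x \<otimes> (r \<otimes> b) = r \<otimes> (t \<otimes> x \<otimes> b)" using t rR bR A_carrier by (simp add: m_ac)
      then show "x \<in> q (r \<otimes> b)" using qI[OF t(3,1)] submodule_ofD(4)[OF sA rs(1) t(2)] by simp
    qed
    ultimately have eq: "q (r \<otimes> b) = q b" using M(2)[of "q (r \<otimes> b)"] rb b(3) by blast
    obtain t where t: "t \<in> A - p" "t \<otimes> (r \<otimes> s) \<otimes> b \<in> (\<otimes>) a ` A" using rs(3) unfolding q_def by blast
    have "t \<otimes> s \<otimes> (r \<otimes> b) = t \<otimes> (r \<otimes> s) \<otimes> b" using t rR bR A_carrier by (auto simp: m_ac)
    then have "s \<in> q (r \<otimes> b)" using qI[OF rs(2) t(1)] t(2) by simp
    then show ?thesis using eq by simp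
  qed simp
  have "primeideal (q b) (R\<lparr>carrier := A\<rparr>)"
    unfolding primeideal_iff using qs b prime_step by (auto simp: q_def)
  moreover have "a \<in> q b"
  proof -
    have "\<one> \<otimes> a \<otimes> b \<in> (\<otimes>) a ` A" using aR b by simp
    then show ?thesis using qI[OF aA one] by blast
  qed
  ultimately have "q b \<in> max_ideals R A" using maximal_if_prime a by blast
  moreover have "q b \<subseteq> p"
  proof
    fix x assume x: "x \<in> q b"
    then obtain t where t: "t \<in> A - p" "t \<otimes> x \<otimes> b \<in> (\<otimes>) a ` A" "x \<in> A" unfolding q_def by blast
    show "x \<in> p"
    proof (rule ccontr)
      assume "x \<notin> p"
      then have "t \<otimes> x \<in> A - p" using pD(5) t by blast
      then show False using b(2) t(2) unfolding qone by blast
    qed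
  qed
  moreover have "p \<noteq> A" using pD(3) by auto
  ultimately have qp: "q b = p" using pD(1,2) unfolding max_ideals_iff by blast
  show ?thesis
  proof (rule that[OF a b(1)])
    show "t \<otimes> b \<notin> (\<otimes>) a ` A" if "t \<in> A - p" for t using b(2) that unfolding qone by blast
    show "\<exists>t \<in> A - p. t \<otimes> r \<otimes> b \<in> (\<otimes>) a ` A" if r: "r \<in> p" for r
    proof -
      have "r \<in> q b" using r qp by simp
      then show ?thesis unfolding q_def by blast
    qed
  qed
qed

text \<open>
  As \<open>p\<close> is finitely generated, a common denominator \<open>t\<close> turns the multiplier into an element
  \<open>y = t b / a\<close> outside \<open>A\<close> with \<open>y p \<subseteq> A\<close>. If \<open>y p\<close> were contained in \<open>p\<close>, then \<open>y\<close> would be integral. So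
  \<open>y \<pi>\<close> is outside \<open>p\<close> for some \<open>\<pi> \<in> p\<close>, and \<open>r = (y r) \<pi> / (y \<pi>)\<close> for all \<open>r \<in> p\<close>.
\<close>

lemma exists_local_generator:
  obtains \<pi> u where "\<pi> \<in> p" "\<pi> \<noteq> \<zero>" "u \<in> A - p" "\<And>r. r \<in> p \<Longrightarrow> \<exists>c \<in> A. u \<otimes> r = c \<otimes> \<pi>"
proof -
  obtain a b where a: "a \<in> p" "a \<noteq> \<zero>" and b: "b \<in> A"
    and nb: "\<And>t. t \<in> A - p \<Longrightarrow> t \<otimes> b \<notin> (\<otimes>) a ` A"
    and ab: "\<And>r. r \<in> p \<Longrightarrow> \<exists>t \<in> A - p. t \<otimes> r \<otimes> b \<in> (\<otimes>) a ` A"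
    by (rule exists_multiplier) blast
  have aR: "a \<in> carrier R" "a \<in> Units R" and bR: "b \<in> carrier R" and aA: "a \<in> A"
    using a b p_carrier A_carrier field_Units pD(2) by auto
  have sA: "submodule_of R A ((\<otimes>) a ` A)"
    by (rule submodule_of_scale[OF submodule_of_self[OF subring] aR(1) subringE(1)[OF subring]])
  have "ideal p (R\<lparr>carrier := A\<rparr>)" using prime by (simp add: primeideal_def)
  then obtain G where G: "G \<subseteq> A" "finite G" "p = Idl\<^bsub>R\<lparr>carrier := A\<rparr>\<^esub> G"
    using noetherian_ring.finetely_gen[OF noeth] by auto
  have Gp: "G \<subseteq> p"
    using ring.genideal_self[OF subring_is_ring[OF subring], of G] G by simp
  have "\<exists>t \<in> A - p. \<forall>r \<in> G. t \<otimes> r \<otimes> b \<in> (\<otimes>) a ` A"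
    using G(2) Gp
  proof (induction G rule: finite_induct)
    case empty
    then show ?case using pD(3) A_closed(2) by blast
  next
    case (insert g G)
    obtain t where t: "t \<in> A - p" "\<forall>r \<in> G. t \<otimes> r \<otimes> b \<in> (\<otimes>) a ` A" using insert by auto
    obtain s where s: "s \<in> A - p" "s \<otimes> g \<otimes> b \<in> (\<otimes>) a ` A" using insert ab by blast
    have c: "s \<in> carrier R" "t \<in> carrier R" using s t A_carrier by auto
    have "s \<otimes> t \<otimes> r \<otimes> b \<in> (\<otimes>) a ` A" if r: "r \<in> insert g G" for r
    proof (cases "r = g")
      case True
      have "s \<otimes> t \<otimes> g \<otimes> b = t \<otimes> (s \<otimes> g \<otimes> b)"
        using c bR p_carrier insert.prems by (simp add: m_ac)
      then show ?thesis using True submodule_ofD(4)[OF sA _ s(2), of t] t by simp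
    next
      case False
      then have rG: "r \<in> G" using r by simp
      have "s \<otimes> t \<otimes> r \<otimes> b = s \<otimes> (t \<otimes> r \<otimes> b)"
        using c bR p_carrier insert.prems rG by (auto simp: m_assoc)
      then show ?thesis using submodule_ofD(4)[OF sA, of s] t rG s by simp
    qed
    then show ?case using pD(5)[OF s(1) t(1)] by blast
  qed
  then obtain t where t: "t \<in> A - p" "\<And>r. r \<in> G \<Longrightarrow> t \<otimes> r \<otimes> b \<in> (\<otimes>) a ` A" by blast
  have tR: "t \<in> carrier R" using t A_carrier by auto
  define y where "y = t \<otimes> b \<otimes> inv a"
  have yR: "y \<in> carrier R" using tR bR aR by (simp add: y_def)
  have ya: "a \<otimes> y = t \<otimes> b" unfolding y_def using tR bR aR by (simp add: m_lcomm[of a])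
  have yr: "y \<otimes> r \<in> A \<longleftrightarrow> t \<otimes> r \<otimes> b \<in> (\<otimes>) a ` A" if r: "r \<in> carrier R" for r
  proof -
    have "t \<otimes> r \<otimes> b = a \<otimes> (y \<otimes> r)"
      using ya r yR tR bR aR by (metis m_assoc m_comm m_closed)
    then show ?thesis using m_lcancel[OF a(2) aR(1), of "y \<otimes> r"] yR r A_carrier by auto
  qed
  have "submodule_of R A {r \<in> A. y \<otimes> r \<in> A}"
  proof (rule submodule_ofI)
    show "\<zero> \<in> {r \<in> A. y \<otimes> r \<in> A}" using yR by simp
    show "r \<oplus> s \<in> {r \<in> A. y \<otimes> r \<in> A}" if "r \<in> {r \<in> A. y \<otimes> r \<in> A}" "s \<in> {r \<in> A. y \<otimes> r \<in> A}" for r s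
      using that yR A_carrier by (auto simp: r_distr)
    show "c \<otimes> r \<in> {r \<in> A. y \<otimes> r \<in> A}" if "c \<in> A" "r \<in> {r \<in> A. y \<otimes> r \<in> A}" for c r
      using that yR A_carrier by (auto simp: m_lcomm[of y])
  qed (use A_carrier in auto)
  then have id: "ideal {r \<in> A. y \<otimes> r \<in> A} (R\<lparr>carrier := A\<rparr>)"
    unfolding ideal_iff_submodule_of[OF subring] by auto
  have "G \<subseteq> {r \<in> A. y \<otimes> r \<in> A}" using G(1) t(2) yr A_carrier by auto
  then have yp: "y \<otimes> r \<in> A" if "r \<in> p" for r
    using ring.genideal_minimal[OF subring_is_ring[OF subring] id] G(3) that by auto
  have "\<exists>\<pi> \<in> p. y \<otimes> \<pi> \<notin> p"
  proof (rule ccontr)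
    assume "\<not> (\<exists>\<pi> \<in> p. y \<otimes> \<pi> \<notin> p)"
    then have "integral_over R A y"
      using integral_over_if_stable[OF subring noetherian_submodule_subset[OF
            noetherian_submodule_self[OF subring noeth] pD(1,2)] yR a] by blast
    moreover have "y \<in> fraction_field R A"
    proof -
      have "a \<otimes> y \<in> A" unfolding ya using b t by simp
      then show ?thesis unfolding fraction_field_iff using yR a aA by blast
    qed
    ultimately have "y \<in> A"
      using dedekind unfolding dedekind_domain_def integral_closure_def by blast
    then have "t \<otimes> b \<in> (\<otimes>) a ` A" using ya by (metis imageI)
    then show False using nb t by blast
  qed
  then obtain \<pi> where \<pi>: "\<pi> \<in> p" "y \<otimes> \<pi> \<notin> p" by blast
  have \<pi>R: "\<pi> \<in> carrier R" using p_carrier \<pi> by simp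
  show ?thesis
  proof (rule that[OF \<pi>(1)])
    show "\<pi> \<noteq> \<zero>" using \<pi> pD(4) yR by auto
    show "y \<otimes> \<pi> \<in> A - p" using yp \<pi> by blast
    show "\<exists>c \<in> A. y \<otimes> \<pi> \<otimes> r = c \<otimes> \<pi>" if r: "r \<in> p" for r
    proof (rule bexI[OF _ yp[OF r]])
      show "y \<otimes> \<pi> \<otimes> r = y \<otimes> r \<otimes> \<pi>" using yR \<pi>R p_carrier[OF r] by (simp add: m_ac)
    qed
  qed
qed

text \<open>
  If \<open>c\<close> were locally divisible by all powers of \<open>\<pi>\<close>, then the ideals of elements that are locally
  multiples of \<open>c / \<pi>\<^sup>n\<close> would form a chain that never becomes stationary.
\<close>

lemma exists_uniformizer:
  obtains \<pi> where "\<pi> \<in> p" "\<pi> \<noteq> \<zero>"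
    "\<And>c. c \<in> A - {\<zero>} \<Longrightarrow> \<exists>n :: nat. \<exists>s \<in> A - p. \<exists>t \<in> A - p. t \<otimes> c = s \<otimes> \<pi> [^] n"
proof -
  obtain \<pi> u where \<pi>: "\<pi> \<in> p" "\<pi> \<noteq> \<zero>" and u: "u \<in> A - p"
    and ur: "\<And>r. r \<in> p \<Longrightarrow> \<exists>c \<in> A. u \<otimes> r = c \<otimes> \<pi>"
    by (rule exists_local_generator) blast
  have \<pi>R: "\<pi> \<in> carrier R" "\<pi> \<in> A" using p_carrier pD(2) \<pi> by auto
  have uR: "u \<in> carrier R" using u A_carrier by simp
  have "\<exists>n :: nat. \<exists>s \<in> A - p. \<exists>t \<in> A - p. t \<otimes> c = s \<otimes> \<pi> [^] n" if c: "c \<in> A - {\<zero>}" for c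
  proof (rule ccontr)
    assume neg: "\<not> (\<exists>n :: nat. \<exists>s \<in> A - p. \<exists>t \<in> A - p. t \<otimes> c = s \<otimes> \<pi> [^] n)"
    have cR: "c \<in> carrier R" and cA: "c \<in> A" using c A_carrier by auto
    have all: "\<exists>t \<in> A - p. \<exists>d \<in> A. t \<otimes> c = d \<otimes> \<pi> [^] n" for n :: nat
    proof (induction n)
      case 0
      have "\<one> \<otimes> c = c \<otimes> \<pi> [^] (0::nat)" using cR by simp
      then show ?case using pD(3) A_closed(2) cA by blast
    next
      case (Suc n)
      obtain t d where t: "t \<in> A - p" and d: "d \<in> A" "t \<otimes> c = d \<otimes> \<pi> [^] n" using Suc by blast
      then have "d \<in> p" using neg by blast
      then obtain e where e: "e \<in> A" "u \<otimes> d = e \<otimes> \<pi>" using ur by blast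
      have C: "t \<in> carrier R" "d \<in> carrier R" "e \<in> carrier R" using t d e A_carrier by auto
      have "u \<otimes> t \<otimes> c = (u \<otimes> d) \<otimes> \<pi> [^] n" using C uR cR \<pi>R d(2) by (simp add: m_assoc)
      also have "\<dots> = e \<otimes> \<pi> [^] Suc n"
        unfolding e(2) using C \<pi>R by (simp add: m_assoc m_comm[of \<pi>])
      finally show ?case using pD(5)[OF u t] e(1) by blast
    qed
    define C where "C n = {r \<in> A. \<exists>t \<in> A - p. \<exists>d \<in> A. t \<otimes> r \<otimes> \<pi> [^] n = c \<otimes> d}" for n :: nat
    have CI: "r \<in> C n" if "r \<in> A" "t \<in> A - p" "d \<in> A" "t \<otimes> r \<otimes> \<pi> [^] n = c \<otimes> d" for r t d n
      unfolding C_def using that by blast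
    have one: "\<one> \<in> A - p" using pD(3) by simp
    have sub: "submodule_of R A (C n)" for n
    proof (rule submodule_ofI)
      show "x \<in> carrier R" if "x \<in> C n" for x using that A_carrier by (auto simp: C_def)
      have "\<one> \<otimes> \<zero> \<otimes> \<pi> [^] n = c \<otimes> \<zero>" using cR \<pi>R by simp
      then show "\<zero> \<in> C n" using CI[OF A_closed(1) one A_closed(1)] by simp
      show "x \<oplus> y \<in> C n" if xy: "x \<in> C n" "y \<in> C n" for x y
      proof -
        obtain s t d e where s: "s \<in> A - p" "s \<otimes> x \<otimes> \<pi> [^] n = c \<otimes> d" "x \<in> A" "d \<in> A"
          and t: "t \<in> A - p" "t \<otimes> y \<otimes> \<pi> [^] n = c \<otimes> e" "y \<in> A" "e \<in> A" using xy unfolding C_def by blast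
        have R: "s \<in> carrier R" "t \<in> carrier R" "x \<in> carrier R" "y \<in> carrier R" "d \<in> carrier R" "e \<in> carrier R"
          "\<pi> [^] n \<in> carrier R" using s t A_carrier \<pi>R by auto
        have "(s \<otimes> t) \<otimes> (x \<oplus> y) \<otimes> \<pi> [^] n = t \<otimes> (s \<otimes> x \<otimes> \<pi> [^] n) \<oplus> s \<otimes> (t \<otimes> y \<otimes> \<pi> [^] n)"
          using R by (simp add: r_distr l_distr m_ac)
        also have "\<dots> = c \<otimes> (t \<otimes> d \<oplus> s \<otimes> e)"
          unfolding s t using R cR by (simp add: r_distr m_lcomm)
        finally show ?thesis by (rule CI[rotated 3]) (use pD(5)[OF s(1) t(1)] s t in auto)
      qed
      show "a \<otimes> x \<in> C n" if ax: "a \<in> A" "x \<in> C n" for a x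
      proof -
        obtain s d where s: "s \<in> A - p" "s \<otimes> x \<otimes> \<pi> [^] n = c \<otimes> d" "x \<in> A" "d \<in> A"
          using ax unfolding C_def by blast
        have R: "s \<in> carrier R" "a \<in> carrier R" "x \<in> carrier R" "d \<in> carrier R" "\<pi> [^] n \<in> carrier R"
          using s ax A_carrier \<pi>R by auto
        have "s \<otimes> (a \<otimes> x) \<otimes> \<pi> [^] n = a \<otimes> (s \<otimes> x \<otimes> \<pi> [^] n)" using R by (simp add: m_ac)
        also have "\<dots> = c \<otimes> (a \<otimes> d)" unfolding s using R cR by (simp add: m_lcomm)
        finally show ?thesis by (rule CI[rotated 3]) (use s ax in auto)
      qed
    qed
    have "C n \<subseteq> C (Suc n)" for n
    proof
      fix r assume "r \<in> C n"
      then obtain t d where t: "t \<in> A - p" "t \<otimes> r \<otimes> \<pi> [^] n = c \<otimes> d" "r \<in> A" "d \<in> A"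
        unfolding C_def by blast
      have R: "t \<in> carrier R" "r \<in> carrier R" "d \<in> carrier R" using t A_carrier by auto
      have "t \<otimes> r \<otimes> \<pi> [^] (Suc n) = (t \<otimes> r \<otimes> \<pi> [^] n) \<otimes> \<pi>" using R \<pi>R by (simp add: m_assoc)
      also have "\<dots> = c \<otimes> (d \<otimes> \<pi>)" unfolding t using R cR \<pi>R by (simp add: m_assoc)
      finally show "r \<in> C (Suc n)" by (rule CI[rotated 3]) (use t \<pi>R in auto)
    qed
    moreover have "C n \<subseteq> A" for n by (auto simp: C_def)
    ultimately obtain n where "\<forall>m\<ge>n. C m = C n"
      using noetherian_submoduleD[OF noetherian_submodule_self[OF subring noeth], of C] sub by blast
    then have eq: "C (Suc n) = C n" by (meson le_SucI order_refl)
    obtain t d where t: "t \<in> A - p" and d: "d \<in> A" "t \<otimes> c = d \<otimes> \<pi> [^] Suc n" using all by blast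
    have tR: "t \<in> carrier R" "d \<in> carrier R" using t d A_carrier by auto
    have "\<one> \<otimes> d \<otimes> \<pi> [^] Suc n = c \<otimes> t" using d tR cR by (simp add: m_comm)
    then have "d \<in> C (Suc n)" by (rule CI[rotated 3]) (use t d one in auto)
    then obtain t' e where e: "t' \<in> A - p" "e \<in> A" "t' \<otimes> d \<otimes> \<pi> [^] n = c \<otimes> e"
      unfolding eq unfolding C_def by blast
    have eR: "t' \<in> carrier R" "e \<in> carrier R" using e A_carrier by auto
    have "c \<otimes> (t' \<otimes> t) = t' \<otimes> (t \<otimes> c)" using eR tR cR by (simp add: m_ac)
    also have "\<dots> = (t' \<otimes> d \<otimes> \<pi> [^] n) \<otimes> \<pi>" unfolding d using eR tR \<pi>R by (simp add: m_assoc)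
    also have "\<dots> = c \<otimes> (e \<otimes> \<pi>)" unfolding e using eR cR \<pi>R by (simp add: m_assoc)
    finally have "t' \<otimes> t = e \<otimes> \<pi>" using m_lcancel[of c "t' \<otimes> t" "e \<otimes> \<pi>"] c cR eR tR \<pi>R by simp
    then have "t' \<otimes> t \<in> p" using pD(7)[OF e(2) \<pi>(1)] by simp
    then show False using pD(5)[OF e(1) t] by blast
  qed
  then show ?thesis using that[OF \<pi>] by blast
qed

end

section \<open>Valuation rings of a field\<close>

context field
begin

lemma pow_nonzero: "x \<in> carrier R \<Longrightarrow> x \<noteq> \<zero> \<Longrightarrow> x [^] (n :: nat) \<noteq> \<zero>"
  by (induction n) (auto simp: integral_iff)

lemma inv_facts:
  assumes "x \<in> carrier R" "x \<noteq> \<zero>"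
  shows "x \<in> Units R" "inv x \<in> carrier R" "inv x \<noteq> \<zero>" "x \<otimes> inv x = \<one>" "inv x \<otimes> x = \<one>"
    "inv (inv x) = x"
proof -
  show u: "x \<in> Units R" using assms field_Units by auto
  show c: "inv x \<in> carrier R" "x \<otimes> inv x = \<one>" "inv x \<otimes> x = \<one>" "inv (inv x) = x" using u by auto
  show "inv x \<noteq> \<zero>" using c assms by auto
qed

lemma mult_div_cancel:
  assumes "x \<in> carrier R" "x \<noteq> \<zero>" "y \<in> carrier R"
  shows "x \<otimes> (y \<otimes> inv x) = y"
  using assms inv_facts[OF assms(1,2)] by (simp add: m_lcomm[of x y])

lemma inv_mult_nonzero:
  assumes "x \<in> carrier R" "x \<noteq> \<zero>" "y \<in> carrier R" "y \<noteq> \<zero>"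
  shows "inv (x \<otimes> y) = inv x \<otimes> inv y"
  using assms inv_facts(1) comm_inv_char[of "x \<otimes> y" "inv x \<otimes> inv y"] inv_facts(2,4)
  by (simp add: m_ac)

lemma additive_map_facts:
  fixes f :: "'a \<Rightarrow> 'c :: linordered_field"
  assumes additive: "\<forall>x \<in> nonzero R. \<forall>y \<in> nonzero R. f (x \<otimes> y) = f x + f y"
  shows "f \<one> = 0" "x \<in> nonzero R \<Longrightarrow> f (inv x) = - f x"
    "x \<in> nonzero R \<Longrightarrow> f (x [^] (n :: nat)) = of_nat n * f x"
proof -
  note f = additive[rule_format]
  show one: "f \<one> = 0" using f[of \<one> \<one>] by simp
  show "f (inv x) = - f x" if x: "x \<in> nonzero R" for x
  proof -
    have "f (x \<otimes> inv x) = f x + f (inv x)" by (rule f) (use x inv_facts(2,3)[of x] in auto)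
    then show ?thesis using inv_facts(4)[of x] x one by simp
  qed
  show "f (x [^] (n :: nat)) = of_nat n * f x" if x: "x \<in> nonzero R" for x n
  proof (induction n)
    case (Suc n)
    have "f (x [^] n \<otimes> x) = f (x [^] n) + f x" by (rule f) (use x pow_nonzero in auto)
    then show ?case using Suc by (simp add: algebra_simps)
  qed (use one in simp)
qed

end

locale valuation_ring_of_field = subring_of_field R V for R (structure) and V +
  assumes total: "x \<in> carrier R \<Longrightarrow> x \<noteq> \<zero> \<Longrightarrow> x \<in> V \<or> inv x \<in> V"
begin

definition U where "U = {u \<in> V. u \<noteq> \<zero> \<and> inv u \<in> V}"

lemma UD: "u \<in> U \<Longrightarrow> u \<in> carrier R" "u \<in> U \<Longrightarrow> u \<noteq> \<zero>" "u \<in> U \<Longrightarrow> u \<in> V" "u \<in> U \<Longrightarrow> inv u \<in> V"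
  using A_carrier by (auto simp: U_def)

lemma U_one: "\<one> \<in> U" by (simp add: U_def)

lemma U_mult: "u \<in> U \<Longrightarrow> w \<in> U \<Longrightarrow> u \<otimes> w \<in> U"
  using inv_mult_nonzero A_carrier by (auto simp: U_def integral_iff)

lemma U_inv: "u \<in> U \<Longrightarrow> inv u \<in> U"
  using inv_facts A_carrier by (auto simp: U_def)

lemma U_pow: "u \<in> U \<Longrightarrow> u [^] (n :: nat) \<in> U"
  by (induction n) (auto simp: U_one U_mult)

text \<open>
  Of the two elements \<open>z\<close> and \<open>w = 1 + z\<close> one divides the other. If \<open>w\<close> divides \<open>z\<close> then it divides \<open>1 = w - z\<close>;
  if \<open>z\<close> divides \<open>w\<close> then \<open>z\<close> divides \<open>1\<close>.
\<close>

lemma one_plus_nonunit: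
  assumes z: "z \<in> V" "z \<notin> U"
  shows "\<one> \<oplus> z \<in> U"
proof (cases "z = \<zero>")
  case True
  then show ?thesis using U_one by simp
next
  case False
  define w where "w = \<one> \<oplus> z"
  have zR: "z \<in> carrier R" using z A_carrier by simp
  have wV: "w \<in> V" "w \<in> carrier R" using z A_carrier by (auto simp: w_def)
  have e: "\<one> = w \<ominus> z" unfolding w_def using zR by (simp add: a_minus_def a_assoc r_neg)
  have wn: "w \<noteq> \<zero>"
  proof
    assume "w = \<zero>"
    then have "\<one> = \<ominus> z" using e zR by (simp add: a_minus_def)
    then have "z = \<ominus> \<one>" using zR by simp
    moreover have "inv (\<ominus> \<one>) = \<ominus> \<one>"
      by (rule comm_inv_char) (auto simp: l_minus)
    ultimately show False using z False unfolding U_def by auto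
  qed
  note W = inv_facts[OF wV(2) wn] and Z = inv_facts[OF zR False]
  have "inv w \<in> V"
  proof (cases "z \<otimes> inv w \<in> V")
    case True
    have "inv w = (w \<ominus> z) \<otimes> inv w" unfolding e[symmetric] using W by simp
    also have "\<dots> = \<one> \<ominus> z \<otimes> inv w" using wV zR W by (simp add: a_minus_def l_distr l_minus)
    finally have q: "inv w = \<one> \<ominus> z \<otimes> inv w" .
    show ?thesis by (subst q) (use True in simp)
  next
    case F: False
    have nz: "z \<otimes> inv w \<in> carrier R" "z \<otimes> inv w \<noteq> \<zero>" using zR W False integral by auto
    have "inv (z \<otimes> inv w) = w \<otimes> inv z"
      using inv_mult_nonzero[OF zR False W(2,3)] W(6) Z(2) wV(2) by (simp add: m_comm)
    then have y: "w \<otimes> inv z \<in> V" using total[OF nz] F by simp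
    have "inv z = (w \<ominus> z) \<otimes> inv z" unfolding e[symmetric] using Z by simp
    also have "\<dots> = w \<otimes> inv z \<ominus> \<one>" using wV zR Z by (simp add: a_minus_def l_distr l_minus)
    finally have q: "inv z = w \<otimes> inv z \<ominus> \<one>" .
    have "inv z \<in> V" by (subst q) (use y in simp)
    then show ?thesis using z False by (simp add: U_def)
  qed
  then show ?thesis using wV wn by (simp add: U_def w_def)
qed

end

text \<open>
  A power of each element has, up to units, the value of a positive or negative power of \<open>\<pi>\<close>.
  Writing the latter as a quotient of powers with natural exponents keeps everything inside the monoid.
\<close>

locale commensurable_valuation_ring = valuation_ring_of_field +
  fixes \<pi>
  assumes \<pi>: "\<pi> \<in> V" "\<pi> \<noteq> \<zero>" "inv \<pi> \<notin> V"
    and commensurable: "x \<in> carrier R \<Longrightarrow> x \<noteq> \<zero> \<Longrightarrow>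
      \<exists>(n :: nat) (m :: nat) (k :: nat). \<exists>u \<in> U. n > 0 \<and> x [^] n \<otimes> \<pi> [^] m = u \<otimes> \<pi> [^] k"
begin

lemma \<pi>R: "\<pi> \<in> carrier R"
  using \<pi> A_carrier by simp

text \<open>
  Otherwise \<open>\<pi>\<close> would divide a unit.
\<close>

lemma uniformizer_power_less:
  assumes u: "u \<in> U" and w: "w \<in> V" and e: "u \<otimes> \<pi> [^] (i :: nat) = w \<otimes> \<pi> [^] j"
  shows "j \<le> i"
proof (rule ccontr)
  assume "\<not> j \<le> i"
  then obtain d where j: "j = i + Suc d" by (metis less_imp_Suc_add not_le add_Suc_right)
  have wR: "w \<in> carrier R" using w A_carrier by simp
  have "\<pi> [^] i \<otimes> u = \<pi> [^] i \<otimes> (w \<otimes> \<pi> [^] Suc d)"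
    using e \<pi>R UD(1)[OF u] wR by (simp add: j nat_pow_mult[symmetric] m_ac del: nat_pow_Suc)
  then have "u = w \<otimes> \<pi> [^] Suc d"
    using m_lcancel[OF pow_nonzero[OF \<pi>R \<pi>(2)], of i u] \<pi>R UD(1)[OF u] wR by simp
  then have "inv u \<otimes> u = inv u \<otimes> (w \<otimes> \<pi> [^] d) \<otimes> \<pi>"
    using \<pi>R wR inv_facts(2)[OF UD(1)[OF u] UD(2)[OF u]] by (simp add: m_assoc)
  then have "\<one> = inv u \<otimes> (w \<otimes> \<pi> [^] d) \<otimes> \<pi>" using inv_facts(5)[OF UD(1)[OF u] UD(2)[OF u]] by simp
  then have "inv \<pi> = inv u \<otimes> (w \<otimes> \<pi> [^] d)"
    using \<pi>R wR inv_facts(2)[OF UD(1)[OF u] UD(2)[OF u]] comm_inv_char[OF \<pi>R, of "inv u \<otimes> (w \<otimes> \<pi> [^] d)"]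
    by (simp add: m_comm)
  then show False using \<pi>(3) UD(4)[OF u] w \<pi>(1) by simp
qed

text \<open>
  The value of \<open>x\<close> in units of the value of \<open>\<pi>\<close>: the condition says \<open>n v(x) + m v(\<pi>) = k v(\<pi>)\<close>.
\<close>

definition has_value :: "'a \<Rightarrow> rat \<Rightarrow> bool" where
  "has_value x q \<longleftrightarrow> (\<exists>(n :: nat) (m :: nat) (k :: nat). \<exists>u \<in> U. n > 0 \<and> x [^] n \<otimes> \<pi> [^] m = u \<otimes> \<pi> [^] k \<and>
    q = (of_nat k - of_nat m) / of_nat n)"

lemma has_value_exists: "x \<in> carrier R \<Longrightarrow> x \<noteq> \<zero> \<Longrightarrow> \<exists>q. has_value x q"
  using commensurable[of x] unfolding has_value_def by blast

lemma has_value_mult: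
  assumes x: "x \<in> carrier R" and y: "y \<in> carrier R" and q: "has_value x q" and r: "has_value y r"
  shows "has_value (x \<otimes> y) (q + r)"
proof -
  obtain n m k :: nat and u where a: "u \<in> U" "n > 0" "x [^] n \<otimes> \<pi> [^] m = u \<otimes> \<pi> [^] k"
    "q = (of_nat k - of_nat m) / of_nat n" using q unfolding has_value_def by blast
  obtain n' m' k' :: nat and u' where b: "u' \<in> U" "n' > 0" "y [^] n' \<otimes> \<pi> [^] m' = u' \<otimes> \<pi> [^] k'"
    "r = (of_nat k' - of_nat m') / of_nat n'" using r unfolding has_value_def by blast
  have uR: "u \<in> carrier R" "u' \<in> carrier R" using UD a b by auto
  have "(x \<otimes> y) [^] (n * n') \<otimes> \<pi> [^] (m * n' + m' * n) =
    (x [^] n \<otimes> \<pi> [^] m) [^] n' \<otimes> (y [^] n' \<otimes> \<pi> [^] m') [^] n"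
    using x y \<pi>R by (simp add: nat_pow_distrib nat_pow_pow nat_pow_mult[symmetric] m_ac mult.commute)
  also have "\<dots> = (u [^] n' \<otimes> u' [^] n) \<otimes> \<pi> [^] (k * n' + k' * n)"
    unfolding a(3) b(3)
    using uR \<pi>R by (simp add: nat_pow_distrib nat_pow_pow nat_pow_mult[symmetric] m_ac)
  finally have "(x \<otimes> y) [^] (n * n') \<otimes> \<pi> [^] (m * n' + m' * n) =
    (u [^] n' \<otimes> u' [^] n) \<otimes> \<pi> [^] (k * n' + k' * n)" .
  moreover have "u [^] n' \<otimes> u' [^] n \<in> U" using a b U_mult U_pow by simp
  moreover have "q + r = (of_nat (k * n' + k' * n) - of_nat (m * n' + m' * n)) / of_nat (n * n')"
    unfolding a(4) b(4) using a(2) b(2) by (simp add: field_simps)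
  moreover have "n * n' > 0" using a b by simp
  ultimately show ?thesis unfolding has_value_def by blast
qed

text \<open>
  A power \<open>x\<^sup>n\<close> in \<open>V\<close> forces \<open>x\<close> into \<open>V\<close>, because otherwise \<open>x = x\<^sup>n x\<^bsup>-(n-1)\<^esup>\<close> with \<open>x\<^sup>-\<^sup>1\<close> in \<open>V\<close>.
\<close>

lemma has_value_nonneg:
  assumes x: "x \<in> carrier R" "x \<noteq> \<zero>" and q: "has_value x q"
  shows "q \<ge> 0 \<longleftrightarrow> x \<in> V"
proof -
  obtain n m k :: nat and u where a: "u \<in> U" "n > 0" "x [^] n \<otimes> \<pi> [^] m = u \<otimes> \<pi> [^] k"
    "q = (of_nat k - of_nat m) / of_nat n" using q unfolding has_value_def by blast
  have q0: "q \<ge> 0 \<longleftrightarrow> m \<le> k" unfolding a(4) using a(2) by (simp add: zero_le_divide_iff)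
  show ?thesis
  proof
    assume "x \<in> V"
    then have "x [^] n \<in> V" by simp
    then show "q \<ge> 0" unfolding q0 using uniformizer_power_less[OF a(1), of "x [^] n" k m] a(3) by simp
  next
    assume "q \<ge> 0"
    then obtain d where k: "k = m + d" using q0 by (metis le_iff_add)
    have "\<pi> [^] m \<otimes> x [^] n = \<pi> [^] m \<otimes> (u \<otimes> \<pi> [^] d)"
      using a(3) x \<pi>R UD(1)[OF a(1)] by (simp add: k nat_pow_mult[symmetric] m_ac)
    then have xn: "x [^] n = u \<otimes> \<pi> [^] d"
      using m_lcancel[OF pow_nonzero[OF \<pi>R \<pi>(2)], of m "x [^] n"] \<pi>R UD(1)[OF a(1)] x by simp
    show "x \<in> V"
    proof (rule ccontr)
      assume "x \<notin> V"
      then have i: "inv x \<in> V" using total x by blast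
      obtain n' where n: "n = Suc n'" using a(2) by (cases n) auto
      have "x [^] n \<otimes> inv x [^] n' = (x [^] n' \<otimes> inv x [^] n') \<otimes> x"
        using x inv_facts(2)[OF x] by (simp add: n m_ac)
      also have "x [^] n' \<otimes> inv x [^] n' = \<one>"
        using nat_pow_distrib[OF x(1) inv_facts(2)[OF x], of n'] inv_facts(4)[OF x] by simp
      finally have "x = u \<otimes> \<pi> [^] d \<otimes> inv x [^] n'" using xn x by simp
      moreover have "u \<otimes> \<pi> [^] d \<otimes> inv x [^] n' \<in> V" using UD(3)[OF a(1)] \<pi>(1) i by simp
      ultimately show False using \<open>x \<notin> V\<close> by simp
    qed
  qed
qed

lemma has_value_one: "has_value \<one> q \<Longrightarrow> q = 0"
proof -
  assume "has_value \<one> q"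
  then obtain n m k :: nat and u where a: "u \<in> U" "n > 0" "\<one> [^] n \<otimes> \<pi> [^] m = u \<otimes> \<pi> [^] k"
    "q = (of_nat k - of_nat m) / of_nat n" unfolding has_value_def by blast
  have e: "\<one> \<otimes> \<pi> [^] m = u \<otimes> \<pi> [^] k" using a(3) by simp
  have "k \<le> m" by (rule uniformizer_power_less[OF U_one UD(3)[OF a(1)] e])
  moreover have "m \<le> k" by (rule uniformizer_power_less[OF a(1) _ e[symmetric]]) simp
  ultimately show "q = 0" using a by simp
qed

text \<open>
  Adding the value of the inverse reduces this to the value of \<open>1\<close>.
\<close>

lemma has_value_unique:
  assumes x: "x \<in> carrier R" "x \<noteq> \<zero>" and q: "has_value x q" "has_value x q'"
  shows "q = q'"
proof -
  note I = inv_facts[OF x]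
  obtain r where r: "has_value (inv x) r" using has_value_exists I by blast
  have "q + r = 0" "q' + r = 0"
    using has_value_mult[OF x(1) I(2) q(1) r] has_value_mult[OF x(1) I(2) q(2) r] I(4) has_value_one by auto
  then show ?thesis by simp
qed

text \<open>
  The ultrametric inequality follows from the other properties: if \<open>x / y\<close> is in \<open>V\<close> then so is
  \<open>(x + y) / y\<close>.
\<close>

theorem exists_rational_valuation:
  obtains v :: "'a \<Rightarrow> rat" where "v \<in> extensional (nonzero R)"
    "\<And>x y. x \<in> nonzero R \<Longrightarrow> y \<in> nonzero R \<Longrightarrow> v (x \<otimes> y) = v x + v y"
    "\<And>x y. x \<in> nonzero R \<Longrightarrow> y \<in> nonzero R \<Longrightarrow> x \<oplus> y \<noteq> \<zero> \<Longrightarrow> v (x \<oplus> y) \<ge> min (v x) (v y)"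
    "\<And>x. x \<in> nonzero R \<Longrightarrow> v x \<ge> 0 \<longleftrightarrow> x \<in> V"
    "\<And>x u m k. x \<in> nonzero R \<Longrightarrow> u \<in> U \<Longrightarrow> x \<otimes> \<pi> [^] m = u \<otimes> \<pi> [^] k \<Longrightarrow> v x = of_nat k - of_nat m"
proof -
  define v where "v = restrict (\<lambda>x. THE q. has_value x q) (nonzero R)"
  have vI: "v x = q" if "x \<in> nonzero R" "has_value x q" for x q
    using that has_value_unique by (auto simp: v_def intro!: the_equality)
  have vr: "has_value x (v x)" if "x \<in> nonzero R" for x
    using vI[OF that] has_value_exists[of x] that by auto
  have mult: "v (x \<otimes> y) = v x + v y" if "x \<in> nonzero R" "y \<in> nonzero R" for x y
    using vI[OF _ has_value_mult[OF _ _ vr[OF that(1)] vr[OF that(2)]]] that integral by auto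
  have nonneg: "v x \<ge> 0 \<longleftrightarrow> x \<in> V" if "x \<in> nonzero R" for x
    using has_value_nonneg[OF _ _ vr[OF that]] that by simp
  have um: "v (x \<oplus> y) \<ge> v y"
    if x: "x \<in> nonzero R" and y: "y \<in> nonzero R" and xy: "x \<oplus> y \<noteq> \<zero>" and z: "x \<otimes> inv y \<in> V" for x y
  proof -
    have R: "x \<in> carrier R" "y \<in> carrier R" "y \<noteq> \<zero>" using x y by auto
    note I = inv_facts[OF R(2,3)]
    have "y \<otimes> (x \<otimes> inv y \<oplus> \<one>) = y \<otimes> inv y \<otimes> x \<oplus> y" using R I(2) by (simp add: r_distr m_ac)
    then have e: "x \<oplus> y = y \<otimes> (x \<otimes> inv y \<oplus> \<one>)" using R I by simp
    have w: "x \<otimes> inv y \<oplus> \<one> \<in> V" using z by simp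
    then have "x \<otimes> inv y \<oplus> \<one> \<in> nonzero R" using e xy R A_carrier by auto
    then show ?thesis using mult[OF y, of "x \<otimes> inv y \<oplus> \<one>"] nonneg w e by simp
  qed
  show ?thesis
  proof (rule that[of v])
    show "v \<in> extensional (nonzero R)" by (simp add: v_def)
    show "v (x \<oplus> y) \<ge> min (v x) (v y)" if xy: "x \<in> nonzero R" "y \<in> nonzero R" "x \<oplus> y \<noteq> \<zero>" for x y
    proof (cases "x \<otimes> inv y \<in> V")
      case True
      then show ?thesis using um[OF xy] by simp
    next
      case False
      have R: "x \<in> carrier R" "x \<noteq> \<zero>" "y \<in> carrier R" "y \<noteq> \<zero>" using xy by auto
      note I = inv_facts[OF R(3,4)] inv_facts[OF R(1,2)]
      have "x \<otimes> inv y \<in> carrier R" "x \<otimes> inv y \<noteq> \<zero>" using R I integral by auto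
      then have "inv (x \<otimes> inv y) \<in> V" using total False by blast
      moreover have "inv (x \<otimes> inv y) = y \<otimes> inv x"
        using inv_mult_nonzero[OF R(1,2) I(2,3)] I R by (simp add: m_comm)
      ultimately show ?thesis using um[OF xy(2,1)] xy R by (simp add: a_comm)
    qed
    show "v x = of_nat k - of_nat m"
      if "x \<in> nonzero R" "u \<in> U" "x \<otimes> \<pi> [^] m = u \<otimes> \<pi> [^] k" for x u m k
    proof (rule vI[OF that(1)])
      have "x [^] (1::nat) \<otimes> \<pi> [^] m = u \<otimes> \<pi> [^] k" using that by simp
      then show "has_value x (of_nat k - of_nat m)" unfolding has_value_def
        using that(2) by (intro exI[of _ "1::nat"] exI[of _ m] exI[of _ k] bexI[of _ u]) auto
    qed
  qed (use mult nonneg in auto)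
qed

end

context valuation_ring_of_field
begin

lemma eval_all_zero:
  assumes "x \<in> carrier R" "set p \<subseteq> {\<zero>}" shows "eval p x = \<zero>"
  using assms(2) by (induction p) (use assms(1) in auto)

text \<open>
  Either two terms of \<open>p(x)\<close> have the same value, which relates a power of \<open>x\<close> to coefficients,
  or the term of least value dominates and \<open>p(x)\<close> is a unit multiple of it.
\<close>

lemma commensurable_or_dominant_term:
  assumes x: "x \<in> carrier R" "x \<noteq> \<zero>" and \<pi>: "\<pi> \<in> carrier R"
    and K: "\<And>c. c \<in> K \<Longrightarrow> c \<in> carrier R"
      "\<And>c. c \<in> K - {\<zero>} \<Longrightarrow> \<exists>(m :: nat) (k :: nat). \<exists>u \<in> U. c \<otimes> \<pi> [^] m = u \<otimes> \<pi> [^] k"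
    and not: "\<not> (\<exists>(n :: nat) (m :: nat) (k :: nat). \<exists>u \<in> U. n > 0 \<and> x [^] n \<otimes> \<pi> [^] m = u \<otimes> \<pi> [^] k)"
  shows "set p \<subseteq> K \<Longrightarrow> \<not> set p \<subseteq> {\<zero>} \<Longrightarrow>
    \<exists>c \<in> K - {\<zero>}. \<exists>i < length p. \<exists>u \<in> U. eval p x = u \<otimes> c \<otimes> x [^] i"
proof (induction p)
  case (Cons a p)
  have aK: "a \<in> K" and pK: "set p \<subseteq> K" using Cons.prems by auto
  have aR: "a \<in> carrier R" using K(1) aK by simp
  have pR: "eval p x \<in> carrier R" using eval_in_carrier[of p x] pK K(1) x by auto
  have e: "eval (a # p) x = a \<otimes> x [^] length p \<oplus> eval p x" by simp
  show ?case
  proof (cases "set p \<subseteq> {\<zero>}")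
    case True
    have "eval (a # p) x = \<one> \<otimes> a \<otimes> x [^] length p"
      unfolding e eval_all_zero[OF x(1) True] using aR x by simp
    moreover have "a \<noteq> \<zero>" using Cons.prems True by auto
    ultimately show ?thesis using aK U_one by (metis Diff_iff length_Cons lessI singletonD)
  next
    case False
    then obtain c i u where c: "c \<in> K - {\<zero>}" "i < length p" "u \<in> U" "eval p x = u \<otimes> c \<otimes> x [^] i"
      using Cons.IH pK by blast
    have cR: "c \<in> carrier R" "c \<noteq> \<zero>" and uR: "u \<in> carrier R" "u \<noteq> \<zero>" using c K UD by auto
    have pn: "eval p x \<noteq> \<zero>" unfolding c(4)
      using cR uR x pow_nonzero[OF x] by (simp add: integral_iff)
    show ?thesis
    proof (cases "a = \<zero>")
      case True
      then have "eval (a # p) x = u \<otimes> c \<otimes> x [^] i" unfolding e using c(4) pR x cR uR by simp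
      then show ?thesis using c by (metis length_Cons less_SucI)
    next
      case a0: False
      let ?t = "a \<otimes> x [^] length p" and ?s = "eval p x"
      have tR: "?t \<in> carrier R" "?t \<noteq> \<zero>" using aR x a0 pow_nonzero[OF x]
        by (auto simp: integral_iff)
      note S = inv_facts[OF pR pn] and T = inv_facts[OF tR]
      define z where "z = ?t \<otimes> inv ?s"
      have zR: "z \<in> carrier R" "z \<noteq> \<zero>" unfolding z_def using tR S integral by auto
      have ts: "?t = ?s \<otimes> z" unfolding z_def using mult_div_cancel[OF pR pn tR(1)] by simp
      show ?thesis
      proof (cases "z \<in> V")
        case zV: True
        show ?thesis
        proof (cases "z \<in> U")
          case True
          obtain d where d: "length p = i + Suc d" using c(2) by (metis less_imp_Suc_add add_Suc_right)
          have "x [^] i \<otimes> (a \<otimes> x [^] Suc d) = x [^] i \<otimes> ((u \<otimes> z) \<otimes> c)"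
            using ts[unfolded c(4)] x aR cR uR zR
            by (simp add: d nat_pow_mult[symmetric] m_ac del: nat_pow_Suc)
          then have xd: "a \<otimes> x [^] Suc d = (u \<otimes> z) \<otimes> c"
            using m_lcancel[of "x [^] i" "a \<otimes> x [^] Suc d" "(u \<otimes> z) \<otimes> c"] x aR cR uR zR
              pow_nonzero[OF x, of i] by simp
          obtain m k :: nat and u1 where 1: "u1 \<in> U" "a \<otimes> \<pi> [^] m = u1 \<otimes> \<pi> [^] k"
            using K(2)[of a] aK a0 by auto
          obtain m' k' :: nat and u2 where 2: "u2 \<in> U" "c \<otimes> \<pi> [^] m' = u2 \<otimes> \<pi> [^] k'"
            using K(2)[of c] c by auto
          have u12: "u1 \<in> carrier R" "u2 \<in> carrier R" using UD 1 2 by auto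
          note I1 = inv_facts[OF UD(1)[OF 1(1)] UD(2)[OF 1(1)]]
          have "u1 \<otimes> (x [^] Suc d \<otimes> \<pi> [^] (k + m')) = (u1 \<otimes> \<pi> [^] k) \<otimes> x [^] Suc d \<otimes> \<pi> [^] m'"
            using u12 x \<pi> by (simp add: nat_pow_mult[symmetric] m_ac del: nat_pow_Suc)
          also have "\<dots> = (a \<otimes> x [^] Suc d) \<otimes> \<pi> [^] m \<otimes> \<pi> [^] m'"
            unfolding 1(2)[symmetric] using aR x \<pi> by (simp add: m_ac del: nat_pow_Suc)
          also have "\<dots> = u \<otimes> z \<otimes> (c \<otimes> \<pi> [^] m') \<otimes> \<pi> [^] m"
            unfolding xd using uR zR cR \<pi> by (simp add: m_ac)
          also have "\<dots> = (u \<otimes> z \<otimes> u2) \<otimes> \<pi> [^] (k' + m)"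
            unfolding 2 using uR zR u12 \<pi> by (simp add: nat_pow_mult[symmetric] m_ac)
          finally have eq: "u1 \<otimes> (x [^] Suc d \<otimes> \<pi> [^] (k + m')) = (u \<otimes> z \<otimes> u2) \<otimes> \<pi> [^] (k' + m)" .
          have "x [^] Suc d \<otimes> \<pi> [^] (k + m') = inv u1 \<otimes> (u1 \<otimes> (x [^] Suc d \<otimes> \<pi> [^] (k + m')))"
            using I1 u12 x \<pi> by (simp add: m_assoc[symmetric] del: nat_pow_Suc)
          also have "\<dots> = (inv u1 \<otimes> (u \<otimes> z \<otimes> u2)) \<otimes> \<pi> [^] (k' + m)"
            unfolding eq using I1 u12 uR zR \<pi> by (simp add: m_assoc)
          finally have "x [^] Suc d \<otimes> \<pi> [^] (k + m') = (inv u1 \<otimes> (u \<otimes> z \<otimes> u2)) \<otimes> \<pi> [^] (k' + m)" .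
          moreover have "inv u1 \<otimes> (u \<otimes> z \<otimes> u2) \<in> U"
            using U_mult U_inv c(3) True 1(1) 2(1) by simp
          ultimately show ?thesis using not by blast
        next
          case False
          have "eval (a # p) x = ?s \<otimes> (\<one> \<oplus> z)"
            unfolding e ts using pR zR by (simp add: r_distr a_comm)
          also have "\<dots> = (u \<otimes> (\<one> \<oplus> z)) \<otimes> c \<otimes> x [^] i"
            unfolding c(4) using uR cR x zR by (simp add: m_ac)
          finally have "eval (a # p) x = (u \<otimes> (\<one> \<oplus> z)) \<otimes> c \<otimes> x [^] i" .
          moreover have "u \<otimes> (\<one> \<oplus> z) \<in> U" using U_mult[OF c(3) one_plus_nonunit[OF zV False]] .
          ultimately show ?thesis using c(1,2) by (metis length_Cons less_SucI)
        qed
      next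
        case zV: False
        then have iz: "inv z \<in> V" using total zR by blast
        have "inv z \<notin> U" using UD(4)[of "inv z"] inv_facts(6)[OF zR] zV by auto
        then have w: "\<one> \<oplus> inv z \<in> U" using one_plus_nonunit iz by simp
        have "?s = ?t \<otimes> inv z" unfolding ts using pR zR inv_facts[OF zR] by (simp add: m_assoc)
        then have "eval (a # p) x = ?t \<oplus> ?t \<otimes> inv z" unfolding e by simp
        also have "\<dots> = (\<one> \<oplus> inv z) \<otimes> a \<otimes> x [^] length p"
          using aR x inv_facts[OF zR] by (simp add: l_distr r_distr m_ac)
        finally show ?thesis using w aK a0 by (metis Diff_iff length_Cons lessI singletonD)
      qed
    qed
  qed
qed simp

end

section \<open>Integrality of the leading segments of a relation\<close>

context cring
begin

lemma power_span_mono_le: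
  assumes N: "submodule_of R A N" and x: "x \<in> carrier R" and mn: "m \<le> n"
  shows "power_span R N x m \<subseteq> power_span R N x n"
  using lift_Suc_mono_le[of "power_span R N x", OF power_span_mono[OF N x] mn] .

text \<open>
  Peeling off the highest power reduces membership of the whole span to that of the powers of \<open>x\<close>.
\<close>

lemma power_span_subset:
  assumes T: "submodule_of R A T" and x: "x \<in> carrier R" and A: "subring A R"
  shows "(\<And>i. i < n \<Longrightarrow> x [^] i \<in> T) \<Longrightarrow> power_span R A x n \<subseteq> T"
proof (induction n)
  case 0
  then show ?case using submodule_ofD(2)[OF T] by simp
next
  case (Suc n)
  have IH: "power_span R A x n \<subseteq> T" using Suc by simp
  show ?case
  proof
    fix z assume "z \<in> power_span R A x (Suc n)"
    then obtain a b where ab: "a \<in> A" "b \<in> power_span R A x n" "z = x [^] n \<otimes> a \<oplus> b"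
      using power_span_Suc_top[OF submodule_of_self[OF A] x] by blast
    have "a \<in> carrier R" using ab subringE(1)[OF A] by auto
    then have "z = a \<otimes> x [^] n \<oplus> b" using ab x by (simp add: m_comm)
    then show "z \<in> T"
      using submodule_ofD(3)[OF T submodule_ofD(4)[OF T ab(1) Suc.prems[of n]]] IH ab(2) by auto
  qed
qed

end

context domain
begin

lemma eval_append_zeros:
  assumes p: "set p \<subseteq> carrier R" and x: "x \<in> carrier R"
  shows "eval (p @ replicate i \<zero>) x = eval p x \<otimes> x [^] i"
proof -
  have "eval (replicate i \<zero>) x = \<zero>" using x by (induction i) auto
  then show ?thesis
    using eval_append[OF p _ x, of "replicate i \<zero>"] eval_in_carrier[OF p x] x
    by (simp add: set_replicate_conv_if)
qed

text \<open>
  Multiplying the front part of a relation by a power of \<open>x\<close> either does not reach the degree of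
  the relation, or can be rewritten by means of the back part; so it stabilises the module
  spanned by the lower powers.
\<close>

lemma integral_over_eval_prefix:
  assumes A: "subring A R" and AN: "noetherian_ring (R\<lparr>carrier := A\<rparr>)" and x: "x \<in> carrier R"
    and p: "set p \<subseteq> A" and q: "set q \<subseteq> A" and e: "eval (p @ q) x = \<zero>"
  shows "integral_over R A (eval p x)"
proof -
  have AR: "A \<subseteq> carrier R" using subringE(1)[OF A] .
  have pR: "set p \<subseteq> carrier R" and qR: "set q \<subseteq> carrier R" using p q AR by auto
  have bR: "eval p x \<in> carrier R" "eval q x \<in> carrier R"
    using eval_in_carrier[OF pR x] eval_in_carrier[OF qR x] by auto
  have sA: "submodule_of R A A" by (rule submodule_of_self[OF A])
  have zA: "\<zero> \<in> A" using subringE(2)[OF A] .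
  show ?thesis
  proof (cases "p = [] \<or> q = []")
    case True
    then have "eval p x = \<zero>" using e by auto
    then show ?thesis using integral_over_self[OF A zA] by simp
  next
    case False
    (* the degree of the relation *)
    define d where "d = length p + length q - 1"
    obtain d' where d': "d = Suc d'" "length p \<le> d" "length q \<le> d"
    proof -
      have "length p \<noteq> 0" "length q \<noteq> 0" using False by auto
      then show ?thesis using that[of "d - 1"] unfolding d_def by linarith
    qed
    define N where "N = power_span R A x d"
    have nN: "noetherian_submodule R A N"
      unfolding N_def by (rule noetherian_power_span[OF noetherian_submodule_self[OF A AN] A x])
    note sN = noetherian_submodule_imp_submodule_of[OF nN]
    have mem: "eval r x \<in> N" if "set r \<subseteq> A" "length r \<le> d" for r
      using eval_mem_power_span[OF A x that(1)] power_span_mono_le[OF sA x that(2)] by (auto simp: N_def)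
    have rel: "eval p x \<otimes> x [^] length q = \<ominus> eval q x"
    proof -
      have "eval p x \<otimes> x [^] length q \<oplus> eval q x = \<zero>" using eval_append[OF pR qR x] e by simp
      then show ?thesis using minus_equality bR x by simp
    qed
    have pow: "eval p x \<otimes> x [^] i \<in> N" if i: "i < d" for i
    proof (cases "i < length q")
      case True
      have "eval (p @ replicate i \<zero>) x \<in> N"
        by (rule mem) (use p zA True in \<open>auto simp: d_def\<close>)
      then show ?thesis using eval_append_zeros[OF pR x] by simp
    next
      case False
      then obtain j where j: "i = length q + j" by (metis le_iff_add not_less)
      have "eval p x \<otimes> x [^] i = (eval p x \<otimes> x [^] length q) \<otimes> x [^] j"
        using bR x by (simp add: j nat_pow_mult[symmetric] m_assoc)
      also have "\<dots> = \<ominus> eval (q @ replicate j \<zero>) x"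
        unfolding rel eval_append_zeros[OF qR x] using bR x by (simp add: l_minus)
      finally have *: "eval p x \<otimes> x [^] i = \<ominus> eval (q @ replicate j \<zero>) x" .
      have "eval (q @ replicate j \<zero>) x \<in> N"
        by (rule mem) (use q zA i j in auto)
      then show ?thesis using * submodule_of_uminus[OF A sN] by simp
    qed
    define T where "T = {z \<in> carrier R. eval p x \<otimes> z \<in> N}"
    have "submodule_of R A T"
    proof (rule submodule_ofI)
      show "\<zero> \<in> T" using submodule_ofD(2)[OF sN] bR by (simp add: T_def)
      show "y \<oplus> z \<in> T" if "y \<in> T" "z \<in> T" for y z
        using that submodule_ofD(3)[OF sN] bR by (simp add: T_def r_distr)
      show "a \<otimes> z \<in> T" if "a \<in> A" "z \<in> T" for a z
      proof -
        have aR: "a \<in> carrier R" using that AR by auto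
        have "eval p x \<otimes> (a \<otimes> z) = a \<otimes> (eval p x \<otimes> z)"
          using aR bR that by (auto simp: T_def intro: m_lcomm)
        then show ?thesis using that submodule_ofD(4)[OF sN] aR by (simp add: T_def)
      qed
    qed (simp add: T_def)
    then have "N \<subseteq> T"
      unfolding N_def by (rule power_span_subset[OF _ x A]) (use pow x in \<open>simp add: T_def\<close>)
    moreover have "\<one> \<in> N"
      using subset_power_span_Suc[OF sA AR x] subringE(3)[OF A] unfolding N_def d'(1) by blast
    ultimately show ?thesis
      using integral_over_if_stable[OF A nN bR(1) _ one_not_zero] unfolding T_def by blast
  qed
qed

lemma eval_map_mult:
  assumes c: "c \<in> carrier R" and x: "x \<in> carrier R" and p: "set p \<subseteq> carrier R"
  shows "eval (map ((\<otimes>) c) p) x = c \<otimes> eval p x"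
  using p
proof (induction p)
  case (Cons a p)
  then show ?case using c x eval_in_carrier[of p x] by (simp add: r_distr m_assoc)
qed (use c in simp)

end


context subring_of_field
begin

lemma eval_closed:
  assumes x: "x \<in> A" shows "set q \<subseteq> A \<Longrightarrow> eval q x \<in> A"
  by (induction q) (use x in auto)

end

locale integral_closure_of_dedekind = field R for R :: "('a, 'b) ring_scheme" (structure) +
  fixes \<oo> K \<OO>
  assumes sub: "subring \<oo> R"
    and ded: "dedekind_domain R \<oo>"
    and not_field: "\<not> field (R\<lparr>carrier := \<oo>\<rparr>)"
    and K: "K = fraction_field R \<oo>"
    and alg: "x \<in> carrier R \<Longrightarrow> (ring.algebraic R over K) x"
    and \<OO>: "\<OO> = integral_closure R \<oo> (carrier R)"
begin

sublocale \<oo>: subring_of_field R \<oo>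
  by (intro subring_of_field.intro field_axioms subring_of_field_axioms.intro sub)

lemma noeth: "noetherian_ring (R\<lparr>carrier := \<oo>\<rparr>)"
  using ded by (simp add: dedekind_domain_def noetherian_domain_def)

sublocale \<OO>: subring_of_field R \<OO>
  unfolding \<OO>
  by (intro subring_of_field.intro field_axioms subring_of_field_axioms.intro
      subring_integral_closure[OF sub noeth])

lemma \<OO>_iff: "x \<in> \<OO> \<longleftrightarrow> x \<in> carrier R \<and> integral_over R \<oo> x"
  by (simp add: \<OO> integral_closure_def)

lemma \<oo>_subset: "\<oo> \<subseteq> \<OO>"
  using integral_over_self[OF sub] \<oo>.A_carrier by (auto simp: \<OO>_iff)

lemma K_carrier: "c \<in> K \<Longrightarrow> c \<in> carrier R"
  unfolding K \<oo>.fraction_field_iff by simp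

lemma integral_in_K: "c \<in> K \<Longrightarrow> c \<in> \<OO> \<Longrightarrow> c \<in> \<oo>"
  using ded unfolding dedekind_domain_def integral_closure_def \<OO>_iff K by blast

lemma subring_K: "subring K R" and \<oo>_subset_K: "\<oo> \<subseteq> K"
proof -
  have "submodule_of R \<oo> {\<zero>}" using \<oo>.A_carrier by (intro submodule_ofI) auto
  then have p: "primeideal {\<zero>} (R\<lparr>carrier := \<oo>\<rparr>)"
    unfolding \<oo>.primeideal_iff using \<oo>.A_carrier by (auto simp: integral_iff)
  have "K = localization_at R \<oo> {\<zero>}" by (simp add: K fraction_field_def localization_at_def)
  then show "subring K R" "\<oo> \<subseteq> K" using \<oo>.subring_localization_at[OF p] by auto
qed

sublocale K: subring_of_field R K
  by (intro subring_of_field.intro field_axioms subring_of_field_axioms.intro subring_K)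

lemma K_inv:
  assumes c: "c \<in> K" "c \<noteq> \<zero>" shows "inv c \<in> K"
proof -
  obtain s where s: "s \<in> \<oo> - {\<zero>}" "s \<otimes> c \<in> \<oo>" "c \<in> carrier R"
    using c unfolding K \<oo>.fraction_field_iff by blast
  have sR: "s \<in> carrier R" using s \<oo>.A_carrier by auto
  note I = inv_facts[OF s(3) c(2)]
  have "(s \<otimes> c) \<otimes> inv c = s" using sR s I by (simp add: m_assoc)
  then have "(s \<otimes> c) \<otimes> inv c \<in> \<oo>" using s by simp
  moreover have "s \<otimes> c \<in> \<oo> - {\<zero>}" using s sR c by (auto simp: integral_iff)
  ultimately show ?thesis using I(2) unfolding K \<oo>.fraction_field_iff by blast
qed

lemma algebraic_relation:
  assumes x: "x \<in> carrier R"
  shows "\<exists>p. set p \<subseteq> K \<and> \<not> set p \<subseteq> {\<zero>} \<and> eval p x = \<zero>"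
proof -
  obtain p where p: "p \<in> carrier (K[X])" "p \<noteq> []" "eval p x = \<zero>"
    using algebraicE[OF subring_K x alg[OF x]] by blast
  then have "polynomial K p" by (simp add: univ_poly_def)
  then have "set p \<subseteq> K" "\<not> set p \<subseteq> {\<zero>}" using p(2) by (cases p; auto simp: polynomial_def)+
  then show ?thesis using p(3) by blast
qed

text \<open>
  The constant coefficient of a relation is a multiple of \<open>x\<close>; if it vanishes then \<open>x\<close> cancels.
\<close>

lemma multiple_in_\<oo>_if_relation:
  assumes x: "x \<in> \<OO>" "x \<noteq> \<zero>"
  shows "set q \<subseteq> \<oo> \<Longrightarrow> \<not> set q \<subseteq> {\<zero>} \<Longrightarrow> eval q x = \<zero> \<Longrightarrow>
    \<exists>c \<in> \<oo> - {\<zero>}. \<exists>y \<in> \<OO>. c = x \<otimes> y"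
proof (induction q rule: rev_induct)
  case (snoc a q)
  have xR: "x \<in> carrier R" using x \<OO>.A_carrier by simp
  have aR: "a \<in> carrier R" and qR: "set q \<subseteq> carrier R" using snoc.prems \<oo>.A_carrier by auto
  have eO: "eval q x \<in> \<OO>" using \<OO>.eval_closed[OF x(1)] snoc.prems \<oo>_subset by auto
  have eR: "eval q x \<in> carrier R" using eO \<OO>.A_carrier by simp
  have e: "eval q x \<otimes> x \<oplus> a = \<zero>" using eval_append_aux[OF qR aR xR] snoc.prems by simp
  show ?case
  proof (cases "a = \<zero>")
    case True
    then have "eval q x = \<zero>" using e eR xR x by (simp add: integral_iff)
    then show ?thesis using snoc True by auto
  next
    case False
    have "a \<oplus> eval q x \<otimes> x = \<zero>" using e aR eR xR by (simp add: a_comm)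
    then have "a = \<ominus> (eval q x \<otimes> x)" using minus_equality[of a "eval q x \<otimes> x"] aR eR xR by simp
    then have "a = x \<otimes> (\<ominus> eval q x)" using eR xR by (simp add: r_minus m_comm)
    then show ?thesis using False snoc.prems eO by (intro bexI[of _ a] bexI[of _ "\<ominus> eval q x"]) auto
  qed
qed simp

lemma exists_multiple_in_\<oo>:
  assumes x: "x \<in> \<OO>" "x \<noteq> \<zero>"
  obtains c y where "c \<in> \<oo>" "c \<noteq> \<zero>" "y \<in> \<OO>" "c = x \<otimes> y"
proof -
  obtain q where q: "polynomial \<oo> q" "q \<noteq> []" "hd q = \<one>" "eval q x = \<zero>"
    using x unfolding \<OO>_iff integral_over_def by blast
  have "set q \<subseteq> \<oo>" using q by (auto simp: polynomial_def)
  moreover have "\<not> set q \<subseteq> {\<zero>}" using q(2,3) one_not_zero by (cases q) auto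
  ultimately show ?thesis using multiple_in_\<oo>_if_relation[OF x _ _ q(4)] that by auto
qed

end

section \<open>The valuation at a maximal ideal of the integral closure\<close>

lemma normalized_valuationD:
  assumes "normalized_valuation L K B P v"
  shows "v \<in> extensional (nonzero L)"
    "\<And>x y. x \<in> nonzero L \<Longrightarrow> y \<in> nonzero L \<Longrightarrow> v (x \<otimes>\<^bsub>L\<^esub> y) = v x + v y"
    "\<And>x y. x \<in> nonzero L \<Longrightarrow> y \<in> nonzero L \<Longrightarrow> x \<oplus>\<^bsub>L\<^esub> y \<noteq> \<zero>\<^bsub>L\<^esub> \<Longrightarrow>
      v (x \<oplus>\<^bsub>L\<^esub> y) \<ge> min (v x) (v y)"
    "\<And>x. x \<in> nonzero L \<Longrightarrow> v x \<ge> 0 \<longleftrightarrow> x \<in> localization_at L B P"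
    "v ` (K - {\<zero>\<^bsub>L\<^esub>}) = \<int>"
proof -
  note * = assms[unfolded normalized_valuation_def]
  note r = conjunct1[OF conjunct2[OF conjunct2[OF conjunct2[OF *]]]]
  show "v \<in> extensional (nonzero L)" by (rule conjunct1[OF *])
  show "v (x \<otimes>\<^bsub>L\<^esub> y) = v x + v y" if "x \<in> nonzero L" "y \<in> nonzero L" for x y
    using conjunct1[OF conjunct2[OF *]] that by blast
  show "v (x \<oplus>\<^bsub>L\<^esub> y) \<ge> min (v x) (v y)"
    if "x \<in> nonzero L" "y \<in> nonzero L" "x \<oplus>\<^bsub>L\<^esub> y \<noteq> \<zero>\<^bsub>L\<^esub>" for x y
    using conjunct1[OF conjunct2[OF conjunct2[OF *]]] that by blast
  show "v x \<ge> 0 \<longleftrightarrow> x \<in> localization_at L B P" if "x \<in> nonzero L" for x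
    using that unfolding r[symmetric] by simp
  show "v ` (K - {\<zero>\<^bsub>L\<^esub>}) = \<int>" by (rule conjunct2[OF conjunct2[OF conjunct2[OF conjunct2[OF *]]]])
qed

locale integral_closure_at_prime = integral_closure_of_dedekind +
  fixes P
  assumes P: "P \<in> max_ideals R \<OO>"
begin

lemmas P_prime = \<OO>.max_ideal_prime[OF P]
lemmas PD = \<OO>.primeidealD[OF P_prime]

definition p where "p = P \<inter> \<oo>"

text \<open>
  The zero ideal is not maximal in \<open>\<OO>\<close>: an element \<open>c\<close> of \<open>\<oo>\<close> whose inverse is not in \<open>\<oo>\<close> is not invertible in
  \<open>\<OO>\<close> either, since \<open>\<oo>\<close> is integrally closed.
\<close>

lemma P_nonzero: "P \<noteq> {\<zero>}"
proof
  assume P0: "P = {\<zero>}"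
  obtain c where c: "c \<in> \<oo>" "c \<noteq> \<zero>" "inv c \<notin> \<oo>"
    using subfieldI'[OF sub] subfield_iff(2) not_field by blast
  have cR: "c \<in> carrier R" using c \<oo>.A_carrier by simp
  note I = inv_facts[OF cR c(2)]
  have "submodule_of R \<OO> ((\<otimes>) c ` \<OO>)"
    using submodule_of_scale[OF submodule_of_self[OF \<OO>.subring] cR] \<OO>.A_carrier by blast
  moreover have "P \<subseteq> (\<otimes>) c ` \<OO>" using P0 cR by (auto intro!: image_eqI[of _ _ \<zero>])
  moreover have "(\<otimes>) c ` \<OO> \<subseteq> \<OO>" using c \<oo>_subset by auto
  ultimately have "(\<otimes>) c ` \<OO> = P \<or> (\<otimes>) c ` \<OO> = \<OO>" using P unfolding \<OO>.max_ideals_iff by blast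
  moreover have "c \<in> (\<otimes>) c ` \<OO>" using cR by (auto intro!: image_eqI[of _ _ \<one>])
  ultimately have "\<one> \<in> (\<otimes>) c ` \<OO>" using P0 c by auto
  then obtain d where d: "d \<in> \<OO>" "\<one> = c \<otimes> d" by auto
  then have "inv c = d" using comm_inv_char[OF cR, of d] \<OO>.A_carrier by simp
  then have "inv c \<in> \<OO>" using d by simp
  then have "inv c \<in> \<oo>" using integral_in_K K_inv[of c] \<oo>_subset_K c by blast
  then show False using c by simp
qed

lemma p_prime: "primeideal p (R\<lparr>carrier := \<oo>\<rparr>)"
  unfolding \<oo>.primeideal_iff
proof (intro conjI ballI impI)
  show "submodule_of R \<oo> p"
    unfolding p_def using PD(2,4) submodule_ofD(3)[OF PD(1)] PD(7) \<oo>_subset \<oo>.A_carrier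
    by (intro submodule_ofI) auto
  fix a b assume "a \<in> \<oo>" "b \<in> \<oo>" "a \<otimes> b \<in> p"
  then show "a \<in> p \<or> b \<in> p" using PD(5)[of a b] \<oo>_subset by (auto simp: p_def)
qed (use PD(3) in \<open>simp_all add: p_def\<close>)

lemma p_nonzero: "p \<noteq> {\<zero>}"
proof -
  obtain x where x: "x \<in> P" "x \<noteq> \<zero>" using P_nonzero PD(4) by blast
  then obtain c y where c: "c \<in> \<oo>" "c \<noteq> \<zero>" "y \<in> \<OO>" "c = x \<otimes> y"
    using exists_multiple_in_\<oo>[of x] PD(2) by blast
  then have "c \<in> p" using PD(6)[OF x(1)] by (simp add: p_def)
  then show ?thesis using c(2) by blast
qed

sublocale p: dedekind_prime R \<oo> p
  by (intro dedekind_prime.intro dedekind_prime_axioms.intro \<oo>.subring_of_field_axioms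
      ded p_prime p_nonzero)

definition V where "V = localization_at R \<OO> P"

lemma V_iff: "x \<in> V \<longleftrightarrow> x \<in> carrier R \<and> (\<exists>s \<in> \<OO> - P. s \<otimes> x \<in> \<OO>)"
  unfolding V_def by (rule \<OO>.localization_at_iff[OF P_prime])

lemma outside_p: "s \<in> \<oo> - p \<Longrightarrow> s \<in> \<OO> - P"
  using \<oo>_subset by (auto simp: p_def)

text \<open>
  Every non-zero element of \<open>K\<close> is, up to fractions with numerator and denominator outside \<open>p\<close>, a quotient of
  powers of \<open>\<pi>\<close>.
\<close>

definition uniformizer :: "'a \<Rightarrow> bool" where
  "uniformizer \<pi> \<longleftrightarrow> \<pi> \<in> p \<and> \<pi> \<noteq> \<zero> \<and> (\<forall>c \<in> K - {\<zero>}.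
    \<exists>(m :: nat) (n :: nat). \<exists>s \<in> \<oo> - p. \<exists>t \<in> \<oo> - p. t \<otimes> c \<otimes> \<pi> [^] m = s \<otimes> \<pi> [^] n)"

lemma uniformizerD:
  assumes "uniformizer \<pi>"
  shows "\<pi> \<in> p" "\<pi> \<noteq> \<zero>" "\<And>c. c \<in> K - {\<zero>} \<Longrightarrow>
    \<exists>(m :: nat) (n :: nat). \<exists>s \<in> \<oo> - p. \<exists>t \<in> \<oo> - p. t \<otimes> c \<otimes> \<pi> [^] m = s \<otimes> \<pi> [^] n"
proof -
  note * = assms[unfolded uniformizer_def]
  show "\<pi> \<in> p" "\<pi> \<noteq> \<zero>" using * by simp_all
  show "\<exists>(m :: nat) (n :: nat). \<exists>s \<in> \<oo> - p. \<exists>t \<in> \<oo> - p. t \<otimes> c \<otimes> \<pi> [^] m = s \<otimes> \<pi> [^] n"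
    if "c \<in> K - {\<zero>}" for c
    by (rule bspec[OF conjunct2[OF conjunct2[OF *]] that])
qed

lemma exists_uniformizer: "\<exists>\<pi>. uniformizer \<pi>"
proof -
  obtain \<pi> where \<pi>: "\<pi> \<in> p" "\<pi> \<noteq> \<zero>" and dec:
    "\<And>c. c \<in> \<oo> - {\<zero>} \<Longrightarrow> \<exists>n :: nat. \<exists>s \<in> \<oo> - p. \<exists>t \<in> \<oo> - p. t \<otimes> c = s \<otimes> \<pi> [^] n"
    by (rule p.exists_uniformizer) blast
  have \<pi>R: "\<pi> \<in> carrier R" using \<pi> p.p_carrier by simp
  have "uniformizer \<pi>"
    unfolding uniformizer_def
  proof (intro conjI ballI \<pi>)
    fix c assume c: "c \<in> K - {\<zero>}"
    then have cR: "c \<in> carrier R" using K_carrier by simp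
    obtain b where b: "b \<in> \<oo> - {\<zero>}" "b \<otimes> c \<in> \<oo>"
      using DiffD1[OF c] unfolding K \<oo>.fraction_field_iff by blast
    have bR: "b \<in> carrier R" using b \<oo>.A_carrier by simp
    have "b \<otimes> c \<in> \<oo> - {\<zero>}" using b c bR cR by (auto simp: integral_iff)
    then obtain n :: nat and s t where s: "s \<in> \<oo> - p" "t \<in> \<oo> - p" "t \<otimes> (b \<otimes> c) = s \<otimes> \<pi> [^] n"
      using dec by blast
    obtain n' :: nat and s' t' where s': "s' \<in> \<oo> - p" "t' \<in> \<oo> - p" "t' \<otimes> b = s' \<otimes> \<pi> [^] n'"
      using dec[OF b(1)] by blast
    have R: "s \<in> carrier R" "t \<in> carrier R" "s' \<in> carrier R" "t' \<in> carrier R"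
      using s s' \<oo>.A_carrier by auto
    have "(t \<otimes> s') \<otimes> c \<otimes> \<pi> [^] n' = t \<otimes> (s' \<otimes> \<pi> [^] n') \<otimes> c" using R cR \<pi>R by (simp add: m_ac)
    also have "\<dots> = t' \<otimes> (t \<otimes> (b \<otimes> c))" unfolding s'(3)[symmetric] using R cR bR by (simp add: m_ac)
    also have "\<dots> = (t' \<otimes> s) \<otimes> \<pi> [^] n" unfolding s(3) using R \<pi>R by (simp add: m_assoc)
    finally show "\<exists>(m :: nat) (n :: nat). \<exists>s \<in> \<oo> - p. \<exists>t \<in> \<oo> - p. t \<otimes> c \<otimes> \<pi> [^] m = s \<otimes> \<pi> [^] n"
      using p.pD(5)[OF s(2) s'(1)] p.pD(5)[OF s'(2) s(1)] by blast
  qed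
  then show ?thesis by blast
qed

text \<open>
  This is the fact that \<open>\<oo>\<close> localized at \<open>p\<close> is a valuation ring of \<open>K\<close>, stated with denominators.
\<close>

lemma local_comparison:
  assumes c: "c \<in> K - {\<zero>}"
  shows "(\<exists>t \<in> \<oo> - p. t \<otimes> c \<in> \<oo>) \<or> (\<exists>d \<in> \<oo>. d \<otimes> c \<in> \<oo> - p)"
proof -
  obtain \<pi> where "uniformizer \<pi>" using exists_uniformizer by blast
  note \<pi> = uniformizerD(1,2)[OF this] and dec = uniformizerD(3)[OF this]
  obtain m n :: nat and s t where s: "s \<in> \<oo> - p" "t \<in> \<oo> - p" "t \<otimes> c \<otimes> \<pi> [^] m = s \<otimes> \<pi> [^] n"
    using dec[OF c] by blast
  have \<pi>R: "\<pi> \<in> carrier R" "\<pi> \<in> \<oo>" using \<pi> p.p_carrier p.pD(2) by auto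
  have R: "s \<in> carrier R" "t \<in> carrier R" "c \<in> carrier R" using s c \<oo>.A_carrier K_carrier by auto
  show ?thesis
  proof (cases "m \<le> n")
    case True
    then obtain k where n: "n = m + k" by (metis le_iff_add)
    have "\<pi> [^] m \<otimes> (t \<otimes> c) = \<pi> [^] m \<otimes> (s \<otimes> \<pi> [^] k)"
      using s(3) R \<pi>R by (simp add: n nat_pow_mult[symmetric] m_ac)
    then have "t \<otimes> c = s \<otimes> \<pi> [^] k"
      using m_lcancel[OF pow_nonzero[OF \<pi>R(1) \<pi>(2)], of m "t \<otimes> c" "s \<otimes> \<pi> [^] k"] R \<pi>R by simp
    then have "t \<otimes> c \<in> \<oo>" using s \<pi>R by simp
    then show ?thesis using s by blast
  next
    case False
    then obtain k where m: "m = n + k" by (metis le_iff_add nat_le_linear)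
    have "\<pi> [^] n \<otimes> (t \<otimes> \<pi> [^] k \<otimes> c) = \<pi> [^] n \<otimes> s"
      using s(3) R \<pi>R by (simp add: m nat_pow_mult[symmetric] m_ac)
    then have "t \<otimes> \<pi> [^] k \<otimes> c = s"
      using m_lcancel[OF pow_nonzero[OF \<pi>R(1) \<pi>(2)], of n "t \<otimes> \<pi> [^] k \<otimes> c" s] R \<pi>R by simp
    then show ?thesis using s \<pi>R by (intro disjI2 bexI[of _ "t \<otimes> \<pi> [^] k"]) auto
  qed
qed

text \<open>
  Dividing by an entry of least value makes the list locally integral with a unit entry. The induction
  compares each new entry with the least one so far.
\<close>

lemma primitive_multiple:
  "set l \<subseteq> K \<Longrightarrow> \<not> set l \<subseteq> {\<zero>} \<Longrightarrow>
    \<exists>c \<in> K. (\<forall>a \<in> set l. c \<otimes> a \<in> \<oo>) \<and> (\<exists>a \<in> set l. c \<otimes> a \<notin> p)"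
proof (induction l)
  case (Cons a l)
  have aK: "a \<in> K" and lK: "set l \<subseteq> K" using Cons.prems by auto
  have aR: "a \<in> carrier R" using aK K_carrier by simp
  show ?case
  proof (cases "set l \<subseteq> {\<zero>}")
    case True
    then have a: "a \<noteq> \<zero>" using Cons.prems by auto
    note I = inv_facts[OF aR a]
    have "inv a \<otimes> a = \<one>" "inv a \<otimes> \<zero> = \<zero>" using I by auto
    then have "\<forall>b \<in> set (a # l). inv a \<otimes> b \<in> \<oo>" "inv a \<otimes> a \<notin> p"
      using True p.pD(3) by auto
    then show ?thesis using K_inv[OF aK a] by auto
  next
    case False
    then obtain c where c: "c \<in> K" "\<And>b. b \<in> set l \<Longrightarrow> c \<otimes> b \<in> \<oo>" "\<exists>b \<in> set l. c \<otimes> b \<notin> p"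
      using Cons.IH lK by blast
    obtain b where b: "b \<in> set l" "c \<otimes> b \<notin> p" using c(3) by blast
    have cR: "c \<in> carrier R" using c K_carrier by simp
    have lR: "e \<in> carrier R" if "e \<in> set l" for e using lK K_carrier that by auto
    show ?thesis
    proof (cases "c \<otimes> a = \<zero>")
      case True
      then show ?thesis using c b by (intro bexI[of _ c]) auto
    next
      case nz: False
      have "c \<otimes> a \<in> K - {\<zero>}" using c aK nz by simp
      then consider t where "t \<in> \<oo> - p" "t \<otimes> (c \<otimes> a) \<in> \<oo>" | d where "d \<in> \<oo>" "d \<otimes> (c \<otimes> a) \<in> \<oo> - p"
        using local_comparison by blast
      then show ?thesis
      proof cases
        case 1
        have tR: "t \<in> carrier R" "t \<in> K" using 1 \<oo>.A_carrier \<oo>_subset_K by auto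
        have "t \<otimes> (c \<otimes> b) \<notin> p" using p.pD(5)[of t "c \<otimes> b"] 1 b c(2) by auto
        then have "t \<otimes> c \<otimes> b \<notin> p" using tR cR lR[OF b(1)] by (simp add: m_assoc)
        moreover have "\<forall>e \<in> set (a # l). t \<otimes> c \<otimes> e \<in> \<oo>"
          using 1 c(2) tR cR lR aR by (auto simp: m_assoc)
        ultimately show ?thesis using b(1) tR c(1) by (intro bexI[of _ "t \<otimes> c"]) auto
      next
        case 2
        have dR: "d \<in> carrier R" "d \<in> K" using 2 \<oo>.A_carrier \<oo>_subset_K by auto
        have "\<forall>e \<in> set (a # l). d \<otimes> c \<otimes> e \<in> \<oo>" "d \<otimes> c \<otimes> a \<notin> p"
          using 2 c(2) dR cR lR aR by (auto simp: m_assoc)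
        then show ?thesis using dR c(1) by (intro bexI[of _ "d \<otimes> c"]) auto
      qed
    qed
  qed
qed simp

text \<open>
  Let \<open>x\<close> be a root of a polynomial over \<open>\<oo>\<close> with a coefficient outside \<open>P\<close>. The values \<open>b\<close> of
  its leading segments at \<open>x\<close> are integral, and so are the products \<open>b x\<close>; each coefficient is a
  difference of such elements. So some \<open>b\<close> or some \<open>b x\<close> lies outside \<open>P\<close>, and it serves as a
  denominator of \<open>x\<close> or of \<open>x\<inverse>\<close>.
\<close>

lemma V_total:
  assumes x: "x \<in> carrier R" "x \<noteq> \<zero>"
  shows "x \<in> V \<or> inv x \<in> V"
proof -
  obtain l where l: "set l \<subseteq> K" "\<not> set l \<subseteq> {\<zero>}" "eval l x = \<zero>" using algebraic_relation[OF x(1)] by blast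
  obtain c where c: "c \<in> K" "\<forall>a \<in> set l. c \<otimes> a \<in> \<oo>" "\<exists>a \<in> set l. c \<otimes> a \<notin> p"
    using primitive_multiple[OF l(1,2)] by blast
  define q where "q = map ((\<otimes>) c) l"
  have q\<oo>: "set q \<subseteq> \<oo>" using c(2) by (auto simp: q_def)
  then have qR: "set q \<subseteq> carrier R" using \<oo>.A_carrier by auto
  have lR: "set l \<subseteq> carrier R" using l(1) K_carrier by auto
  have q0: "eval q x = \<zero>"
    unfolding q_def eval_map_mult[OF K_carrier[OF c(1)] x(1) lR] l(3) using K_carrier[OF c(1)] by simp
  obtain i where i: "i < length q" "q ! i \<notin> p"
    using c(3) by (auto simp: q_def in_set_conv_nth)
  (* the values of the leading segments *)
  define b where "b i = eval (take i q) x" for i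
  have bO: "b i \<in> \<OO>" for i
  proof -
    have s: "set (take i q) \<subseteq> \<oo>" "set (drop i q) \<subseteq> \<oo>"
      using q\<oo> set_take_subset[of i q] set_drop_subset[of i q] by auto
    have "integral_over R \<oo> (b i)"
      unfolding b_def by (rule integral_over_eval_prefix[OF sub noeth x(1) s]) (simp add: q0)
    moreover have "set (take i q) \<subseteq> carrier R" using s \<oo>.A_carrier by auto
    then have "b i \<in> carrier R" unfolding b_def using eval_in_carrier x by simp
    ultimately show ?thesis by (simp add: \<OO>_iff)
  qed
  then have bR: "b i \<in> carrier R" for i using \<OO>.A_carrier by simp
  have rec: "b (Suc i) = b i \<otimes> x \<oplus> q ! i" if "i < length q" for i
  proof -
    have "set (take i q) \<subseteq> carrier R" "q ! i \<in> carrier R"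
      using qR set_take_subset[of i q] nth_mem[OF that] by auto
    then show ?thesis using eval_append_aux[of "take i q" "q ! i" x] x that
      by (simp add: b_def take_Suc_conv_app_nth)
  qed
  have qi: "q ! i \<in> \<oo>" "q ! i \<in> carrier R" if "i < length q" for i
    using nth_mem[OF that] q\<oo> qR by auto
  have bx: "b i \<otimes> x \<in> \<OO>" if j: "i < length q" for i
  proof -
    have "b i \<otimes> x = b (Suc i) \<ominus> q ! i"
      unfolding rec[OF j] using qi[OF j] bR x by (simp add: a_minus_def a_assoc r_neg)
    then show ?thesis using bO qi[OF j] \<oo>_subset by auto
  qed
  have "q ! i \<in> \<OO> - P" using i qi \<oo>_subset by (auto simp: p_def)
  moreover have "q ! i = b (Suc i) \<oplus> \<ominus> (b i \<otimes> x)"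
    unfolding rec[OF i(1)] using qi(2)[OF i(1)] bR[of i] x by (simp add: a_comm[of "b i \<otimes> x"] a_assoc r_neg)
  ultimately have "\<not> (b (Suc i) \<in> P \<and> b i \<otimes> x \<in> P)"
    using submodule_ofD(3)[OF PD(1)] submodule_of_uminus[OF \<OO>.subring PD(1)] by auto
  then consider "b (Suc i) \<notin> P" | "b i \<otimes> x \<notin> P" by blast
  then show ?thesis
  proof cases
    case 1
    have "Suc i < length q"
    proof (rule ccontr)
      assume "\<not> Suc i < length q"
      then have "b (Suc i) = \<zero>" using i(1) q0 by (simp add: b_def)
      then show False using 1 PD(4) by simp
    qed
    then have "b (Suc i) \<otimes> x \<in> \<OO>" by (rule bx)
    then show ?thesis unfolding V_iff using 1 bO[of "Suc i"] x by blast
  next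
    case 2
    have "b i \<otimes> x \<otimes> inv x = b i" using inv_facts[OF x] bR[of i] x by (simp add: m_assoc)
    then have "b i \<otimes> x \<otimes> inv x \<in> \<OO>" using bO by simp
    then show ?thesis unfolding V_iff using 2 bx[OF i(1)] inv_facts(2)[OF x] by blast
  qed
qed

sublocale V: valuation_ring_of_field R V
proof (intro valuation_ring_of_field.intro valuation_ring_of_field_axioms.intro
    subring_of_field.intro field_axioms subring_of_field_axioms.intro)
  show "subring V R" unfolding V_def by (rule \<OO>.subring_localization_at(1)[OF P_prime])
qed (rule V_total)

lemma outside_p_unit: "s \<in> \<oo> - p \<Longrightarrow> s \<in> V.U"
proof -
  assume "s \<in> \<oo> - p"
  then have s: "s \<in> \<OO> - P" by (rule outside_p)
  have sR: "s \<in> carrier R" "s \<noteq> \<zero>" using s \<OO>.A_carrier PD(4) by auto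
  have "s \<in> V" using s \<OO>.subring_localization_at(2)[OF P_prime] by (auto simp: V_def)
  moreover have "s \<otimes> inv s \<in> \<OO>" using inv_facts(4)[OF sR] by simp
  then have "inv s \<in> V" unfolding V_iff using s inv_facts(2)[OF sR] by blast
  ultimately show ?thesis using sR by (simp add: V.U_def)
qed

text \<open>
  A relation for \<open>x\<close> over \<open>K\<close> has no dominant term, as it evaluates to zero. Hence the value of \<open>x\<close> is
  commensurable with that of the uniformizer, and a rational valuation exists.
\<close>

theorem exists_normalized_valuation: "\<exists>v. normalized_valuation R K \<OO> P v"
proof -
  obtain \<pi> where "uniformizer \<pi>" using exists_uniformizer by blast
  note \<pi> = uniformizerD(1,2)[OF this] and dec = uniformizerD(3)[OF this]
  have \<pi>R: "\<pi> \<in> carrier R" "\<pi> \<in> P" "\<pi> \<in> \<OO>" "\<pi> \<in> K"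
    using \<pi> p.p_carrier PD(2) \<oo>_subset_K by (auto simp: p_def)
  have decU: "\<exists>(m :: nat) (k :: nat). \<exists>u \<in> V.U. c \<otimes> \<pi> [^] m = u \<otimes> \<pi> [^] k" if c: "c \<in> K - {\<zero>}" for c
  proof -
    obtain m n :: nat and s t where s: "s \<in> \<oo> - p" "t \<in> \<oo> - p" "t \<otimes> c \<otimes> \<pi> [^] m = s \<otimes> \<pi> [^] n"
      using dec[OF c] by blast
    have cR: "c \<in> carrier R" using c K_carrier by simp
    note tU = outside_p_unit[OF s(2)] and sU = outside_p_unit[OF s(1)]
    have R: "t \<in> carrier R" "s \<in> carrier R" using V.UD tU sU by auto
    note I = inv_facts[OF V.UD(1)[OF tU] V.UD(2)[OF tU]]
    have "c \<otimes> \<pi> [^] m = inv t \<otimes> (t \<otimes> c \<otimes> \<pi> [^] m)" 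
      using R cR \<pi>R I by (simp add: m_assoc[symmetric])
    also have "\<dots> = (inv t \<otimes> s) \<otimes> \<pi> [^] n" unfolding s(3) using R I \<pi>R by (simp add: m_assoc)
    finally show ?thesis using V.U_mult[OF V.U_inv[OF tU] sU] by blast
  qed
  interpret W: commensurable_valuation_ring R V \<pi>
  proof unfold_locales
    show "\<pi> \<in> V" using \<pi>R \<OO>.subring_localization_at(2)[OF P_prime] by (auto simp: V_def)
    show "inv \<pi> \<notin> V"
    proof
      assume "inv \<pi> \<in> V"
      then obtain s where s: "s \<in> \<OO> - P" "s \<otimes> inv \<pi> \<in> \<OO>" unfolding V_iff by blast
      have sR: "s \<in> carrier R" using s \<OO>.A_carrier by simp
      have "s \<otimes> inv \<pi> \<otimes> \<pi> = s" using sR \<pi>R inv_facts[OF \<pi>R(1) \<pi>(2)] by (simp add: m_assoc)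
      then show False using PD(7)[OF s(2) \<pi>R(2)] s(1) by simp
    qed
    fix x assume x: "x \<in> carrier R" "x \<noteq> \<zero>"
    show "\<exists>(n :: nat) (m :: nat) (k :: nat). \<exists>u \<in> V.U. n > 0 \<and> x [^] n \<otimes> \<pi> [^] m = u \<otimes> \<pi> [^] k"
    proof (rule ccontr)
      assume not: "\<not> ?thesis"
      obtain l where l: "set l \<subseteq> K" "\<not> set l \<subseteq> {\<zero>}" "eval l x = \<zero>"
        using algebraic_relation[OF x(1)] by blast
      obtain c i u where c: "c \<in> K - {\<zero>}" "u \<in> V.U" "eval l x = u \<otimes> c \<otimes> x [^] (i :: nat)"
        using V.commensurable_or_dominant_term[OF x \<pi>R(1) K_carrier decU not l(1,2)] by blast
      have R: "c \<in> carrier R" "u \<in> carrier R" "u \<noteq> \<zero>" using c K_carrier V.UD by auto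
      have "u \<otimes> c \<otimes> x [^] i \<noteq> \<zero>" using c(1) R pow_nonzero[OF x, of i] x by (simp add: integral_iff)
      then show False using c(3) l(3) by simp
    qed
  qed (rule \<pi>(2))
  show ?thesis
  proof (rule W.exists_rational_valuation)
    fix v :: "'a \<Rightarrow> rat"
    assume v: "v \<in> extensional (nonzero R)"
    "\<And>x y. x \<in> nonzero R \<Longrightarrow> y \<in> nonzero R \<Longrightarrow> v (x \<otimes> y) = v x + v y"
    "\<And>x y. x \<in> nonzero R \<Longrightarrow> y \<in> nonzero R \<Longrightarrow> x \<oplus> y \<noteq> \<zero> \<Longrightarrow> v (x \<oplus> y) \<ge> min (v x) (v y)"
    "\<And>x. x \<in> nonzero R \<Longrightarrow> v x \<ge> 0 \<longleftrightarrow> x \<in> V"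
    "\<And>x u m k. x \<in> nonzero R \<Longrightarrow> u \<in> V.U \<Longrightarrow> x \<otimes> \<pi> [^] m = u \<otimes> \<pi> [^] k \<Longrightarrow> v x = of_nat k - of_nat m"
    have "v ` (K - {\<zero>}) = \<int>"
    proof
      show "v ` (K - {\<zero>}) \<subseteq> \<int>"
      proof
        fix z assume "z \<in> v ` (K - {\<zero>})"
        then obtain c where c: "c \<in> K - {\<zero>}" "z = v c" by blast
        obtain m k :: nat and u where u: "u \<in> V.U" "c \<otimes> \<pi> [^] m = u \<otimes> \<pi> [^] k" using decU[OF c(1)] by blast
        have "v c = of_nat k - of_nat m" by (rule v(5)[OF _ u]) (use c K_carrier in auto)
        then show "z \<in> \<int>" using c by simp
      qed
      show "\<int> \<subseteq> v ` (K - {\<zero>})"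
      proof
        fix z :: rat assume "z \<in> \<int>"
        then obtain a where a: "z = of_int a" by (auto elim: Ints_cases)
        obtain k m :: nat where km: "a = int k - int m" by (metis int_diff_cases)
        define c where "c = \<pi> [^] k \<otimes> inv (\<pi> [^] m)"
        have pm: "\<pi> [^] m \<in> carrier R" "\<pi> [^] m \<noteq> \<zero>" "\<pi> [^] k \<noteq> \<zero>" using \<pi>R pow_nonzero \<pi> by auto
        note I = inv_facts[OF pm(1,2)]
        have cK: "c \<in> K" unfolding c_def using K_inv[OF _ pm(2)] \<pi>R by simp
        have c0: "c \<in> nonzero R" unfolding c_def using pm I \<pi>R by (simp add: integral_iff)
        have "c \<otimes> \<pi> [^] m = \<one> \<otimes> \<pi> [^] k" unfolding c_def using pm I \<pi>R by (simp add: m_assoc)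
        then have "v c = of_nat k - of_nat m" by (rule v(5)[OF c0 V.U_one])
        then have "z = v c" using a km by simp
        then show "z \<in> v ` (K - {\<zero>})" using cK c0 by blast
      qed
    qed
    moreover have "insert \<zero> {x \<in> nonzero R. v x \<ge> 0} = localization_at R \<OO> P"
      using v(4) V.A_carrier V.A_closed(1) by (auto simp: V_def[symmetric])
    ultimately have "normalized_valuation R K \<OO> P v"
      using v(1-3) unfolding normalized_valuation_def by simp
    then show ?thesis by blast
  qed
qed

text \<open>
  If \<open>v(c) = 1\<close> and \<open>v(x) = k / n\<close> then \<open>x\<^sup>n c\<^bsup>-k\<^esup>\<close> is a unit of the valuation ring, so both valuations vanish on it
  and \<open>w = w(c) v\<close>. The factor is \<open>1\<close> because both map \<open>K\<^sup>\<times>\<close> onto \<open>\<int>\<close>.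
\<close>

lemma normalized_valuation_unique:
  assumes v: "normalized_valuation R K \<OO> P v" and w: "normalized_valuation R K \<OO> P w"
  shows "v = w"
proof -
  have ring: "v x \<ge> 0 \<longleftrightarrow> x \<in> V" "w x \<ge> 0 \<longleftrightarrow> x \<in> V" if "x \<in> nonzero R" for x
    using normalized_valuationD(4)[OF v] normalized_valuationD(4)[OF w] that by (simp_all add: V_def)
  have vm: "\<And>x y. x \<in> nonzero R \<Longrightarrow> y \<in> nonzero R \<Longrightarrow> v (x \<otimes> y) = v x + v y"
    and wm: "\<And>x y. x \<in> nonzero R \<Longrightarrow> y \<in> nonzero R \<Longrightarrow> w (x \<otimes> y) = w x + w y"
    and vK: "v ` (K - {\<zero>}) = \<int>" and wK: "w ` (K - {\<zero>}) = \<int>"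
    and ext: "v \<in> extensional (nonzero R)" "w \<in> extensional (nonzero R)"
    using normalized_valuationD[OF v] normalized_valuationD[OF w] by simp_all
  have "\<forall>x \<in> nonzero R. \<forall>y \<in> nonzero R. v (x \<otimes> y) = v x + v y"
    "\<forall>x \<in> nonzero R. \<forall>y \<in> nonzero R. w (x \<otimes> y) = w x + w y" using vm wm by simp_all
  note vf = additive_map_facts[OF this(1)] and wf = additive_map_facts[OF this(2)]
  have Knz: "c \<in> nonzero R" if "c \<in> K - {\<zero>}" for c using that K_carrier by auto
  have zero: "w e = 0" if e: "e \<in> nonzero R" "v e = 0" for e
  proof -
    have ie: "inv e \<in> nonzero R" using e inv_facts(2,3)[of e] by simp
    have "e \<in> V" "inv e \<in> V" using ring(1)[OF e(1)] ring(1)[OF ie] e vf(2) by auto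
    then have "w e \<ge> 0" "w (inv e) \<ge> 0" using ring(2)[OF e(1)] ring(2)[OF ie] by auto
    then show ?thesis using wf(2)[OF e(1)] by simp
  qed
  have "1 \<in> v ` (K - {\<zero>})" unfolding vK by simp
  then obtain c where c: "c \<in> K - {\<zero>}" "v c = 1" by (metis imageE)
  have cn: "c \<in> nonzero R" by (rule Knz[OF c(1)])
  have pos: "w x = v x * w c" if x: "x \<in> nonzero R" "v x \<ge> 0" for x
  proof -
    obtain a b where q: "quotient_of (v x) = (a, b)" by (cases "quotient_of (v x)")
    have ab: "v x = of_int a / of_int b" "b > 0"
      using quotient_of_div[OF q] quotient_of_denom_pos[OF q] by auto
    then have "a \<ge> 0" using x(2) by (simp add: zero_le_divide_iff)
    define k n where "k = nat a" and "n = nat b"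
    have kn: "v x = of_nat k / of_nat n" "n > 0"
      using ab \<open>a \<ge> 0\<close> by (simp_all add: k_def n_def)
    (* a unit of the valuation ring, since n v(x) = k v(c) *)
    define e where "e = x [^] n \<otimes> inv (c [^] k)"
    have pw: "c [^] k \<in> nonzero R" "x [^] n \<in> nonzero R" using cn x pow_nonzero by auto
    then have ip: "inv (c [^] k) \<in> nonzero R" using inv_facts(2,3)[of "c [^] k"] by simp
    have en: "e \<in> nonzero R" unfolding e_def using pw ip by (auto simp: integral_iff)
    have "v e = of_nat n * v x - of_nat k * v c"
      unfolding e_def using vm[OF pw(2) ip] vf(2)[OF pw(1)] vf(3) x cn by simp
    also have "\<dots> = 0" using kn c(2) by simp
    finally have "w e = 0" using zero en by simp
    moreover have "w e = of_nat n * w x - of_nat k * w c"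
      unfolding e_def using wm[OF pw(2) ip] wf(2)[OF pw(1)] wf(3) x cn by simp
    ultimately have "of_nat n * w x = of_nat k * w c" by simp
    then have "w x = of_nat k * w c / of_nat n" using kn(2) by (simp add: eq_divide_eq mult.commute)
    then show ?thesis using kn(1) by simp
  qed
  have eq: "w x = v x * w c" if x: "x \<in> nonzero R" for x
  proof (cases "v x \<ge> 0")
    case False
    have ix: "inv x \<in> nonzero R" using x inv_facts(2,3)[of x] by simp
    then have "w (inv x) = v (inv x) * w c" using pos[OF ix] vf(2)[OF x] False by simp
    then show ?thesis using vf(2)[OF x] wf(2)[OF x] by simp
  qed (use pos x in simp)
  have "w c \<in> \<int>" using c(1) wK by blast
  then obtain m where m: "w c = of_int m" by (auto elim: Ints_cases)
  have "1 \<in> w ` (K - {\<zero>})" unfolding wK by simp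
  then obtain y where y: "y \<in> K - {\<zero>}" "w y = 1" by (metis imageE)
  have "v y \<in> \<int>" using y(1) vK by blast
  then obtain n where n: "v y = of_int n" by (auto elim: Ints_cases)
  have "of_int (n * m) = (1 :: rat)" using eq[OF Knz[OF y(1)]] y(2) m n by simp
  then have "n * m = 1" by linarith
  moreover have "w c \<ge> 0" using ring[OF cn] c(2) by simp
  then have "m \<ge> 0" using m by simp
  ultimately have "m = 1" by (auto simp: zmult_eq_1_iff)
  then have "v x = w x" if "x \<in> nonzero R" for x using eq[OF that] m by simp
  then show ?thesis using ext by (intro extensionalityI)
qed

lemma normalized_valuation_at: "normalized_valuation R K \<OO> P (valuation_at R K \<OO> P)"
proof -
  have "\<exists>!v. normalized_valuation R K \<OO> P v"
    using exists_normalized_valuation normalized_valuation_unique by blast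
  then show ?thesis unfolding valuation_at_def by (rule theI')
qed

end

section \<open>Fractional ideals and their values\<close>

text \<open>
  The study of fractional ideals uses the valuations only through these properties.
\<close>

locale valued_domain = subring_of_field R B for R :: "('a, 'b) ring_scheme" (structure) and B +
  fixes v :: "'a set \<Rightarrow> 'a \<Rightarrow> real"
  assumes v_mult: "P \<in> max_ideals R B \<Longrightarrow> x \<in> nonzero R \<Longrightarrow> y \<in> nonzero R \<Longrightarrow>
      v P (x \<otimes> y) = v P x + v P y"
    and v_add: "P \<in> max_ideals R B \<Longrightarrow> x \<in> nonzero R \<Longrightarrow> y \<in> nonzero R \<Longrightarrow> x \<oplus> y \<noteq> \<zero> \<Longrightarrow>
      v P (x \<oplus> y) \<ge> min (v P x) (v P y)"
    and v_nonneg_iff: "P \<in> max_ideals R B \<Longrightarrow> x \<in> nonzero R \<Longrightarrow>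
      v P x \<ge> 0 \<longleftrightarrow> x \<in> localization_at R B P"
    and max_ideal_nonzero: "P \<in> max_ideals R B \<Longrightarrow> P \<noteq> {\<zero>}"
begin

abbreviation M where "M \<equiv> max_ideals R B"

lemma max_idealD:
  assumes "P \<in> M"
  shows "submodule_of R B P" "P \<subseteq> B" "\<one> \<notin> P" "\<zero> \<in> P"
    "\<And>a b. a \<in> B - P \<Longrightarrow> b \<in> B - P \<Longrightarrow> a \<otimes> b \<in> B - P"
    "\<And>a b. a \<in> P \<Longrightarrow> b \<in> B \<Longrightarrow> a \<otimes> b \<in> P"
    "\<And>a b. a \<in> B \<Longrightarrow> b \<in> P \<Longrightarrow> a \<otimes> b \<in> P"
  using primeidealD[OF max_ideal_prime[OF assms]] by simp_all

lemma mult_nz: "x \<in> nonzero R \<Longrightarrow> y \<in> nonzero R \<Longrightarrow> x \<otimes> y \<in> nonzero R"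
  by (simp add: integral_iff)

lemma inv_nz: "x \<in> nonzero R \<Longrightarrow> inv x \<in> nonzero R"
  using inv_facts(2,3)[of x] by simp

lemma pow_nz: "x \<in> nonzero R \<Longrightarrow> x [^] (n :: nat) \<in> nonzero R"
  using pow_nonzero[of x] by simp

lemma one_nz: "\<one> \<in> nonzero R"
  by simp

lemma B_nz: "x \<in> B \<Longrightarrow> x \<noteq> \<zero> \<Longrightarrow> x \<in> nonzero R"
  using A_carrier by simp

lemma v_facts:
  assumes P: "P \<in> M"
  shows "v P \<one> = 0" "x \<in> nonzero R \<Longrightarrow> v P (inv x) = - v P x"
    "x \<in> nonzero R \<Longrightarrow> v P (x [^] (n :: nat)) = real n * v P x"
proof -
  have "\<forall>x \<in> nonzero R. \<forall>y \<in> nonzero R. v P (x \<otimes> y) = v P x + v P y"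
    using v_mult[OF P] by simp
  note f = additive_map_facts[OF this]
  show "v P \<one> = 0" "x \<in> nonzero R \<Longrightarrow> v P (inv x) = - v P x"
    "x \<in> nonzero R \<Longrightarrow> v P (x [^] (n :: nat)) = real n * v P x" using f(1-3) by simp_all
qed

lemma v_nonneg_iff_denominator:
  assumes P: "P \<in> M" and x: "x \<in> nonzero R"
  shows "v P x \<ge> 0 \<longleftrightarrow> (\<exists>s \<in> B - P. s \<otimes> x \<in> B)"
  using v_nonneg_iff[OF P x] localization_at_iff[OF max_ideal_prime[OF P], of x] x by simp

lemma v_ge_0: 
  assumes P: "P \<in> M" and x: "x \<in> B" "x \<noteq> \<zero>" shows "v P x \<ge> 0"
proof -
  have "\<one> \<in> B - P" "\<one> \<otimes> x \<in> B" using max_idealD(3)[OF P] x A_carrier by auto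
  then show ?thesis using v_nonneg_iff_denominator[OF P B_nz[OF x]] by blast
qed

lemma v_eq_0:
  assumes P: "P \<in> M" and x: "x \<in> B - P" shows "v P x = 0"
proof -
  have xn: "x \<in> nonzero R" using x max_idealD(4)[OF P] A_carrier by auto
  have "x \<otimes> inv x \<in> B" using inv_facts(4)[of x] xn by simp
  then have "v P (inv x) \<ge> 0" using v_nonneg_iff_denominator[OF P inv_nz[OF xn]] x by blast
  then have "v P x \<le> 0" using v_facts(2)[OF P xn] by simp
  moreover have "v P x \<ge> 0" using v_ge_0[OF P, of x] x xn by simp
  ultimately show ?thesis by simp
qed

text \<open>
  If \<open>v(x) = 0\<close> then a denominator \<open>s \<notin> P\<close> of \<open>x\<^sup>-\<^sup>1\<close> satisfies \<open>s = (s x\<^sup>-\<^sup>1) x \<in> P\<close>.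
\<close>

lemma v_pos:
  assumes P: "P \<in> M" and x: "x \<in> P" "x \<noteq> \<zero>" shows "v P x > 0"
proof (rule ccontr)
  assume neg: "\<not> v P x > 0"
  have xB: "x \<in> B" using x max_idealD(2)[OF P] by auto
  have xn: "x \<in> nonzero R" using B_nz xB x by simp
  have "v P (inv x) \<ge> 0" using v_facts(2)[OF P xn] neg by simp
  then obtain s where s: "s \<in> B - P" "s \<otimes> inv x \<in> B"
    using v_nonneg_iff_denominator[OF P inv_nz[OF xn]] by blast
  have "s \<in> carrier R" using s A_carrier by simp
  then have "(s \<otimes> inv x) \<otimes> x = s" using xn inv_facts[of x] by (simp add: m_assoc)
  then show False using max_idealD(7)[OF P s(2) x(1)] s(1) by simp
qed

lemma M_nonempty: "M \<noteq> {}"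
proof -
  have "submodule_of R B {\<zero>}" using A_carrier by (intro submodule_ofI) auto
  then obtain P where "P \<in> M" by (rule max_ideal_above) auto
  then show ?thesis by blast
qed

lemma exists_positive: "P \<in> M \<Longrightarrow> \<exists>e \<in> P. e \<in> nonzero R \<and> v P e > 0"
proof -
  assume P: "P \<in> M"
  obtain e where "e \<in> P" "e \<noteq> \<zero>" using max_ideal_nonzero[OF P] max_idealD(4)[OF P] by blast
  then show ?thesis using v_pos[OF P] B_nz max_idealD(2)[OF P] by blast
qed

text \<open>
  An \<open>a \<in> I\<close> of at most the value of \<open>x\<close> provides a denominator \<open>s \<notin> P\<close> with \<open>s x \<in> I\<close>. So the ideal
  of all \<open>s\<close> with \<open>s x \<in> I\<close> is contained in no maximal ideal.
\<close>

lemma local_global: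
  assumes I: "submodule_of R B I" and x: "x \<in> nonzero R"
    and loc: "\<And>P. P \<in> M \<Longrightarrow> \<exists>a \<in> I - {\<zero>}. v P a \<le> v P x"
  shows "x \<in> I"
proof -
  note ID = submodule_ofD[OF I]
  define J where "J = {s \<in> B. s \<otimes> x \<in> I}"
  have J: "submodule_of R B J"
  proof (rule submodule_ofI)
    show "\<zero> \<in> J" using ID(2) x by (simp add: J_def)
    show "s \<oplus> t \<in> J" if "s \<in> J" "t \<in> J" for s t
      using that ID(3)[of "s \<otimes> x" "t \<otimes> x"] x A_carrier by (simp add: J_def l_distr)
    show "b \<otimes> s \<in> J" if "b \<in> B" "s \<in> J" for b s
      using that ID(4)[of b "s \<otimes> x"] x A_carrier by (simp add: J_def m_assoc)
  qed (simp add: J_def A_carrier)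
  have "\<one> \<in> J"
  proof (rule ccontr)
    assume "\<one> \<notin> J"
    moreover have "J \<subseteq> B" by (auto simp: J_def)
    ultimately obtain P where P: "P \<in> M" "J \<subseteq> P" using max_ideal_above[OF J] by metis
    obtain a where a: "a \<in> I" "a \<noteq> \<zero>" "v P a \<le> v P x" using loc[OF P(1)] by auto
    have an: "a \<in> nonzero R" using a ID(1) by simp
    have "v P (x \<otimes> inv a) \<ge> 0" using v_mult[OF P(1) x inv_nz[OF an]] v_facts(2)[OF P(1) an] a(3) by simp
    then obtain s where s: "s \<in> B - P" "s \<otimes> (x \<otimes> inv a) \<in> B"
      using v_nonneg_iff_denominator[OF P(1) mult_nz[OF x inv_nz[OF an]]] by blast
    have "s \<in> carrier R" using s A_carrier by simp
    then have "s \<otimes> (x \<otimes> inv a) \<otimes> a = s \<otimes> x" using an x inv_facts[of a] by (simp add: m_assoc)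
    then have "s \<otimes> x \<in> I" using ID(4)[OF s(2) a(1)] by simp
    then have "s \<in> J" using s(1) by (simp add: J_def)
    then show False using P(2) s(1) by blast
  qed
  then show ?thesis using x by (simp add: J_def)
qed

lemma fractional_ideal_iff:
  "fractional_ideal R B I \<longleftrightarrow>
    submodule_of R B I \<and> I \<noteq> {\<zero>} \<and> (\<exists>d \<in> nonzero R. \<forall>x \<in> I. d \<otimes> x \<in> B)"
proof -
  have 1: "submodule_of R B I" if s: "subgroup I (add_monoid R)" and m: "\<forall>b \<in> B. \<forall>x \<in> I. b \<otimes> x \<in> I"
    using subgroup.subset[OF s] subgroup.one_closed[OF s] subgroup.m_closed[OF s] m
    by (intro submodule_ofI) auto
  have 2: "subgroup I (add_monoid R)" if s: "submodule_of R B I"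
  proof (rule subgroup.intro)
    show "inv\<^bsub>add_monoid R\<^esub> x \<in> I" if "x \<in> I" for x
      using submodule_of_uminus[OF subring s that] by (simp add: a_inv_def)
  qed (use submodule_ofD[OF s] in auto)
  have "d <# I \<subseteq> B \<longleftrightarrow> (\<forall>x \<in> I. d \<otimes> x \<in> B)" for d by (auto simp: l_coset_def)
  then show ?thesis
    unfolding fractional_ideal_def using 1 2 submodule_ofD(4)[of R B I] by metis
qed

text \<open>
  The set of values \<open>vals P I\<close> is an upward closed part of the value group \<open>G P\<close>; it is recorded by
  its infimum \<open>ord P I\<close> and the fact \<open>att P I\<close> that the infimum is a minimum.
\<close>

definition vals :: "'a set \<Rightarrow> 'a set \<Rightarrow> real set" where "vals P I = v P ` (I - {\<zero>})"

definition ord :: "'a set \<Rightarrow> 'a set \<Rightarrow> real" where "ord P I = Inf (vals P I)"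

definition att :: "'a set \<Rightarrow> 'a set \<Rightarrow> bool" where "att P I \<longleftrightarrow> ord P I \<in> vals P I"

abbreviation "fideal I \<equiv> fractional_ideal R B I"

definition G :: "'a set \<Rightarrow> real set" where "G P = v P ` nonzero R"

lemma fractional_idealD:
  assumes "fideal I"
  shows "submodule_of R B I" "\<exists>a. a \<in> I \<and> a \<in> nonzero R"
    "\<exists>d \<in> nonzero R. \<forall>x \<in> I. d \<otimes> x \<in> B" "x \<in> I \<Longrightarrow> x \<in> carrier R"
proof -
  note * = assms[unfolded fractional_ideal_iff]
  show s: "submodule_of R B I" using * by simp
  show "\<exists>d \<in> nonzero R. \<forall>x \<in> I. d \<otimes> x \<in> B" using * by (elim conjE)
  show "x \<in> I \<Longrightarrow> x \<in> carrier R" for x using submodule_ofD(1)[OF s] .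
  have "\<exists>a \<in> I. a \<noteq> \<zero>" using * submodule_ofD(2)[OF s] by blast
  then show "\<exists>a. a \<in> I \<and> a \<in> nonzero R" using submodule_ofD(1)[OF s] by blast
qed

lemma frac_nz: "fideal I \<Longrightarrow> a \<in> I - {\<zero>} \<Longrightarrow> a \<in> nonzero R"
  using fractional_idealD(4)[of I a] by simp

lemma frac_lower_bound:
  assumes I: "fideal I"
  obtains d where "d \<in> nonzero R" "\<And>P c. P \<in> M \<Longrightarrow> c \<in> vals P I \<Longrightarrow> - v P d \<le> c"
proof -
  obtain d where d: "d \<in> nonzero R" "\<forall>x \<in> I. d \<otimes> x \<in> B" using fractional_idealD(3)[OF I] by auto
  show ?thesis
  proof (rule that[OF d(1)])
    fix P c assume P: "P \<in> M" and "c \<in> vals P I"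
    then obtain a where a: "a \<in> I - {\<zero>}" "c = v P a" by (auto simp: vals_def)
    have an: "a \<in> nonzero R" by (rule frac_nz[OF I a(1)])
    have "v P (d \<otimes> a) \<ge> 0" using v_ge_0[OF P, of "d \<otimes> a"] d(2) a(1) mult_nz[OF d(1) an] by simp
    then show "- v P d \<le> c" using v_mult[OF P d(1) an] a(2) by simp
  qed
qed

lemma vals_facts:
  assumes I: "fideal I" and P: "P \<in> M"
  shows "vals P I \<noteq> {}" "bdd_below (vals P I)" "c \<in> vals P I \<Longrightarrow> ord P I \<le> c" "vals P I \<subseteq> G P"
    "ord P I < c \<Longrightarrow> \<exists>w \<in> vals P I. w < c"
proof -
  show ne: "vals P I \<noteq> {}" using fractional_idealD(2)[OF I] by (auto simp: vals_def)
  obtain d where d: "d \<in> nonzero R" "\<And>P c. P \<in> M \<Longrightarrow> c \<in> vals P I \<Longrightarrow> - v P d \<le> c"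
    by (rule frac_lower_bound[OF I]) (rule that)
  show bd: "bdd_below (vals P I)" using d(2)[OF P] by (intro bdd_belowI)
  show "c \<in> vals P I \<Longrightarrow> ord P I \<le> c" unfolding ord_def by (rule cInf_lower[OF _ bd])
  show "vals P I \<subseteq> G P" using frac_nz[OF I] by (auto simp: vals_def G_def)
  show "ord P I < c \<Longrightarrow> \<exists>w \<in> vals P I. w < c" unfolding ord_def using cInf_less_iff[OF ne bd] by simp
qed

text \<open>
  A set of values is upward closed: if \<open>v(a) \<le> v(x)\<close> with \<open>a \<in> I\<close> then \<open>s x \<in> I\<close> for some \<open>s\<close> of value zero.
\<close>

lemma mem_vals_iff:
  assumes I: "fideal I" and P: "P \<in> M" and c: "c \<in> G P"
  shows "c \<in> vals P I \<longleftrightarrow> (if att P I then ord P I \<le> c else ord P I < c)"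
proof
  assume cI: "c \<in> vals P I"
  then have "ord P I \<le> c" by (rule vals_facts(3)[OF I P])
  moreover have "ord P I \<noteq> c" if "\<not> att P I" using that cI by (auto simp: att_def)
  ultimately show "if att P I then ord P I \<le> c else ord P I < c" by auto
next
  assume c2: "if att P I then ord P I \<le> c else ord P I < c"
  have "\<exists>w \<in> vals P I. w \<le> c"
  proof (cases "att P I")
    case True
    then show ?thesis using c2 by (auto simp: att_def)
  next
    case False
    then have "ord P I < c" using c2 by simp
    then show ?thesis using vals_facts(5)[OF I P] less_imp_le by blast
  qed
  then obtain a where a: "a \<in> I - {\<zero>}" "v P a \<le> c" by (auto simp: vals_def)
  obtain x where x: "x \<in> nonzero R" "c = v P x" using c by (auto simp: G_def)
  have an: "a \<in> nonzero R" by (rule frac_nz[OF I a(1)])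
  have "v P (x \<otimes> inv a) \<ge> 0" using v_mult[OF P x(1) inv_nz[OF an]] v_facts(2)[OF P an] a(2) x(2) by simp
  then obtain s where s: "s \<in> B - P" "s \<otimes> (x \<otimes> inv a) \<in> B"
    using v_nonneg_iff_denominator[OF P mult_nz[OF x(1) inv_nz[OF an]]] by blast
  have sn: "s \<in> nonzero R" using s max_idealD(4)[OF P] A_carrier by auto
  then have "s \<otimes> (x \<otimes> inv a) \<otimes> a = s \<otimes> x" using an x inv_facts[of a] by (simp add: m_assoc)
  then have "s \<otimes> x \<in> I" using submodule_ofD(4)[OF fractional_idealD(1)[OF I] s(2), of a] a(1) by simp
  then have "v P (s \<otimes> x) \<in> vals P I" using mult_nz[OF sn x(1)] by (simp add: vals_def)
  then show "c \<in> vals P I" using v_mult[OF P sn x(1)] v_eq_0[OF P s(1)] x(2) by simp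
qed

lemma frac_subset:
  assumes I: "fideal I" and J: "fideal J"
    and eq: "\<And>P. P \<in> M \<Longrightarrow> ord P I = ord P J \<and> (att P I \<longleftrightarrow> att P J)"
  shows "I \<subseteq> J"
proof
  fix x assume x: "x \<in> I"
  show "x \<in> J"
  proof (cases "x = \<zero>")
    case True
    then show ?thesis using submodule_ofD(2)[OF fractional_idealD(1)[OF J]] by simp
  next
    case False
    have xn: "x \<in> nonzero R" using frac_nz[OF I, of x] x False by simp
    show ?thesis
    proof (rule local_global[OF fractional_idealD(1)[OF J] xn])
      fix P assume P: "P \<in> M"
      have g: "v P x \<in> G P" using xn by (simp add: G_def)
      have e: "ord P I = ord P J" "att P I = att P J" using eq[OF P] by auto
      have "v P x \<in> vals P I" using x False by (simp add: vals_def)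
      then have "v P x \<in> vals P J" unfolding mem_vals_iff[OF I P g] mem_vals_iff[OF J P g] e .
      then show "\<exists>a \<in> J - {\<zero>}. v P a \<le> v P x" by (auto simp: vals_def)
    qed
  qed
qed

theorem frac_eqI:
  assumes I: "fideal I" and J: "fideal J"
    and eq: "\<And>P. P \<in> M \<Longrightarrow> ord P I = ord P J \<and> (att P I \<longleftrightarrow> att P J)"
  shows "I = J"
  by (intro equalityI frac_subset[OF I J] frac_subset[OF J I]) (use eq in auto)

lemma ord_att_if_min:
  assumes P: "P \<in> M" and a: "a \<in> I - {\<zero>}" "\<And>b. b \<in> I - {\<zero>} \<Longrightarrow> v P a \<le> v P b"
  shows "ord P I = v P a" "att P I"
proof -
  have m: "v P a \<in> vals P I" using a(1) by (simp add: vals_def)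
  show o: "ord P I = v P a"
    unfolding ord_def by (rule cInf_eq_minimum[OF m]) (use a(2) in \<open>auto simp: vals_def\<close>)
  show "att P I" using m by (simp add: att_def o)
qed

lemma att_obtain:
  assumes "att P I" obtains a where "a \<in> I - {\<zero>}" "v P a = ord P I"
  using assms unfolding att_def vals_def by (metis imageE)

text \<open>
  In a sum of products some summand has at most the value of the sum.
\<close>

lemma ideal_prod_value:
  assumes I: "fideal I" and J: "fideal J" and P: "P \<in> M"
  shows "z \<in> ideal_prod R I J \<Longrightarrow> z \<in> carrier R \<and>
    (z \<noteq> \<zero> \<longrightarrow> (\<exists>a \<in> I - {\<zero>}. \<exists>b \<in> J - {\<zero>}. v P a + v P b \<le> v P z))"
proof (induction rule: ideal_prod.induct)
  case (prod i j)
  have R: "i \<in> carrier R" "j \<in> carrier R" using prod fractional_idealD(4)[OF I] fractional_idealD(4)[OF J] by auto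
  show ?case
  proof (intro conjI impI)
    show "i \<otimes> j \<in> carrier R" using R by simp
    assume "i \<otimes> j \<noteq> \<zero>"
    then have nz: "i \<noteq> \<zero>" "j \<noteq> \<zero>" using R by auto
    then have "v P i + v P j \<le> v P (i \<otimes> j)" using v_mult[OF P, of i j] R by simp
    then show "\<exists>a \<in> I - {\<zero>}. \<exists>b \<in> J - {\<zero>}. v P a + v P b \<le> v P (i \<otimes> j)" using prod nz by blast
  qed
next
  case (sum s t)
  have R: "s \<in> carrier R" "t \<in> carrier R" using sum.IH by auto
  show ?case
  proof (intro conjI impI)
    show "s \<oplus> t \<in> carrier R" using R by simp
    assume st: "s \<oplus> t \<noteq> \<zero>"
    consider "s = \<zero>" | "t = \<zero>" | "s \<noteq> \<zero>" "t \<noteq> \<zero>" by blast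
    then show "\<exists>a \<in> I - {\<zero>}. \<exists>b \<in> J - {\<zero>}. v P a + v P b \<le> v P (s \<oplus> t)"
    proof cases
      case 1
      then show ?thesis using sum.IH(2) st R by simp
    next
      case 2
      then show ?thesis using sum.IH(1) st R by simp
    next
      case 3
      obtain a b where ab: "a \<in> I - {\<zero>}" "b \<in> J - {\<zero>}" "v P a + v P b \<le> v P s" using sum.IH(1) 3 by blast
      obtain a' b' where ab': "a' \<in> I - {\<zero>}" "b' \<in> J - {\<zero>}" "v P a' + v P b' \<le> v P t"
        using sum.IH(2) 3 by blast
      have "v P (s \<oplus> t) \<ge> min (v P s) (v P t)" using v_add[OF P, of s t] R 3 st by simp
      then have "v P a + v P b \<le> v P (s \<oplus> t) \<or> v P a' + v P b' \<le> v P (s \<oplus> t)" using ab ab' by linarith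
      then show ?thesis using ab ab' by blast
    qed
  qed
qed

lemma submodule_of_ideal_prod:
  assumes I: "fideal I" and J: "fideal J"
  shows "submodule_of R B (ideal_prod R I J)"
proof (rule submodule_ofI)
  note ID = submodule_ofD[OF fractional_idealD(1)[OF I]] and JD = submodule_ofD[OF fractional_idealD(1)[OF J]]
  show c: "z \<in> carrier R" if "z \<in> ideal_prod R I J" for z
    using that by (induction rule: ideal_prod.induct) (use ID(1) JD(1) in auto)
  show "\<zero> \<in> ideal_prod R I J" using ideal_prod.prod[OF ID(2) JD(2), of R] by simp
  show "x \<oplus> y \<in> ideal_prod R I J" if "x \<in> ideal_prod R I J" "y \<in> ideal_prod R I J" for x y
    by (rule ideal_prod.sum[OF that])
  show "b \<otimes> z \<in> ideal_prod R I J" if b: "b \<in> B" and z: "z \<in> ideal_prod R I J" for b z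
    using z
  proof (induction rule: ideal_prod.induct)
    case (prod i j)
    have "b \<otimes> (i \<otimes> j) = (b \<otimes> i) \<otimes> j" using prod ID(1) JD(1) A_carrier[OF b] by (simp add: m_assoc)
    then show ?case using ideal_prod.prod[OF ID(4)[OF b prod(1)] prod(2), of R] by simp
  next
    case (sum s t)
    have "b \<otimes> (s \<oplus> t) = b \<otimes> s \<oplus> b \<otimes> t" using c sum.hyps A_carrier[OF b] by (simp add: r_distr)
    then show ?case using ideal_prod.sum[OF sum.IH] by simp
  qed
qed

lemma frac_ideal_prod:
  assumes I: "fideal I" and J: "fideal J"
  shows "fideal (ideal_prod R I J)"
  unfolding fractional_ideal_iff
proof (intro conjI)
  note ID = submodule_ofD[OF fractional_idealD(1)[OF I]] and JD = submodule_ofD[OF fractional_idealD(1)[OF J]]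
  show s: "submodule_of R B (ideal_prod R I J)" by (rule submodule_of_ideal_prod[OF I J])
  obtain a b where ab: "a \<in> I" "a \<in> nonzero R" "b \<in> J" "b \<in> nonzero R"
    using fractional_idealD(2)[OF I] fractional_idealD(2)[OF J] by auto
  have "a \<otimes> b \<in> ideal_prod R I J" by (rule ideal_prod.prod[OF ab(1,3)])
  then show "ideal_prod R I J \<noteq> {\<zero>}" using mult_nz[OF ab(2,4)] by auto
  obtain d where d: "d \<in> nonzero R" "\<forall>x \<in> I. d \<otimes> x \<in> B" using fractional_idealD(3)[OF I] by auto
  obtain e where e: "e \<in> nonzero R" "\<forall>x \<in> J. e \<otimes> x \<in> B" using fractional_idealD(3)[OF J] by auto
  have "d \<otimes> e \<otimes> z \<in> B" if "z \<in> ideal_prod R I J" for z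
    using that
  proof (induction rule: ideal_prod.induct)
    case (prod i j)
    have "d \<otimes> e \<otimes> (i \<otimes> j) = (d \<otimes> i) \<otimes> (e \<otimes> j)"
      using prod ID(1) JD(1) d e by (simp add: m_ac)
    then show ?case using d(2) e(2) prod by simp
  next
    case (sum s' t)
    have "d \<otimes> e \<otimes> (s' \<oplus> t) = d \<otimes> e \<otimes> s' \<oplus> d \<otimes> e \<otimes> t"
      using submodule_ofD(1)[OF s] sum.hyps d e by (simp add: r_distr)
    then show ?case using sum.IH by simp
  qed
  then show "\<exists>d \<in> nonzero R. \<forall>x \<in> ideal_prod R I J. d \<otimes> x \<in> B"
    using mult_nz[OF d(1) e(1)] by blast
qed

theorem ord_ideal_prod:
  assumes I: "fideal I" and J: "fideal J" and P: "P \<in> M"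
  shows "ord P (ideal_prod R I J) = ord P I + ord P J"
proof (rule antisym)
  note IJ = frac_ideal_prod[OF I J]
  have le: "ord P (ideal_prod R I J) \<le> a + b" if ab: "a \<in> vals P I" "b \<in> vals P J" for a b
  proof -
    obtain i j where ij: "i \<in> I - {\<zero>}" "a = v P i" "j \<in> J - {\<zero>}" "b = v P j"
      using ab by (auto simp: vals_def)
    have n: "i \<in> nonzero R" "j \<in> nonzero R" using frac_nz[OF I ij(1)] frac_nz[OF J ij(3)] by auto
    have "v P (i \<otimes> j) \<in> vals P (ideal_prod R I J)"
      using ideal_prod.prod[of i I j J R] ij mult_nz[OF n] by (simp add: vals_def)
    from vals_facts(3)[OF IJ P this] show ?thesis using v_mult[OF P n] ij by simp
  qed
  have "ord P (ideal_prod R I J) - b \<le> ord P I" if "b \<in> vals P J" for b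
    unfolding ord_def[of P I] by (rule cInf_greatest[OF vals_facts(1)[OF I P]]) (use le that in force)
  then have "ord P (ideal_prod R I J) - ord P I \<le> ord P J"
    unfolding ord_def[of P J] by (intro cInf_greatest[OF vals_facts(1)[OF J P]]) force
  then show "ord P (ideal_prod R I J) \<le> ord P I + ord P J" by simp
  show "ord P I + ord P J \<le> ord P (ideal_prod R I J)"
    unfolding ord_def[of P "ideal_prod R I J"]
  proof (rule cInf_greatest[OF vals_facts(1)[OF IJ P]])
    fix c assume "c \<in> vals P (ideal_prod R I J)"
    then obtain z where z: "z \<in> ideal_prod R I J" "z \<noteq> \<zero>" "c = v P z" by (auto simp: vals_def)
    obtain a b where ab: "a \<in> I - {\<zero>}" "b \<in> J - {\<zero>}" "v P a + v P b \<le> v P z"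
      using ideal_prod_value[OF I J P z(1)] z(2) by blast
    have "ord P I \<le> v P a" "ord P J \<le> v P b"
      using vals_facts(3)[OF I P] vals_facts(3)[OF J P] ab(1,2) by (auto simp: vals_def)
    then show "ord P I + ord P J \<le> c" using ab(3) z(3) by simp
  qed
qed

text \<open>
  An element of \<open>I J\<close> with the least value \<open>ord P I + ord P J\<close> has a value of at least \<open>v(a) + v(b)\<close> for some
  \<open>a \<in> I\<close> and \<open>b \<in> J\<close>, which must then be of least value in \<open>I\<close> and \<open>J\<close>.
\<close>

theorem att_ideal_prod:
  assumes I: "fideal I" and J: "fideal J" and P: "P \<in> M"
  shows "att P (ideal_prod R I J) \<longleftrightarrow> att P I \<and> att P J"
proof
  assume "att P (ideal_prod R I J)"
  then obtain z where z: "z \<in> ideal_prod R I J - {\<zero>}" "v P z = ord P (ideal_prod R I J)"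
    by (rule att_obtain)
  obtain a b where ab: "a \<in> I - {\<zero>}" "b \<in> J - {\<zero>}" "v P a + v P b \<le> v P z"
    using ideal_prod_value[OF I J P, of z] z(1) by blast
  have m: "v P a \<in> vals P I" "v P b \<in> vals P J" using ab by (auto simp: vals_def)
  have "ord P I \<le> v P a" "ord P J \<le> v P b"
    using vals_facts(3)[OF I P m(1)] vals_facts(3)[OF J P m(2)] by auto
  then have "ord P I = v P a" "ord P J = v P b" using ab(3) z(2) ord_ideal_prod[OF I J P] by auto
  then show "att P I \<and> att P J" using m by (simp add: att_def)
next
  assume "att P I \<and> att P J"
  then obtain a b where ab: "a \<in> I - {\<zero>}" "v P a = ord P I" "b \<in> J - {\<zero>}" "v P b = ord P J"
    by (auto elim!: att_obtain)
  have n: "a \<in> nonzero R" "b \<in> nonzero R" using frac_nz[OF I ab(1)] frac_nz[OF J ab(3)] by auto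
  have "v P (a \<otimes> b) \<in> vals P (ideal_prod R I J)"
    using ideal_prod.prod[of a I b J R] ab mult_nz[OF n] by (simp add: vals_def)
  then show "att P (ideal_prod R I J)"
    unfolding att_def ord_ideal_prod[OF I J P] using v_mult[OF P n] ab by simp
qed

lemma frac_B: "fideal B" and ord_B: "P \<in> M \<Longrightarrow> ord P B = 0" and att_B: "P \<in> M \<Longrightarrow> att P B"
proof -
  show "fideal B"
    unfolding fractional_ideal_iff
  proof (intro conjI)
    show "submodule_of R B B" by (rule submodule_of_self[OF subring])
    show "B \<noteq> {\<zero>}" using A_closed(2) one_not_zero by blast
    have "\<one> \<in> nonzero R" "\<forall>x \<in> B. \<one> \<otimes> x \<in> B" using A_carrier by auto
    then show "\<exists>d \<in> nonzero R. \<forall>x \<in> B. d \<otimes> x \<in> B" by blast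
  qed
  assume P: "P \<in> M"
  have le: "v P \<one> \<le> v P b" if "b \<in> B - {\<zero>}" for b
    using v_ge_0[OF P, of b] v_facts(1)[OF P] that by simp
  have one: "\<one> \<in> B - {\<zero>}" by simp
  show "ord P B = 0" using ord_att_if_min(1)[OF P one le] v_facts(1)[OF P] by simp
  show "att P B" by (rule ord_att_if_min(2)[OF P one le])
qed

lemma principal_invariants:
  assumes a: "a \<in> nonzero R"
  shows "fideal (a <# B)" "P \<in> M \<Longrightarrow> ord P (a <# B) = v P a" "P \<in> M \<Longrightarrow> att P (a <# B)"
proof -
  have e: "a <# B = (\<otimes>) a ` B" by (auto simp: l_coset_def)
  have aR: "a \<in> carrier R" using a by simp
  have one: "a \<in> a <# B" unfolding e using aR by (intro image_eqI[of _ _ \<one>]) auto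
  show "fideal (a <# B)"
    unfolding fractional_ideal_iff
  proof (intro conjI)
    show "submodule_of R B (a <# B)" unfolding e
      by (rule submodule_of_scale[OF submodule_of_self[OF subring] aR subringE(1)[OF subring]])
    show "a <# B \<noteq> {\<zero>}" using one a by auto
    have "inv a \<otimes> x \<in> B" if x: "x \<in> a <# B" for x
    proof -
      obtain b where b: "b \<in> B" "x = a \<otimes> b" using x unfolding e by blast
      then have "inv a \<otimes> x = b" using a A_carrier inv_facts[of a] by (simp add: m_assoc[symmetric])
      then show ?thesis using b by simp
    qed
    then show "\<exists>d \<in> nonzero R. \<forall>x \<in> a <# B. d \<otimes> x \<in> B" using inv_nz[OF a] by blast
  qed
  assume P: "P \<in> M"
  have le: "v P a \<le> v P x" if x: "x \<in> (a <# B) - {\<zero>}" for x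
  proof -
    obtain b where b: "b \<in> B" "x = a \<otimes> b" using x unfolding e by blast
    have "b \<noteq> \<zero>" using b x aR by auto
    then show ?thesis using v_mult[OF P a B_nz[OF b(1)]] v_ge_0[OF P b(1)] b(2) by simp
  qed
  have m: "a \<in> (a <# B) - {\<zero>}" using one a by simp
  show "ord P (a <# B) = v P a" by (rule ord_att_if_min(1)[OF P m le])
  show "att P (a <# B)" by (rule ord_att_if_min(2)[OF P m le])
qed

end

section \<open>Fractional ideals with prescribed values\<close>

lemma closure_eq_UNIV_iff:
  fixes S :: "real set"
  shows "closure S = UNIV \<longleftrightarrow> (\<forall>a b. a < b \<longrightarrow> (\<exists>g \<in> S. a < g \<and> g < b))"
proof
  assume c: "closure S = UNIV"
  show "\<forall>a b. a < b \<longrightarrow> (\<exists>g \<in> S. a < g \<and> g < b)"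
  proof (intro allI impI)
    fix a b :: real assume ab: "a < b"
    have "(a + b) / 2 \<in> closure S" using c by simp
    then obtain g where g: "g \<in> S" "dist g ((a + b) / 2) < (b - a) / 2"
      using ab unfolding closure_approachable by (metis diff_gt_0_iff_gt half_gt_zero)
    have *: "g - (a + b) / 2 < (b - a) / 2" "- (g - (a + b) / 2) < (b - a) / 2"
      using g(2) unfolding dist_real_def abs_less_iff by blast+
    have "a < g" using *(2) by (simp add: field_simps)
    moreover have "g < b" using *(1) by (simp add: field_simps)
    ultimately show "\<exists>g \<in> S. a < g \<and> g < b" using g(1) by blast
  qed
next
  assume d: "\<forall>a b. a < b \<longrightarrow> (\<exists>g \<in> S. a < g \<and> g < b)"
  have "x \<in> closure S" for x
    unfolding closure_approachable
  proof (intro allI impI)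
    fix e :: real assume "e > 0"
    then obtain g where "g \<in> S" "x - e < g" "g < x + e" using d[rule_format, of "x - e" "x + e"] by auto
    then show "\<exists>y \<in> S. dist y x < e" by (intro bexI[of _ g]) (auto simp: dist_real_def abs_less_iff)
  qed
  then show "closure S = UNIV" by blast
qed

context valued_domain
begin

lemma GI: "x \<in> nonzero R \<Longrightarrow> v P x \<in> G P"
  unfolding G_def by (rule imageI)

lemma GE:
  assumes "g \<in> G P" obtains x where "x \<in> nonzero R" "g = v P x"
  using assms unfolding G_def by (metis imageE)

lemma G_group:
  assumes P: "P \<in> M"
  shows "0 \<in> G P" "a \<in> G P \<Longrightarrow> b \<in> G P \<Longrightarrow> a + b \<in> G P" "a \<in> G P \<Longrightarrow> - a \<in> G P"
    "a \<in> G P \<Longrightarrow> b \<in> G P \<Longrightarrow> a - b \<in> G P" "a \<in> G P \<Longrightarrow> of_int n * a \<in> G P"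
proof -
  show 0: "0 \<in> G P" using GI[OF one_nz, of P] v_facts(1)[OF P] by simp
  show add: "a + b \<in> G P" if a: "a \<in> G P" and b: "b \<in> G P" for a b
  proof -
    obtain x where x: "x \<in> nonzero R" "a = v P x" using a by (rule GE)
    obtain y where y: "y \<in> nonzero R" "b = v P y" using b by (rule GE)
    show ?thesis using GI[OF mult_nz[OF x(1) y(1)], of P] v_mult[OF P x(1) y(1)] x y by simp
  qed
  show minus: "- a \<in> G P" if a: "a \<in> G P" for a
  proof -
    obtain x where x: "x \<in> nonzero R" "a = v P x" using a by (rule GE)
    show ?thesis using GI[OF inv_nz[OF x(1)], of P] v_facts(2)[OF P x(1)] x by simp
  qed
  show "a - b \<in> G P" if a: "a \<in> G P" and b: "b \<in> G P" for a b
    using add[OF a minus[OF b]] by simp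
  have nat: "real n * a \<in> G P" if a: "a \<in> G P" for n a
  proof (induction n)
    case (Suc n)
    have "real n * a + a \<in> G P" by (rule add[OF Suc a])
    then show ?case by (simp add: algebra_simps)
  qed (use 0 in simp)
  show "of_int n * a \<in> G P" if a: "a \<in> G P" for a
  proof (cases n)
    case (nonneg k)
    then show ?thesis using nat[OF a, of k] by simp
  next
    case (neg k)
    have e: "of_int n * a = real (Suc k) * - a" unfolding neg by (simp add: algebra_simps)
    show ?thesis unfolding e by (rule nat[OF minus[OF a]])
  qed
qed

definition dense_at :: "'a set \<Rightarrow> bool" where
  "dense_at P \<longleftrightarrow> (\<forall>a b. a < b \<longrightarrow> (\<exists>g \<in> G P. a < g \<and> g < b))"

text \<open>
  If the infimum of a set of values is not attained then there are arbitrarily small positive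
  differences of values, and their multiples are dense.
\<close>

lemma dense_if_not_attained:
  assumes I: "fideal I" and P: "P \<in> M" and na: "\<not> att P I"
  shows "dense_at P"
  unfolding dense_at_def
proof (intro allI impI)
  fix a b :: real assume ab: "a < b"
  have lt: "ord P I < w" if "w \<in> vals P I" for w
    using vals_facts(3)[OF I P that] na that by (metis att_def less_eq_real_def)
  obtain w1 where w1: "w1 \<in> vals P I" "w1 < ord P I + (b - a)"
    using vals_facts(5)[OF I P, of "ord P I + (b - a)"] ab by auto
  obtain w2 where w2: "w2 \<in> vals P I" "w2 < w1" using vals_facts(5)[OF I P lt[OF w1(1)]] by auto
  (* a positive element of the value group, smaller than the gap to be hit *)
  define g where "g = w1 - w2"
  have g: "g > 0" "g < b - a" using w1 w2 lt[OF w2(1)] by (auto simp: g_def)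
  have gG: "g \<in> G P" unfolding g_def using G_group(4)[OF P] vals_facts(4)[OF I P] w1 w2 by blast
  (* the first multiple of g beyond a *)
  define n where "n = \<lfloor>a / g\<rfloor> + 1"
  have 1: "a / g < of_int n" "of_int n \<le> a / g + 1" unfolding n_def by linarith+
  have "a < of_int n * g" using 1(1) g(1) by (simp add: field_simps)
  moreover have "of_int n * g \<le> a + g" using 1(2) g(1) by (simp add: field_simps)
  ultimately show "\<exists>g \<in> G P. a < g \<and> g < b" using G_group(5)[OF P gG, of n] g(2) by force
qed

text \<open>
  Some localization is a valuation ring, so \<open>x\<close> or its inverse has a denominator there.
\<close>

lemma exists_denominator:
  assumes x: "x \<in> nonzero R"
  obtains s where "s \<in> B" "s \<noteq> \<zero>" "s \<otimes> x \<in> B"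
proof -
  obtain P where P: "P \<in> M" using M_nonempty by blast
  show ?thesis
  proof (cases "v P x \<ge> 0")
    case True
    then obtain s where "s \<in> B - P" "s \<otimes> x \<in> B" using v_nonneg_iff_denominator[OF P x] by blast
    then show ?thesis using that[of s] max_idealD(4)[OF P] by blast
  next
    case False
    then have "v P (inv x) \<ge> 0" using v_facts(2)[OF P x] by simp
    then obtain s where s: "s \<in> B - P" "s \<otimes> inv x \<in> B"
      using v_nonneg_iff_denominator[OF P inv_nz[OF x]] by blast
    have sn: "s \<in> nonzero R" using s max_idealD(4)[OF P] A_carrier by auto
    have "(s \<otimes> inv x) \<otimes> x = s" using sn x inv_facts[of x] by (simp add: m_assoc)
    moreover have "s \<otimes> inv x \<noteq> \<zero>" using mult_nz[OF sn inv_nz[OF x]] by simp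
    ultimately show ?thesis using that[of "s \<otimes> inv x"] s by simp
  qed
qed

lemma finite_nonzero_values:
  assumes fc: "finite_character R B" and x: "x \<in> nonzero R"
  shows "finite {P \<in> M. v P x \<noteq> 0}"
proof -
  obtain s where s: "s \<in> B" "s \<noteq> \<zero>" "s \<otimes> x \<in> B" by (rule exists_denominator[OF x])
  have sn: "s \<in> nonzero R" using B_nz s by simp
  have "finite {P \<in> M. s \<in> P}" "finite {P \<in> M. s \<otimes> x \<in> P}"
    using fc s mult_nz[OF sn x] unfolding finite_character_def by auto
  moreover have "{P \<in> M. v P x \<noteq> 0} \<subseteq> {P \<in> M. s \<in> P} \<union> {P \<in> M. s \<otimes> x \<in> P}"
  proof
    fix P assume "P \<in> {P \<in> M. v P x \<noteq> 0}"
    then have P: "P \<in> M" "v P x \<noteq> 0" by auto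
    have "v P (s \<otimes> x) = v P s + v P x" by (rule v_mult[OF P(1) sn x])
    then have "v P s \<noteq> 0 \<or> v P (s \<otimes> x) \<noteq> 0" using P(2) by auto
    then have "s \<in> P \<or> s \<otimes> x \<in> P" using v_eq_0[OF P(1), of s] v_eq_0[OF P(1), of "s \<otimes> x"] s by auto
    then show "P \<in> {P \<in> M. s \<in> P} \<union> {P \<in> M. s \<otimes> x \<in> P}" using P by simp
  qed
  ultimately show ?thesis by (meson finite_UnI finite_subset)
qed

text \<open>
  A product of high powers of elements, one of positive value for each \<open>Q \<in> F\<close>, does it. The set \<open>T\<close>
  allows for a side condition that is stable under products.
\<close>

lemma raise_values:
  assumes F: "finite F" and T: "T \<subseteq> B - {\<zero>}" "\<one> \<in> T" "\<And>s t. s \<in> T \<Longrightarrow> t \<in> T \<Longrightarrow> s \<otimes> t \<in> T"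
  shows "F \<subseteq> M \<Longrightarrow> (\<And>Q. Q \<in> F \<Longrightarrow> \<exists>e \<in> T. v Q e > 0) \<Longrightarrow> \<exists>d \<in> T. \<forall>Q \<in> F. v Q d \<ge> l Q"
  using F
proof (induction F rule: finite_induct)
  case empty
  then show ?case using T(2) by blast
next
  case (insert Q F)
  obtain d where d: "d \<in> T" "\<And>Q'. Q' \<in> F \<Longrightarrow> v Q' d \<ge> l Q'" using insert by auto
  obtain e where e: "e \<in> T" "v Q e > 0" using insert.prems(2) by auto
  obtain n :: nat where n: "real n * v Q e \<ge> l Q"
    using reals_Archimedean3[OF e(2)] less_imp_le by blast
  have nz: "d \<in> nonzero R" "e \<in> nonzero R" "d \<in> B" "e \<in> B" using d e T(1) A_carrier by auto
  have pT: "e [^] n \<in> T" by (induction n) (use T e in auto)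
  have val: "v Q' (d \<otimes> e [^] n) = v Q' d + real n * v Q' e" if "Q' \<in> M" for Q'
    using v_mult[OF that nz(1) pow_nz[OF nz(2)]] v_facts(3)[OF that nz(2)] by simp
  have ge: "v Q' d \<ge> 0" "v Q' e \<ge> 0" if "Q' \<in> M" for Q'
    using v_ge_0[OF that] nz by auto
  have "v Q' (d \<otimes> e [^] n) \<ge> l Q'" if Q': "Q' \<in> insert Q F" for Q'
  proof -
    have QM: "Q' \<in> M" using Q' insert.prems(1) by auto
    have pos: "real n * v Q' e \<ge> 0" using ge(2)[OF QM] by simp
    show ?thesis
    proof (cases "Q' = Q")
      case True
      then show ?thesis using val[OF QM] ge(1)[OF QM] n by simp
    next
      case False
      then have "v Q' d \<ge> l Q'" using d(2) Q' by simp
      then show ?thesis unfolding val[OF QM] using pos by linarith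
    qed
  qed
  then show ?case using T(3)[OF d(1) pT] by blast
qed

text \<open>
  The complement of \<open>P\<close> is multiplicative and meets every other maximal ideal. So \<open>raise_values\<close>
  applies to it.
\<close>

lemma exists_unit_at_raising_others:
  assumes P: "P \<in> M" and F: "finite F" "F \<subseteq> M - {P}"
  obtains d where "d \<in> B - {\<zero>}" "v P d = 0" "\<And>Q. Q \<in> F \<Longrightarrow> v Q d \<ge> l Q"
proof -
  have "\<exists>d \<in> B - P. \<forall>Q \<in> F. v Q d \<ge> l Q"
  proof (rule raise_values[OF F(1)])
    show "B - P \<subseteq> B - {\<zero>}" "\<one> \<in> B - P" using max_idealD(3,4)[OF P] by auto
    show "F \<subseteq> M" using F(2) by blast
    show "s \<otimes> t \<in> B - P" if "s \<in> B - P" "t \<in> B - P" for s t by (rule max_idealD(5)[OF P that])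
    show "\<exists>e \<in> B - P. v Q e > 0" if Q: "Q \<in> F" for Q
    proof -
      have QM: "Q \<in> M" "Q \<noteq> P" using Q F(2) by auto
      have "\<not> Q \<subseteq> P"
        using QM max_idealD(1,2)[OF P] max_idealD(3)[OF P] unfolding max_ideals_iff[of Q] by (metis A_closed(2))
      then obtain e where e: "e \<in> Q" "e \<notin> P" by blast
      then have "e \<noteq> \<zero>" "e \<in> B" using max_idealD(4)[OF P] max_idealD(2)[OF QM(1)] by auto
      then show ?thesis using v_pos[OF QM(1) e(1)] e(2) by blast
    qed
  qed
  then obtain d where "d \<in> B - P" "\<forall>Q \<in> F. v Q d \<ge> l Q" by blast
  then show ?thesis using that[of d] v_eq_0[OF P] max_idealD(4)[OF P] by blast
qed

text \<open>
  The ideal consists of the elements whose values all lie in the prescribed cuts. To see that each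
  value in the cut at \<open>P\<close> occurs, take any \<open>x\<close> of this value at \<open>P\<close>. It violates the conditions at finitely many
  other maximal ideals only, which is repaired by a factor of value zero at \<open>P\<close> and large value at these.
\<close>

theorem exists_fractional_ideal:
  assumes fc: "finite_character R B"
    and attained: "\<And>P. P \<in> M \<Longrightarrow> \<alpha> P \<Longrightarrow> \<rho> P \<in> G P"
    and dense: "\<And>P. P \<in> M \<Longrightarrow> \<not> \<alpha> P \<Longrightarrow> dense_at P"
    and fin: "finite {P \<in> M. \<not> (\<rho> P = 0 \<and> \<alpha> P)}"
  obtains I where "fideal I" "\<And>P. P \<in> M \<Longrightarrow> ord P I = \<rho> P" "\<And>P. P \<in> M \<Longrightarrow> att P I \<longleftrightarrow> \<alpha> P"
proof -
  define cut where "cut P c \<longleftrightarrow> (if \<alpha> P then \<rho> P \<le> c else \<rho> P < c)" for P and c :: real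
  have up: "cut P d" if "cut P c" "c \<le> d" for P c d using that by (auto simp: cut_def split: if_splits)
  have lb: "\<rho> P \<le> c" if "cut P c" for P c using that by (auto simp: cut_def split: if_splits)
  (* adding 1 reaches the inside of an open cut as well as of a closed one *)
  have big: "cut P c" if "\<rho> P + 1 \<le> c" for P c using that by (auto simp: cut_def)
  define F where "F = {P \<in> M. \<not> (\<rho> P = 0 \<and> \<alpha> P)}"
  have F: "finite F" "F \<subseteq> M" using fin by (auto simp: F_def)
  have outside: "cut P c \<longleftrightarrow> 0 \<le> c" if "P \<in> M" "P \<notin> F" for P c
    using that by (auto simp: F_def cut_def)
  define I where "I = {x \<in> carrier R. x \<noteq> \<zero> \<longrightarrow> (\<forall>P \<in> M. cut P (v P x))}"
  have sI: "submodule_of R B I"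
  proof (rule submodule_ofI)
    show "x \<oplus> y \<in> I" if xy: "x \<in> I" "y \<in> I" for x y
    proof -
      have R: "x \<in> carrier R" "y \<in> carrier R" using xy by (auto simp: I_def)
      have "cut P (v P (x \<oplus> y))" if P: "P \<in> M" and nz: "x \<oplus> y \<noteq> \<zero>" for P
      proof -
        consider "x = \<zero>" | "y = \<zero>" | "x \<noteq> \<zero>" "y \<noteq> \<zero>" by blast
        then show ?thesis
        proof cases
          case 1
          then show ?thesis using xy(2) nz R P by (simp add: I_def)
        next
          case 2
          then show ?thesis using xy(1) nz R P by (simp add: I_def)
        next
          case 3
          have "cut P (v P x)" "cut P (v P y)" using xy 3 P by (auto simp: I_def)
          then have "cut P (min (v P x) (v P y))" by (simp add: min_def)
          then show ?thesis using up v_add[OF P, of x y] R 3 nz by simp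
        qed
      qed
      then show ?thesis using R by (simp add: I_def)
    qed
    show "b \<otimes> x \<in> I" if bx: "b \<in> B" "x \<in> I" for b x
    proof -
      have R: "b \<in> carrier R" "x \<in> carrier R" using bx A_carrier by (auto simp: I_def)
      have "cut P (v P (b \<otimes> x))" if P: "P \<in> M" and nz: "b \<otimes> x \<noteq> \<zero>" for P
      proof -
        have nz': "b \<noteq> \<zero>" "x \<noteq> \<zero>" using nz R by auto
        have "cut P (v P x)" using bx nz' P by (simp add: I_def)
        moreover have "v P x \<le> v P (b \<otimes> x)"
          using v_mult[OF P, of b x] v_ge_0[OF P bx(1) nz'(1)] nz' R by simp
        ultimately show ?thesis by (rule up)
      qed
      then show ?thesis using R by (simp add: I_def)
    qed
  qed (auto simp: I_def)
  have vals_I: "vals P I = {c \<in> G P. cut P c}" if P: "P \<in> M" for P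
  proof
    show "vals P I \<subseteq> {c \<in> G P. cut P c}" using P by (auto simp: vals_def I_def G_def)
    show "{c \<in> G P. cut P c} \<subseteq> vals P I"
    proof
      fix c assume "c \<in> {c \<in> G P. cut P c}"
      then have c: "c \<in> G P" "cut P c" by auto
      obtain x where x: "x \<in> nonzero R" "c = v P x" by (rule GE[OF c(1)])
      (* the maximal ideals other than P where x may violate its condition *)
      define F' where "F' = (F \<union> {Q \<in> M. v Q x \<noteq> 0}) - {P}"
      have F': "finite F'" "F' \<subseteq> M - {P}" using F finite_nonzero_values[OF fc x(1)] by (auto simp: F'_def)
      obtain d where d: "d \<in> B - {\<zero>}" "v P d = 0" "\<And>Q. Q \<in> F' \<Longrightarrow> v Q d \<ge> \<rho> Q + 1 - v Q x"
        by (rule exists_unit_at_raising_others[OF P F', of "\<lambda>Q. \<rho> Q + 1 - v Q x"]) (rule that)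
      have dn: "d \<in> nonzero R" using d(1) B_nz by simp
      have val: "v Q (d \<otimes> x) = v Q d + v Q x" if "Q \<in> M" for Q by (rule v_mult[OF that dn x(1)])
      have "cut Q (v Q (d \<otimes> x))" if Q: "Q \<in> M" for Q
      proof (cases "Q = P")
        case True
        then show ?thesis using val[OF P] d(2) c(2) x(2) by simp
      next
        case QP: False
        show ?thesis
        proof (cases "Q \<in> F'")
          case True
          then show ?thesis using big[of Q] val[OF Q] d(3)[OF True] by simp
        next
          case False
          then have "Q \<notin> F" "v Q x = 0" using Q QP by (auto simp: F'_def)
          then show ?thesis using outside[OF Q] val[OF Q] v_ge_0[OF Q, of d] d(1) by simp
        qed
      qed
      then have "d \<otimes> x \<in> I - {\<zero>}" using mult_nz[OF dn x(1)] by (simp add: I_def)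
      moreover have "v P (d \<otimes> x) = c" using val[OF P] d(2) x(2) by simp
      ultimately show "c \<in> vals P I" unfolding vals_def by blast
    qed
  qed
  have cut_ne: "\<exists>c \<in> G P. cut P c" if P: "P \<in> M" for P
  proof (cases "\<alpha> P")
    case True
    then show ?thesis using attained[OF P] by (auto simp: cut_def)
  next
    case False
    then have "\<exists>g \<in> G P. \<rho> P < g \<and> g < \<rho> P + 1" using dense[OF P] by (simp add: dense_at_def)
    then show ?thesis using False by (auto simp: cut_def)
  qed
  have "fideal I"
    unfolding fractional_ideal_iff
  proof (intro conjI sI)
    obtain P where P: "P \<in> M" using M_nonempty by blast
    have "vals P I \<noteq> {}" using vals_I[OF P] cut_ne[OF P] by auto
    then show "I \<noteq> {\<zero>}" by (auto simp: vals_def)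
    have "\<exists>d \<in> B - {\<zero>}. \<forall>Q \<in> F. v Q d \<ge> - \<rho> Q"
    proof (rule raise_values[OF F(1) subset_refl _ _ F(2)])
      show "\<one> \<in> B - {\<zero>}" by simp
      show "s \<otimes> t \<in> B - {\<zero>}" if "s \<in> B - {\<zero>}" "t \<in> B - {\<zero>}" for s t
        using that A_carrier by (auto simp: integral_iff)
      show "\<exists>e \<in> B - {\<zero>}. v Q e > 0" if "Q \<in> F" for Q
        using exists_positive[of Q] max_idealD(2)[of Q] that F(2) by blast
    qed
    then obtain d where d: "d \<in> B - {\<zero>}" "\<And>Q. Q \<in> F \<Longrightarrow> v Q d \<ge> - \<rho> Q" by blast
    have dn: "d \<in> nonzero R" using d(1) B_nz by simp
    have "d \<otimes> x \<in> B" if x: "x \<in> I" for x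
    proof (cases "x = \<zero>")
      case True
      then show ?thesis using dn by simp
    next
      case False
      have xn: "x \<in> nonzero R" using x False by (simp add: I_def)
      show ?thesis
      proof (rule local_global[OF submodule_of_self[OF subring] mult_nz[OF dn xn]])
        fix Q assume Q: "Q \<in> M"
        have c: "cut Q (v Q x)" using x False Q by (simp add: I_def)
        have "v Q d + v Q x \<ge> 0"
        proof (cases "Q \<in> F")
          case True
          then show ?thesis using d(2)[OF True] lb[OF c] by simp
        next
          case False
          then show ?thesis using outside[OF Q] c v_ge_0[OF Q, of d] d(1) by simp
        qed
        then have "v Q \<one> \<le> v Q (d \<otimes> x)" using v_mult[OF Q dn xn] v_facts(1)[OF Q] by simp
        then show "\<exists>a \<in> B - {\<zero>}. v Q a \<le> v Q (d \<otimes> x)" by (intro bexI[of _ \<one>]) auto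
      qed
    qed
    then show "\<exists>d \<in> nonzero R. \<forall>x \<in> I. d \<otimes> x \<in> B" using dn by blast
  qed
  moreover have "ord P I = \<rho> P" "att P I \<longleftrightarrow> \<alpha> P" if P: "P \<in> M" for P
  proof -
    have o: "ord P I = \<rho> P"
    proof (cases "\<alpha> P")
      case True
      then have "\<rho> P \<in> vals P I" using vals_I[OF P] attained[OF P True] by (simp add: cut_def)
      then show ?thesis unfolding ord_def
        by (rule cInf_eq_minimum) (use vals_I[OF P] lb in auto)
    next
      case False
      show ?thesis unfolding ord_def
      proof (rule cInf_eq_non_empty)
        show "vals P I \<noteq> {}" using vals_I[OF P] cut_ne[OF P] by auto
        show "\<rho> P \<le> c" if "c \<in> vals P I" for c using that vals_I[OF P] lb by simp
        show "y \<le> \<rho> P" if y: "\<And>c. c \<in> vals P I \<Longrightarrow> y \<le> c" for y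
        proof (rule ccontr)
          assume "\<not> y \<le> \<rho> P"
          then obtain g where g: "g \<in> G P" "\<rho> P < g" "g < y"
            using dense[OF P False] unfolding dense_at_def by (metis not_le)
          then have "g \<in> vals P I" using vals_I[OF P] False by (simp add: cut_def)
          then show False using y g(3) by fastforce
        qed
      qed
    qed
    show "ord P I = \<rho> P" by (rule o)
    show "att P I \<longleftrightarrow> \<alpha> P" using attained[OF P] unfolding att_def o vals_I[OF P] by (auto simp: cut_def)
  qed
  ultimately show ?thesis by (rule that)
qed

text \<open>
  If \<open>a \<in> I\<close> and \<open>d I \<subseteq> B\<close> then the data are trivial wherever both \<open>a\<close> and \<open>d\<close> have value zero.
\<close>

lemma finite_nontrivial:
  assumes fc: "finite_character R B" and I: "fideal I"
  shows "finite {P \<in> M. \<not> (ord P I = 0 \<and> att P I)}"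
proof -
  obtain a where a: "a \<in> I" "a \<in> nonzero R" using fractional_idealD(2)[OF I] by blast
  obtain d where d: "d \<in> nonzero R" "\<And>P c. P \<in> M \<Longrightarrow> c \<in> vals P I \<Longrightarrow> - v P d \<le> c"
    by (rule frac_lower_bound[OF I]) (rule that)
  have "ord P I = 0 \<and> att P I" if P: "P \<in> M" and 0: "v P a = 0" "v P d = 0" for P
  proof -
    have le: "v P a \<le> v P b" if "b \<in> I - {\<zero>}" for b
      using d(2)[OF P, of "v P b"] that 0 by (auto simp: vals_def)
    have ai: "a \<in> I - {\<zero>}" using a by simp
    show ?thesis using ord_att_if_min[OF P ai le] 0 by simp
  qed
  then have "{P \<in> M. \<not> (ord P I = 0 \<and> att P I)} \<subseteq> {P \<in> M. v P a \<noteq> 0} \<union> {P \<in> M. v P d \<noteq> 0}" by blast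
  then show ?thesis
    using finite_nonzero_values[OF fc a(2)] finite_nonzero_values[OF fc d(1)]
    by (meson finite_UnI finite_subset)
qed

lemma ord_in_G: "fideal I \<Longrightarrow> P \<in> M \<Longrightarrow> att P I \<Longrightarrow> ord P I \<in> G P"
  using vals_facts(4)[of I P] by (auto simp: att_def)

text \<open>
  The ideal \<open>J\<close> has the opposite infima and attains them where \<open>I\<close> does.
\<close>

theorem regular_if_finite_character:
  assumes fc: "finite_character R B" and I: "fideal I"
  obtains J where "fideal J" "ideal_prod R (ideal_prod R I J) I = I"
proof -
  have 1: "- ord P I \<in> G P" if P: "P \<in> M" and "att P I" for P
    using G_group(3)[OF P] ord_in_G[OF I that] by simp
  have 2: "finite {P \<in> M. \<not> (- ord P I = 0 \<and> att P I)}" using finite_nontrivial[OF fc I] by simp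
  obtain J where J: "fideal J" "\<And>P. P \<in> M \<Longrightarrow> ord P J = - ord P I"
    "\<And>P. P \<in> M \<Longrightarrow> att P J \<longleftrightarrow> att P I"
    by (rule exists_fractional_ideal[OF fc 1 dense_if_not_attained[OF I] 2]) (assumption | rule that)+
  note IJ = frac_ideal_prod[OF I J(1)]
  have "ideal_prod R (ideal_prod R I J) I = I"
    by (rule frac_eqI[OF frac_ideal_prod[OF IJ I] I])
      (simp add: ord_ideal_prod[OF IJ I] ord_ideal_prod[OF I J(1)] att_ideal_prod[OF IJ I]
        att_ideal_prod[OF I J(1)] J)
  then show ?thesis using that J(1) by blast
qed

end

section \<open>Quotients of commutative monoids\<close>

text \<open>
  Principal ideals, invertible ideals and value groups are submonoids of this kind. The condition on inverses says
  that the submonoid is a group, in a form that stays inside the ambient monoid.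
\<close>

locale submonoid_with_inverses = comm_monoid A + submonoid H A for A (structure) and H +
  assumes inverse: "h \<in> H \<Longrightarrow> \<exists>k \<in> H. k \<otimes> h = \<one>"
begin

lemma H_carrier: "h \<in> H \<Longrightarrow> h \<in> carrier A"
  using subset by blast

lemma coset_mem_iff: "x \<in> H #> a \<longleftrightarrow> (\<exists>h \<in> H. x = h \<otimes> a)"
  by (auto simp: r_coset_def)

lemma coset_subset:
  assumes "b \<in> carrier A" "h \<in> H" "a = h \<otimes> b"
  shows "H #> a \<subseteq> H #> b"
proof
  fix x assume "x \<in> H #> a"
  then obtain k where k: "k \<in> H" "x = k \<otimes> a" by (auto simp: coset_mem_iff)
  then have "x = (k \<otimes> h) \<otimes> b" using assms H_carrier by (simp add: m_assoc)
  then show "x \<in> H #> b" using k(1) assms(2) by (auto simp: coset_mem_iff)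
qed

lemma coset_eq_iff:
  assumes a: "a \<in> carrier A" and b: "b \<in> carrier A"
  shows "H #> a = H #> b \<longleftrightarrow> (\<exists>h \<in> H. a = h \<otimes> b)"
proof
  assume "H #> a = H #> b"
  moreover have "a \<in> H #> a" using a one_closed by (auto simp: coset_mem_iff intro!: bexI[of _ \<one>])
  ultimately show "\<exists>h \<in> H. a = h \<otimes> b" by (simp add: coset_mem_iff)
next
  assume "\<exists>h \<in> H. a = h \<otimes> b"
  then obtain h where h: "h \<in> H" "a = h \<otimes> b" by blast
  obtain k where k: "k \<in> H" "k \<otimes> h = \<one>" using inverse[OF h(1)] by blast
  have "b = k \<otimes> a" using h k b H_carrier by (simp add: m_assoc[symmetric])
  then show "H #> a = H #> b" using coset_subset[OF b h] coset_subset[OF a k(1)] by blast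
qed

lemma coset_mult:
  "a \<in> carrier A \<Longrightarrow> b \<in> carrier A \<Longrightarrow> (H #> a) <#> (H #> b) = H #> (a \<otimes> b)"
  using mult_Mod[OF comm_monoid_axioms submonoid_axioms, of a b] by (simp add: FactGroup_def)

lemma carrier_Mod: "carrier (A Mod H) = (\<lambda>a. H #> a) ` carrier A"
  by (rule carrier_FactGroup)

theorem Reg_Mod_eq_carrier_iff:
  "Reg (A Mod H) = carrier (A Mod H) \<longleftrightarrow>
    (\<forall>a \<in> carrier A. \<exists>b \<in> carrier A. \<exists>h \<in> H. a = h \<otimes> (a \<otimes> b \<otimes> a))"
proof -
  have "H #> a = (H #> a) <#> (H #> b) <#> (H #> a) \<longleftrightarrow> (\<exists>h \<in> H. a = h \<otimes> (a \<otimes> b \<otimes> a))"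
    if "a \<in> carrier A" "b \<in> carrier A" for a b
    using that by (simp add: coset_mult coset_eq_iff)
  then have "(\<exists>Y \<in> carrier (A Mod H). H #> a = (H #> a) <#> Y <#> (H #> a)) \<longleftrightarrow>
      (\<exists>b \<in> carrier A. \<exists>h \<in> H. a = h \<otimes> (a \<otimes> b \<otimes> a))" if "a \<in> carrier A" for a
    using that unfolding carrier_Mod by simp
  moreover have "Reg (A Mod H) = carrier (A Mod H) \<longleftrightarrow>
      (\<forall>a \<in> carrier A. \<exists>Y \<in> carrier (A Mod H). H #> a = (H #> a) <#> Y <#> (H #> a))"
    unfolding Reg_def carrier_Mod by (auto simp: FactGroup_def)
  ultimately show ?thesis by simp
qed

end

text \<open>
  The elements of the iterated quotient are sets of \<open>Q\<close>-cosets. The union of such a set is an \<open>H\<close>-coset,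
  and \<open>\<phi>\<close> is constant on it.
\<close>

theorem Mod_Mod_iso:
  fixes A :: "('a, 'b) monoid_scheme" (structure) and D :: "('c, 'd) monoid_scheme"
  assumes Q: "submonoid_with_inverses A Q" and H: "submonoid_with_inverses A H" and QH: "Q \<subseteq> H"
    and \<phi>: "\<phi> ` carrier A = carrier D"
    and hom: "\<And>a b. a \<in> carrier A \<Longrightarrow> b \<in> carrier A \<Longrightarrow> \<phi> (a \<otimes> b) = \<phi> a \<otimes>\<^bsub>D\<^esub> \<phi> b"
    and ker: "\<And>a b. a \<in> carrier A \<Longrightarrow> b \<in> carrier A \<Longrightarrow> \<phi> a = \<phi> b \<longleftrightarrow> (\<exists>h \<in> H. a = h \<otimes> b)"
  shows "(A Mod Q) Mod carrier (A\<lparr>carrier := H\<rparr> Mod Q) \<cong> D"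
proof -
  interpret Q: submonoid_with_inverses A Q by (rule Q)
  interpret H: submonoid_with_inverses A H by (rule H)
  define S where "S = carrier (A\<lparr>carrier := H\<rparr> Mod Q)"
  define cl where "cl a = (\<lambda>h. Q #> (h \<otimes> a)) ` H" for a
  have S: "S = (\<lambda>h. Q #> h) ` H"
    unfolding S_def by (simp add: carrier_FactGroup r_coset_def)
  have cl: "S #>\<^bsub>A Mod Q\<^esub> (Q #> a) = cl a" if a: "a \<in> carrier A" for a
  proof -
    have "S #>\<^bsub>A Mod Q\<^esub> (Q #> a) = (\<lambda>h. (Q #> h) <#> (Q #> a)) ` H"
    proof -
      have "(\<otimes>\<^bsub>A Mod Q\<^esub>) = (<#>)" by (simp add: FactGroup_def)
      then show ?thesis unfolding r_coset_def[of "A Mod Q"] S by auto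
    qed
    also have "\<dots> = cl a" unfolding cl_def
      by (rule image_cong) (use Q.coset_mult H.H_carrier a in auto)
    finally show ?thesis .
  qed
  have carr: "carrier ((A Mod Q) Mod S) = cl ` carrier A"
    unfolding carrier_FactGroup image_image using cl by auto
  have union: "\<Union> (cl a) = H #> a" if a: "a \<in> carrier A" for a
  proof
    show "\<Union> (cl a) \<subseteq> H #> a"
    proof
      fix x assume "x \<in> \<Union> (cl a)"
      then obtain h where h: "h \<in> H" "x \<in> Q #> (h \<otimes> a)" unfolding cl_def by blast
      then obtain q where q: "q \<in> Q" "x = q \<otimes> (h \<otimes> a)" by (auto simp: Q.coset_mem_iff)
      then have "x = (q \<otimes> h) \<otimes> a" using h a Q.H_carrier H.H_carrier by (simp add: Q.m_assoc)
      moreover have "q \<otimes> h \<in> H" using q h QH by auto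
      ultimately show "x \<in> H #> a" by (auto simp: H.coset_mem_iff)
    qed
    show "H #> a \<subseteq> \<Union> (cl a)"
    proof
      fix x assume "x \<in> H #> a"
      then obtain h where h: "h \<in> H" "x = h \<otimes> a" by (auto simp: H.coset_mem_iff)
      have "x = \<one> \<otimes> x" using h a H.H_carrier by simp
      then have "x \<in> Q #> x" using Q.one_closed unfolding Q.coset_mem_iff by blast
      then show "x \<in> \<Union> (cl a)" using h unfolding cl_def by blast
    qed
  qed
  have img: "\<phi> ` (\<Union> (cl a)) = {\<phi> a}" if a: "a \<in> carrier A" for a
  proof -
    have "\<phi> x = \<phi> a" if x: "x \<in> H #> a" for x
    proof -
      obtain h where h: "h \<in> H" "x = h \<otimes> a" using x by (auto simp: H.coset_mem_iff)
      then have "x \<in> carrier A" using a H.H_carrier by simp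
      then show ?thesis using ker[of x a] a h by blast
    qed
    moreover have "a \<in> H #> a"
      using a H.one_closed by (auto simp: H.coset_mem_iff intro!: bexI[of _ "\<one>"])
    ultimately show ?thesis unfolding union[OF a] by blast
  qed
  define \<psi> where "\<psi> C = the_elem (\<phi> ` \<Union> C)" for C
  have \<psi>: "\<psi> (cl a) = \<phi> a" if "a \<in> carrier A" for a unfolding \<psi>_def img[OF that] by simp
  have cl_mult: "cl a \<otimes>\<^bsub>(A Mod Q) Mod S\<^esub> cl b = cl (a \<otimes> b)"
    if a: "a \<in> carrier A" and b: "b \<in> carrier A" for a b
  proof -
    have m: "(Q #> (h \<otimes> a)) \<otimes>\<^bsub>A Mod Q\<^esub> (Q #> (k \<otimes> b)) =
        Q #> ((h \<otimes> k) \<otimes> (a \<otimes> b))" if "h \<in> H" "k \<in> H" for h k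
    proof -
      have R: "h \<in> carrier A" "k \<in> carrier A" using that H.H_carrier by auto
      then have "(h \<otimes> a) \<otimes> (k \<otimes> b) = (h \<otimes> k) \<otimes> (a \<otimes> b)"
        using a b by (simp add: Q.m_ac)
      then show ?thesis
        using mult_Mod[OF Q.comm_monoid_axioms Q.submonoid_axioms, of "h \<otimes> a" "k \<otimes> b"] R a b
        by simp
    qed
    have "cl a \<otimes>\<^bsub>(A Mod Q) Mod S\<^esub> cl b = cl a <#>\<^bsub>A Mod Q\<^esub> cl b" by (simp add: FactGroup_def)
    also have "\<dots> = (\<Union>h \<in> H. \<Union>k \<in> H. {Q #> ((h \<otimes> k) \<otimes> (a \<otimes> b))})"
      unfolding set_mult_def cl_def using m by simp
    also have "\<dots> = cl (a \<otimes> b)"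
    proof
      show "(\<Union>h \<in> H. \<Union>k \<in> H. {Q #> ((h \<otimes> k) \<otimes> (a \<otimes> b))}) \<subseteq> cl (a \<otimes> b)"
        unfolding cl_def using H.m_closed by blast
      show "cl (a \<otimes> b) \<subseteq> (\<Union>h \<in> H. \<Union>k \<in> H. {Q #> ((h \<otimes> k) \<otimes> (a \<otimes> b))})"
      proof
        fix C assume "C \<in> cl (a \<otimes> b)"
        then obtain h where h: "h \<in> H" "C = Q #> (h \<otimes> (a \<otimes> b))" unfolding cl_def by blast
        then have "C = Q #> ((h \<otimes> \<one>) \<otimes> (a \<otimes> b))" using H.H_carrier by simp
        then show "C \<in> (\<Union>h \<in> H. \<Union>k \<in> H. {Q #> ((h \<otimes> k) \<otimes> (a \<otimes> b))})"
          using h(1) H.one_closed by blast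
      qed
    qed
    finally show ?thesis .
  qed
  have cl_subset: "cl a \<subseteq> cl b" if b: "b \<in> carrier A" and h: "h \<in> H" "a = h \<otimes> b" for a b h
  proof
    fix C assume "C \<in> cl a"
    then obtain k where k: "k \<in> H" "C = Q #> (k \<otimes> a)" unfolding cl_def by blast
    have "k \<otimes> a = (k \<otimes> h) \<otimes> b" using h k b H.H_carrier by (simp add: Q.m_assoc)
    then show "C \<in> cl b" unfolding cl_def using k h(1) by (intro image_eqI[of _ _ "k \<otimes> h"]) auto
  qed
  have "\<psi> \<in> hom ((A Mod Q) Mod S) D"
  proof (rule homI)
    show "\<psi> C \<in> carrier D" if "C \<in> carrier ((A Mod Q) Mod S)" for C
      using that \<psi> \<phi> unfolding carr by auto
    show "\<psi> (C \<otimes>\<^bsub>(A Mod Q) Mod S\<^esub> E) = \<psi> C \<otimes>\<^bsub>D\<^esub> \<psi> E"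
      if CE: "C \<in> carrier ((A Mod Q) Mod S)" "E \<in> carrier ((A Mod Q) Mod S)" for C E
    proof -
      obtain a b where ab: "a \<in> carrier A" "b \<in> carrier A" "C = cl a" "E = cl b"
        using CE unfolding carr by blast
      then show ?thesis using cl_mult \<psi> hom by simp
    qed
  qed
  moreover have "bij_betw \<psi> (carrier ((A Mod Q) Mod S)) (carrier D)"
    unfolding bij_betw_def
  proof
    show "inj_on \<psi> (carrier ((A Mod Q) Mod S))"
    proof (rule inj_onI)
      fix C E assume CE: "C \<in> carrier ((A Mod Q) Mod S)" "E \<in> carrier ((A Mod Q) Mod S)" "\<psi> C = \<psi> E"
      then obtain a b where ab: "a \<in> carrier A" "b \<in> carrier A" "C = cl a" "E = cl b"
        unfolding carr by blast
      then have e: "\<phi> a = \<phi> b" using CE(3) \<psi> by simp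
      obtain h where h: "h \<in> H" "a = h \<otimes> b" using ker[OF ab(1,2)] e by blast
      obtain k where k: "k \<in> H" "b = k \<otimes> a" using ker[OF ab(2,1)] e by auto
      show "C = E" unfolding ab(3,4) using cl_subset[OF ab(2) h] cl_subset[OF ab(1) k] by blast
    qed
    show "\<psi> ` carrier ((A Mod Q) Mod S) = carrier D"
      unfolding carr image_image \<phi>[symmetric] by (rule image_cong) (use \<psi> in auto)
  qed
  ultimately have "\<psi> \<in> iso ((A Mod Q) Mod S) D" by (simp add: iso_def)
  then show ?thesis unfolding S_def is_iso_def by blast
qed

section \<open>The monoid of fractional ideals\<close>

context valued_domain
begin

abbreviation F where "F \<equiv> frac_ideal_monoid R B"

lemma F_simps [simp]: "carrier F = {I. fideal I}" "I \<otimes>\<^bsub>F\<^esub> J = ideal_prod R I J" "\<one>\<^bsub>F\<^esub> = B"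
  by (simp_all add: frac_ideal_monoid_def)

text \<open>
  By \<open>frac_eqI\<close> the laws reduce to those of addition of reals and of conjunction.
\<close>

lemma comm_monoid_F: "comm_monoid F"
proof (rule comm_monoidI)
  fix I J assume "I \<in> carrier F" "J \<in> carrier F"
  then have I: "fideal I" and J: "fideal J" by auto
  show "I \<otimes>\<^bsub>F\<^esub> J \<in> carrier F" using frac_ideal_prod[OF I J] by simp
  have "ideal_prod R I J = ideal_prod R J I"
    by (rule frac_eqI[OF frac_ideal_prod[OF I J] frac_ideal_prod[OF J I]])
      (auto simp: ord_ideal_prod[OF I J] ord_ideal_prod[OF J I] att_ideal_prod[OF I J] att_ideal_prod[OF J I])
  then show "I \<otimes>\<^bsub>F\<^esub> J = J \<otimes>\<^bsub>F\<^esub> I" by simp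
  fix N assume "N \<in> carrier F"
  then have N: "fideal N" by simp
  note IJ = frac_ideal_prod[OF I J] and JN = frac_ideal_prod[OF J N]
  have "ideal_prod R (ideal_prod R I J) N = ideal_prod R I (ideal_prod R J N)"
    by (rule frac_eqI[OF frac_ideal_prod[OF IJ N] frac_ideal_prod[OF I JN]])
      (simp add: ord_ideal_prod[OF I J] ord_ideal_prod[OF J N] ord_ideal_prod[OF IJ N] ord_ideal_prod[OF I JN]
        att_ideal_prod[OF I J] att_ideal_prod[OF J N] att_ideal_prod[OF IJ N] att_ideal_prod[OF I JN])
  then show "I \<otimes>\<^bsub>F\<^esub> J \<otimes>\<^bsub>F\<^esub> N = I \<otimes>\<^bsub>F\<^esub> (J \<otimes>\<^bsub>F\<^esub> N)" by simp
next
  show "\<one>\<^bsub>F\<^esub> \<in> carrier F" using frac_B by simp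
  fix I assume "I \<in> carrier F"
  then have I: "fideal I" by simp
  have "ideal_prod R B I = I"
    by (rule frac_eqI[OF frac_ideal_prod[OF frac_B I] I])
      (simp add: ord_ideal_prod[OF frac_B I] att_ideal_prod[OF frac_B I] ord_B att_B)
  then show "\<one>\<^bsub>F\<^esub> \<otimes>\<^bsub>F\<^esub> I = I" by simp
qed

sublocale F: comm_monoid F
  by (rule comm_monoid_F)

lemma principal_mult:
  assumes a: "a \<in> nonzero R" and b: "b \<in> nonzero R"
  shows "ideal_prod R (a <# B) (b <# B) = (a \<otimes> b) <# B"
  by (rule frac_eqI[OF frac_ideal_prod[OF principal_invariants(1)[OF a] principal_invariants(1)[OF b]]
        principal_invariants(1)[OF mult_nz[OF a b]]])
    (simp add: ord_ideal_prod[OF principal_invariants(1)[OF a] principal_invariants(1)[OF b]]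
      att_ideal_prod[OF principal_invariants(1)[OF a] principal_invariants(1)[OF b]] principal_invariants(2,3)[OF a] principal_invariants(2,3)[OF b]
      principal_invariants(2,3)[OF mult_nz[OF a b]] v_mult[OF _ a b])

lemma one_coset_B: "\<one> <# B = B"
  by (rule frac_eqI[OF principal_invariants(1)[OF one_nz] frac_B])
    (simp add: principal_invariants(2,3)[OF one_nz] ord_B att_B v_facts(1))

lemma principal_submonoid: "submonoid_with_inverses F (principal_ideals R B)"
proof (intro submonoid_with_inverses.intro submonoid_with_inverses_axioms.intro comm_monoid_F submonoid.intro)
  show "principal_ideals R B \<subseteq> carrier F" using principal_invariants(1) by (auto simp: principal_ideals_def)
  show "\<one>\<^bsub>F\<^esub> \<in> principal_ideals R B"
    unfolding principal_ideals_def using one_coset_B one_nz by (metis (mono_tags, lifting) F_simps(3) mem_Collect_eq)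
  show "I \<otimes>\<^bsub>F\<^esub> J \<in> principal_ideals R B"
    if IJ: "I \<in> principal_ideals R B" "J \<in> principal_ideals R B" for I J
  proof -
    obtain a b where ab: "a \<in> nonzero R" "b \<in> nonzero R" "I = a <# B" "J = b <# B"
      using IJ unfolding principal_ideals_def by blast
    then have "I \<otimes>\<^bsub>F\<^esub> J = (a \<otimes> b) <# B" using principal_mult by simp
    then show ?thesis unfolding principal_ideals_def using mult_nz[OF ab(1,2)] by blast
  qed
  show "\<exists>J \<in> principal_ideals R B. J \<otimes>\<^bsub>F\<^esub> I = \<one>\<^bsub>F\<^esub>" if I: "I \<in> principal_ideals R B" for I
  proof -
    obtain a where a: "a \<in> nonzero R" "I = a <# B" using I unfolding principal_ideals_def by blast
    have "(inv a <# B) \<otimes>\<^bsub>F\<^esub> I = \<one>\<^bsub>F\<^esub>"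
      using principal_mult[OF inv_nz[OF a(1)] a(1)] inv_facts(5)[of a] a one_coset_B by simp
    then show ?thesis unfolding principal_ideals_def using inv_nz[OF a(1)] by blast
  qed
qed

lemma invertible_submonoid: "submonoid_with_inverses F (invertible_ideals R B)"
proof (intro submonoid_with_inverses.intro submonoid_with_inverses_axioms.intro comm_monoid_F submonoid.intro)
  have D: "fideal I \<and> (\<exists>J. fideal J \<and> I \<otimes>\<^bsub>F\<^esub> J = \<one>\<^bsub>F\<^esub>) \<longleftrightarrow> I \<in> invertible_ideals R B" for I
    by (simp add: invertible_ideals_def)
  show "invertible_ideals R B \<subseteq> carrier F" by (auto simp: invertible_ideals_def)
  have "\<one>\<^bsub>F\<^esub> \<otimes>\<^bsub>F\<^esub> \<one>\<^bsub>F\<^esub> = \<one>\<^bsub>F\<^esub>" by (rule F.l_one[OF F.one_closed])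
  then show "\<one>\<^bsub>F\<^esub> \<in> invertible_ideals R B" unfolding D[symmetric] using frac_B by auto
  show "I \<otimes>\<^bsub>F\<^esub> J \<in> invertible_ideals R B"
    if IJ: "I \<in> invertible_ideals R B" "J \<in> invertible_ideals R B" for I J
  proof -
    obtain I' J' where *: "fideal I" "fideal J" "fideal I'" "fideal J'" "I \<otimes>\<^bsub>F\<^esub> I' = \<one>\<^bsub>F\<^esub>" "J \<otimes>\<^bsub>F\<^esub> J' = \<one>\<^bsub>F\<^esub>"
      using IJ unfolding D[symmetric] by blast
    then have c: "I \<in> carrier F" "J \<in> carrier F" "I' \<in> carrier F" "J' \<in> carrier F" by auto
    have "(I \<otimes>\<^bsub>F\<^esub> J) \<otimes>\<^bsub>F\<^esub> (I' \<otimes>\<^bsub>F\<^esub> J') = (I \<otimes>\<^bsub>F\<^esub> I') \<otimes>\<^bsub>F\<^esub> (J \<otimes>\<^bsub>F\<^esub> J')"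
      using c by (simp only: F.m_ac F.m_closed)
    also have "\<dots> = \<one>\<^bsub>F\<^esub>" unfolding *(5,6) by (rule F.l_one[OF F.one_closed])
    finally show ?thesis unfolding D[symmetric]
      using frac_ideal_prod[OF *(1,2)] frac_ideal_prod[OF *(3,4)] by auto
  qed
  show "\<exists>J \<in> invertible_ideals R B. J \<otimes>\<^bsub>F\<^esub> I = \<one>\<^bsub>F\<^esub>" if I: "I \<in> invertible_ideals R B" for I
  proof -
    obtain J where J: "fideal I" "fideal J" "I \<otimes>\<^bsub>F\<^esub> J = \<one>\<^bsub>F\<^esub>" using I unfolding D[symmetric] by blast
    have "J \<otimes>\<^bsub>F\<^esub> I = I \<otimes>\<^bsub>F\<^esub> J" by (rule F.m_comm) (use J in simp_all)
    then have "J \<otimes>\<^bsub>F\<^esub> I = \<one>\<^bsub>F\<^esub>" using J(3) by (rule trans)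
    then show ?thesis unfolding D[symmetric] Bex_def using J D by blast
  qed
qed

lemma principal_subset_invertible: "principal_ideals R B \<subseteq> invertible_ideals R B"
proof
  fix I assume "I \<in> principal_ideals R B"
  then obtain a where a: "a \<in> nonzero R" "I = a <# B" unfolding principal_ideals_def by blast
  have "ideal_prod R (a <# B) (inv a <# B) = B"
    using principal_mult[OF a(1) inv_nz[OF a(1)]] inv_facts(4)[of a] a one_coset_B by simp
  then show "I \<in> invertible_ideals R B"
    unfolding invertible_ideals_def using principal_invariants(1)[OF a(1)] principal_invariants(1)[OF inv_nz[OF a(1)]] a(2) by blast
qed

lemma Cl_regular_iff:
  "Reg (Cl R B) = carrier (Cl R B) \<longleftrightarrow> (\<forall>I. fideal I \<longrightarrow>
    (\<exists>J. fideal J \<and> (\<exists>a \<in> nonzero R. I = ideal_prod R (a <# B) (ideal_prod R (ideal_prod R I J) I))))"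
proof -
  have "(\<exists>h \<in> principal_ideals R B. S h) \<longleftrightarrow> (\<exists>a \<in> nonzero R. S (a <# B))" for S
    unfolding principal_ideals_def by blast
  then show ?thesis
    unfolding Cl_def submonoid_with_inverses.Reg_Mod_eq_carrier_iff[OF principal_submonoid] by simp
qed

lemma att_invertible:
  assumes "H \<in> invertible_ideals R B" "P \<in> M" shows "att P H"
proof -
  obtain J where J: "fideal H" "fideal J" "ideal_prod R H J = B"
    using assms(1) unfolding invertible_ideals_def by blast
  then show ?thesis using att_ideal_prod[OF J(1,2) assms(2)] att_B[OF assms(2)] by simp
qed

text \<open>
  The product of \<open>H\<close> and \<open>J\<close> has the same infima as \<open>B\<close>, and they are attained.
\<close>

lemma invertibleI:
  assumes H: "fideal H" and J: "fideal J"
    and "\<And>P. P \<in> M \<Longrightarrow> att P H \<and> att P J \<and> ord P J = - ord P H"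
  shows "H \<in> invertible_ideals R B"
proof -
  have "ideal_prod R H J = B"
    by (rule frac_eqI[OF frac_ideal_prod[OF H J] frac_B])
      (use assms(3) in \<open>simp add: ord_ideal_prod[OF H J] att_ideal_prod[OF H J] ord_B att_B\<close>)
  then show ?thesis unfolding invertible_ideals_def using H J by blast
qed

end

section \<open>Finite character from regularity\<close>

context cring
begin

lemma one_minus_one_minus: "f \<in> carrier R \<Longrightarrow> \<one> \<ominus> (\<one> \<ominus> f) = f"
  by (simp add: a_minus_def minus_add a_assoc[symmetric] r_neg)

lemma plus_one_minus: "f \<in> carrier R \<Longrightarrow> f \<oplus> (\<one> \<ominus> f) = \<one>"
  by (simp add: a_minus_def a_lcomm[of f \<one>] r_neg)

lemma mult_one_minus_mult:
  assumes "f \<in> carrier R" "h \<in> carrier R"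
  shows "(f \<otimes> h) \<otimes> (\<one> \<ominus> f \<otimes> h) = h \<otimes> (f \<otimes> (\<one> \<ominus> f)) \<oplus> (f \<otimes> f) \<otimes> (h \<otimes> (\<one> \<ominus> h))"
proof -
  let ?a = "f \<otimes> h" and ?b = "f \<otimes> (f \<otimes> h)" and ?c = "f \<otimes> (f \<otimes> (h \<otimes> h))"
  have R: "?a \<in> carrier R" "?b \<in> carrier R" "?c \<in> carrier R" using assms by auto
  have 1: "(f \<otimes> h) \<otimes> (\<one> \<ominus> f \<otimes> h) = ?a \<ominus> ?c"
    using assms by (simp add: a_minus_def r_distr r_minus m_ac)
  have 2: "h \<otimes> (f \<otimes> (\<one> \<ominus> f)) = ?a \<ominus> ?b"
    using assms by (simp add: a_minus_def r_distr r_minus m_ac)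
  have 3: "(f \<otimes> f) \<otimes> (h \<otimes> (\<one> \<ominus> h)) = ?b \<ominus> ?c"
    using assms by (simp add: a_minus_def r_distr r_minus m_ac)
  have "(x \<ominus> y) \<oplus> (y \<ominus> z) = x \<ominus> z" if "x \<in> carrier R" "y \<in> carrier R" "z \<in> carrier R" for x y z
    using minus_plus_plus_cancel[of x "\<ominus> z" y] that by (simp add: a_minus_def)
  from this[OF R] show ?thesis unfolding 1 2 3 by simp
qed

end

context valued_domain
begin

lemma one_minus_dvd_one_minus_power:
  assumes w: "w \<in> B" shows "\<exists>t \<in> B. \<one> \<ominus> w [^] (n :: nat) = (\<one> \<ominus> w) \<otimes> t"
proof (induction n)
  case 0
  have "\<one> \<ominus> w [^] (0 :: nat) = (\<one> \<ominus> w) \<otimes> \<zero>"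
    using A_carrier[OF w] by (simp add: a_minus_def r_neg)
  then show ?case using A_closed(1) by blast
next
  case (Suc n)
  then obtain t where t: "t \<in> B" "\<one> \<ominus> w [^] n = (\<one> \<ominus> w) \<otimes> t" by blast
  let ?q = "w [^] n"
  have R: "w \<in> carrier R" "t \<in> carrier R" "?q \<in> carrier R" using w t A_carrier by auto
  have "\<one> \<ominus> w [^] Suc n = (\<one> \<ominus> ?q) \<oplus> (?q \<ominus> ?q \<otimes> w)"
    using minus_plus_plus_cancel[of \<one> "\<ominus> (?q \<otimes> w)" ?q] R by (simp add: a_minus_def)
  also have "?q \<ominus> ?q \<otimes> w = (\<one> \<ominus> w) \<otimes> ?q" using R by (simp add: a_minus_def l_distr r_distr l_minus r_minus m_comm)
  also have "(\<one> \<ominus> ?q) \<oplus> (\<one> \<ominus> w) \<otimes> ?q = (\<one> \<ominus> w) \<otimes> (t \<oplus> ?q)"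
    unfolding t(2) using R by (simp add: r_distr)
  finally show ?case using t(1) w by (intro bexI[of _ "t \<oplus> ?q"]) simp_all
qed

definition idempotent_mod :: "'a \<Rightarrow> 'a \<Rightarrow> bool" where
  "idempotent_mod x f \<longleftrightarrow> f \<in> B \<and> (\<exists>c \<in> B. f \<otimes> (\<one> \<ominus> f) = x \<otimes> c)"

text \<open>
  A maximal ideal containing \<open>x\<close> contains exactly one of \<open>f\<close> and \<open>1 - f\<close> when \<open>f\<close> is idempotent modulo \<open>x\<close>. So
  the supports of these elements form a Boolean algebra.
\<close>

definition supp :: "'a \<Rightarrow> 'a \<Rightarrow> 'a set set" where
  "supp x f = {P \<in> M. x \<in> P \<and> f \<notin> P}"

lemma idempotent_mod_one: "x \<in> B \<Longrightarrow> idempotent_mod x \<one>"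
proof -
  assume x: "x \<in> B"
  have "\<one> \<otimes> (\<one> \<ominus> \<one>) = x \<otimes> \<zero>" using A_carrier[OF x] by (simp add: a_minus_def r_neg)
  then show ?thesis unfolding idempotent_mod_def using A_closed(1,2) by blast
qed

lemma idempotent_mod_compl:
  assumes "idempotent_mod x f" shows "idempotent_mod x (\<one> \<ominus> f)"
proof -
  obtain c where c: "f \<in> B" "c \<in> B" "f \<otimes> (\<one> \<ominus> f) = x \<otimes> c" using assms by (auto simp: idempotent_mod_def)
  have R: "f \<in> carrier R" using c A_carrier by simp
  have "(\<one> \<ominus> f) \<otimes> (\<one> \<ominus> (\<one> \<ominus> f)) = x \<otimes> c"
    unfolding one_minus_one_minus[OF R] c(3)[symmetric] using R by (simp add: m_comm)
  then show ?thesis unfolding idempotent_mod_def using c by auto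
qed

lemma idempotent_mod_mult:
  assumes x: "x \<in> B" and f: "idempotent_mod x f" and h: "idempotent_mod x h" shows "idempotent_mod x (f \<otimes> h)"
proof -
  obtain c where c: "f \<in> B" "c \<in> B" "f \<otimes> (\<one> \<ominus> f) = x \<otimes> c" using f by (auto simp: idempotent_mod_def)
  obtain d where d: "h \<in> B" "d \<in> B" "h \<otimes> (\<one> \<ominus> h) = x \<otimes> d" using h by (auto simp: idempotent_mod_def)
  have R: "f \<in> carrier R" "h \<in> carrier R" "c \<in> carrier R" "d \<in> carrier R" "x \<in> carrier R"
    using c d x A_carrier by auto
  have "(f \<otimes> h) \<otimes> (\<one> \<ominus> f \<otimes> h) = x \<otimes> (h \<otimes> c \<oplus> (f \<otimes> f) \<otimes> d)"
    unfolding mult_one_minus_mult[OF R(1,2)] c(3) d(3) using R by (simp add: r_distr m_ac)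
  moreover have "h \<otimes> c \<oplus> (f \<otimes> f) \<otimes> d \<in> B" "f \<otimes> h \<in> B" using c d by auto
  ultimately show ?thesis unfolding idempotent_mod_def by blast
qed

lemma compl_mem_iff:
  assumes f: "idempotent_mod x f" and P: "P \<in> M" "x \<in> P" shows "\<one> \<ominus> f \<in> P \<longleftrightarrow> f \<notin> P"
proof -
  obtain c where c: "f \<in> B" "c \<in> B" "f \<otimes> (\<one> \<ominus> f) = x \<otimes> c" using f by (auto simp: idempotent_mod_def)
  have "f \<oplus> (\<one> \<ominus> f) \<notin> P" using plus_one_minus[OF A_carrier[OF c(1)]] max_idealD(3)[OF P(1)] by simp
  then have "\<not> (f \<in> P \<and> \<one> \<ominus> f \<in> P)" using submodule_ofD(3)[OF max_idealD(1)[OF P(1)]] by blast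
  moreover have "f \<otimes> (\<one> \<ominus> f) \<in> P" unfolding c(3) by (rule max_idealD(6)[OF P(1,2) c(2)])
  then have "f \<in> P \<or> \<one> \<ominus> f \<in> P" using max_idealD(5)[OF P(1), of f "\<one> \<ominus> f"] c(1) by auto
  ultimately show ?thesis by blast
qed

lemma supp_compl: "idempotent_mod x f \<Longrightarrow> supp x (\<one> \<ominus> f) = supp x \<one> - supp x f"
proof (rule Set.set_eqI)
  fix P assume f: "idempotent_mod x f"
  show "P \<in> supp x (\<one> \<ominus> f) \<longleftrightarrow> P \<in> supp x \<one> - supp x f"
    using compl_mem_iff[OF f, of P] max_idealD(3)[of P] by (auto simp: supp_def)
qed

lemma supp_mult:
  assumes "idempotent_mod x f" "idempotent_mod x h" shows "supp x (f \<otimes> h) = supp x f \<inter> supp x h"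
proof -
  have B: "f \<in> B" "h \<in> B" using assms by (auto simp: idempotent_mod_def)
  have "f \<otimes> h \<notin> P \<longleftrightarrow> f \<notin> P \<and> h \<notin> P" if P: "P \<in> M" for P
    using max_idealD(5)[OF P, of f h] max_idealD(6)[OF P, of f h] max_idealD(7)[OF P, of f h] B by blast
  then show ?thesis unfolding supp_def by blast
qed

text \<open>
  The factor \<open>1 - f\<close> of \<open>f (1 - f) \<in> x B\<close> is outside \<open>P\<close> and has value zero.
\<close>

lemma idempotent_mod_value:
  assumes x: "x \<in> B" "x \<noteq> \<zero>" and f: "idempotent_mod x f" and P: "P \<in> M" "x \<in> P" "f \<in> P"
  shows "f = \<zero> \<or> v P x \<le> v P f"
proof (cases "f = \<zero>")
  case False
  obtain c where c: "f \<in> B" "c \<in> B" "f \<otimes> (\<one> \<ominus> f) = x \<otimes> c" using f by (auto simp: idempotent_mod_def)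
  have e: "\<one> \<ominus> f \<in> B - P" using compl_mem_iff[OF f P(1,2)] P(3) c(1) by simp
  have "\<one> \<ominus> f \<in> B" "\<one> \<ominus> f \<noteq> \<zero>" using e max_idealD(4)[OF P(1)] by auto
  then have en: "\<one> \<ominus> f \<in> nonzero R" by (rule B_nz)
  have n: "f \<in> nonzero R" "x \<in> nonzero R" using B_nz x c False by auto
  have "x \<otimes> c \<noteq> \<zero>" using mult_nz[OF n(1) en] c(3) by simp
  then have "c \<noteq> \<zero>" using n by auto
  then have cn: "c \<in> nonzero R" "v P c \<ge> 0" using B_nz c v_ge_0[OF P(1)] by auto
  have "v P f + v P (\<one> \<ominus> f) = v P x + v P c"
    using v_mult[OF P(1) n(1) en] v_mult[OF P(1) n(2) cn(1)] c(3) by simp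
  then show ?thesis using v_eq_0[OF P(1) e] cn(2) by simp
qed simp

text \<open>
  An element \<open>e\<close> of \<open>Q\<close> outside \<open>P\<close> is invertible modulo \<open>x\<close> where it does not vanish and nilpotent
  elsewhere: no maximal ideal contains both \<open>e\<close> and all \<open>z\<close> with \<open>e\<^sup>n z \<in> x B\<close> for some \<open>n\<close>,
  as values are archimedean. This yields an idempotent.
\<close>

lemma separating_idempotent:
  assumes x: "x \<in> B" "x \<noteq> \<zero>" and P: "P \<in> M" "x \<in> P" and Q: "Q \<in> M" "x \<in> Q" and PQ: "P \<noteq> Q"
  obtains f where "idempotent_mod x f" "P \<in> supp x f" "Q \<notin> supp x f"
proof -
  have xn: "x \<in> nonzero R" and xR: "x \<in> carrier R" using B_nz x by auto
  have "\<not> Q \<subseteq> P"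
    using Q(1) PQ max_idealD(1,2)[OF P(1)] max_idealD(3)[OF P(1)] unfolding max_ideals_iff[of Q] by (metis A_closed(2))
  then obtain e where e: "e \<in> Q" "e \<notin> P" by blast
  have eB: "e \<in> B" "e \<in> carrier R" "e \<noteq> \<zero>" using e max_idealD(2)[OF Q(1)] max_idealD(4)[OF P(1)] A_carrier by auto
  have en: "e \<in> nonzero R" using eB by simp
  define N where "N = {z \<in> B. \<exists>n :: nat. \<exists>c \<in> B. e [^] n \<otimes> z = x \<otimes> c}"
  have N_mono: "\<exists>c \<in> B. e [^] m \<otimes> z = x \<otimes> c"
    if z: "z \<in> B" "c \<in> B" "e [^] n \<otimes> z = x \<otimes> c" "n \<le> m" for z c and n m :: nat
  proof -
    obtain k where k: "m = n + k" using z(4) by (metis le_iff_add)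
    have zR: "z \<in> carrier R" "c \<in> carrier R" using z A_carrier by auto
    have "e [^] m \<otimes> z = e [^] k \<otimes> (e [^] n \<otimes> z)"
      using zR eB by (simp add: k nat_pow_mult[symmetric] m_ac)
    also have "\<dots> = x \<otimes> (e [^] k \<otimes> c)" unfolding z(3) using zR eB xR by (simp add: m_lcomm)
    finally show ?thesis using z(2) eB(1) by (intro bexI[of _ "e [^] k \<otimes> c"]) simp_all
  qed
  have sN: "submodule_of R B N"
  proof (rule submodule_ofI)
    show "z \<in> carrier R" if "z \<in> N" for z using that A_carrier by (auto simp: N_def)
    have "e [^] (0 :: nat) \<otimes> \<zero> = x \<otimes> \<zero>" using xR by simp
    then show "\<zero> \<in> N" unfolding N_def using A_closed(1) by blast
    show "y \<oplus> z \<in> N" if yz: "y \<in> N" "z \<in> N" for y z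
    proof -
      obtain n c where y: "y \<in> B" "c \<in> B" "e [^] (n :: nat) \<otimes> y = x \<otimes> c" using yz unfolding N_def by blast
      obtain m d where z: "z \<in> B" "d \<in> B" "e [^] (m :: nat) \<otimes> z = x \<otimes> d" using yz unfolding N_def by blast
      obtain c' where c': "c' \<in> B" "e [^] max n m \<otimes> y = x \<otimes> c'" using N_mono[OF y, of "max n m"] by auto
      obtain d' where d': "d' \<in> B" "e [^] max n m \<otimes> z = x \<otimes> d'" using N_mono[OF z, of "max n m"] by auto
      have "e [^] max n m \<otimes> (y \<oplus> z) = x \<otimes> (c' \<oplus> d')"
        using c' d' y z A_carrier eB xR by (simp add: r_distr)
      then show ?thesis unfolding N_def using y(1) z(1) c'(1) d'(1) A_closed(3) by blast
    qed
    show "b \<otimes> z \<in> N" if bz: "b \<in> B" "z \<in> N" for b z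
    proof -
      obtain m d where z: "z \<in> B" "d \<in> B" "e [^] (m :: nat) \<otimes> z = x \<otimes> d" using bz unfolding N_def by blast
      have R: "b \<in> carrier R" "z \<in> carrier R" "d \<in> carrier R" using bz z A_carrier by auto
      have "e [^] m \<otimes> (b \<otimes> z) = b \<otimes> (e [^] m \<otimes> z)" using R eB by (simp add: m_lcomm)
      also have "\<dots> = x \<otimes> (b \<otimes> d)" unfolding z(3) using R xR by (simp add: m_lcomm)
      finally show ?thesis unfolding N_def using bz(1) z(1,2) A_closed(4) by blast
    qed
  qed
  define S where "S = {a \<oplus> b | a b. a \<in> N \<and> b \<in> (\<otimes>) e ` B}"
  have sS: "submodule_of R B S" unfolding S_def
    by (rule submodule_of_sum[OF sN submodule_of_scale[OF submodule_of_self[OF subring] eB(2)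
          subringE(1)[OF subring]] subringE(1)[OF subring]])
  have NB: "N \<subseteq> B" by (auto simp: N_def)
  have e0: "\<zero> \<in> (\<otimes>) e ` B" using eB by (intro image_eqI[of _ _ \<zero>]) auto
  have NS: "z \<in> S" if "z \<in> N" for z
  proof -
    have "z = z \<oplus> \<zero>" using that NB A_carrier by auto
    then show ?thesis unfolding S_def using that e0 by blast
  qed
  have eS: "e \<in> S"
  proof -
    have "e = \<zero> \<oplus> e \<otimes> \<one>" using eB by simp
    then show ?thesis unfolding S_def using submodule_ofD(2)[OF sN] A_closed(2) by blast
  qed
  have SB: "S \<subseteq> B" unfolding S_def using NB eB(1) by auto
  have "\<one> \<in> S"
  proof (rule ccontr)
    assume "\<one> \<notin> S"
    then obtain W where W: "W \<in> M" "S \<subseteq> W" using max_ideal_above[OF sS SB] by metis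
    have ve: "v W e > 0" using v_pos[OF W(1) _ eB(3)] eS W(2) by blast
    obtain n :: nat where n: "real n * v W e \<ge> v W x"
      using reals_Archimedean3[OF ve] less_imp_le by blast
    have pn: "e [^] n \<in> nonzero R" by (rule pow_nz[OF en])
    have "v W (e [^] n \<otimes> inv x) \<ge> 0"
      using v_mult[OF W(1) pn inv_nz[OF xn]] v_facts(2)[OF W(1) xn] v_facts(3)[OF W(1) en] n by simp
    then obtain s where s: "s \<in> B - W" "s \<otimes> (e [^] n \<otimes> inv x) \<in> B"
      using v_nonneg_iff_denominator[OF W(1) mult_nz[OF pn inv_nz[OF xn]]] by blast
    have sR: "s \<in> carrier R" using s A_carrier by simp
    have "x \<otimes> (s \<otimes> (e [^] n \<otimes> inv x)) = e [^] n \<otimes> s \<otimes> (x \<otimes> inv x)"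
      using sR eB xR inv_nz[OF xn] by (simp add: m_ac)
    then have "e [^] n \<otimes> s = x \<otimes> (s \<otimes> (e [^] n \<otimes> inv x))"
      using inv_facts(4)[of x] xn sR eB by simp
    then have "s \<in> N" unfolding N_def using s by blast
    then show False using NS W(2) s(1) by blast
  qed
  then obtain z y where zy: "z \<in> N" "y \<in> B" "\<one> = z \<oplus> e \<otimes> y" unfolding S_def by blast
  obtain n c where z: "z \<in> B" "c \<in> B" "e [^] (n :: nat) \<otimes> z = x \<otimes> c" using zy(1) unfolding N_def by blast
  (* a positive exponent makes sure that f lies in Q *)
  obtain c' where c': "c' \<in> B" "e [^] Suc n \<otimes> z = x \<otimes> c'" using N_mono[OF z, of "Suc n"] by auto
  define w where "w = e \<otimes> y"
  have wB: "w \<in> B" unfolding w_def using eB zy by simp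
  have R: "z \<in> carrier R" "y \<in> carrier R" "w \<in> carrier R" "c' \<in> carrier R"
    using z zy wB c' A_carrier by auto
  have "z \<oplus> w = \<one>" using zy(3) by (simp add: w_def)
  then have zw: "\<one> \<ominus> w = z" using R by (metis a_minus_def add.inv_solve_right' one_closed)
  obtain t where t: "t \<in> B" "\<one> \<ominus> w [^] Suc n = (\<one> \<ominus> w) \<otimes> t" using one_minus_dvd_one_minus_power[OF wB] by blast
  have tR: "t \<in> carrier R" using t A_carrier by simp
  define f where "f = w [^] Suc n"
  have fe: "f = e [^] Suc n \<otimes> y [^] Suc n" unfolding f_def w_def by (rule nat_pow_distrib[OF eB(2) R(2)])
  have yR: "y [^] Suc n \<in> carrier R" "e [^] Suc n \<in> carrier R" using R eB by auto
  have "f \<otimes> (\<one> \<ominus> f) = f \<otimes> (z \<otimes> t)" using t(2) zw by (simp add: f_def)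
  also have "\<dots> = (e [^] Suc n \<otimes> z) \<otimes> (y [^] Suc n \<otimes> t)"
    unfolding fe using yR R tR by (simp only: m_ac m_closed)
  also have "\<dots> = x \<otimes> (c' \<otimes> (y [^] Suc n \<otimes> t))" unfolding c'(2) using xR R tR yR by (simp only: m_assoc m_closed)
  finally have eq: "f \<otimes> (\<one> \<ominus> f) = x \<otimes> (c' \<otimes> (y [^] Suc n \<otimes> t))" .
  have "c' \<otimes> (y [^] Suc n \<otimes> t) \<in> B" by (intro A_closed c'(1) zy(2) t(1))
  moreover have fB: "f \<in> B" unfolding f_def by (intro A_closed wB)
  ultimately have "idempotent_mod x f" unfolding idempotent_mod_def using eq by blast
  moreover have "f \<in> Q"
  proof -
    have "w \<in> Q" unfolding w_def by (rule max_idealD(6)[OF Q(1) e(1) zy(2)])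
    then show ?thesis unfolding f_def using max_idealD(7)[OF Q(1), of "w [^] n" w] wB by simp
  qed
  moreover have "f \<notin> P"
  proof -
    have pw: "w [^] (k :: nat) \<in> B - P" if "w \<notin> P" for k
    proof (induction k)
      case (Suc k)
      then show ?case using max_idealD(5)[OF P(1), of "w [^] k" w] wB that by simp
    qed (use max_idealD(3)[OF P(1)] in simp)
    have ep: "e [^] (k :: nat) \<in> B - P" for k
    proof (induction k)
      case (Suc k)
      then show ?case using max_idealD(5)[OF P(1), of "e [^] k" e] eB e(2) by simp
    qed (use max_idealD(3)[OF P(1)] in simp)
    have "e [^] n \<otimes> z \<in> P" unfolding z(3) by (rule max_idealD(6)[OF P z(2)])
    then have "z \<in> P" using max_idealD(5)[OF P(1) ep, of z n] z(1) by blast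
    moreover have "z \<oplus> w \<notin> P" using \<open>z \<oplus> w = \<one>\<close> max_idealD(3)[OF P(1)] by simp
    ultimately have "w \<notin> P" using submodule_ofD(3)[OF max_idealD(1)[OF P(1)]] by blast
    then show ?thesis unfolding f_def using pw by blast
  qed
  ultimately show ?thesis using that[of f] P by (simp add: supp_def)
qed

text \<open>
  Split an infinite support into two parts by an idempotent that separates two of its points; one of
  the parts is again infinite, and neither is everything.
\<close>

lemma smaller_infinite_support:
  assumes x: "x \<in> B" "x \<noteq> \<zero>" and g: "idempotent_mod x g" "infinite (supp x g)"
  shows "\<exists>h. (idempotent_mod x h \<and> infinite (supp x h)) \<and> supp x h \<subset> supp x g"
proof -
  obtain P Q where PQ: "P \<in> supp x g" "Q \<in> supp x g" "P \<noteq> Q"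
    using g(2) by (metis finite.simps infinite_imp_nonempty insertI1 is_singletonI' is_singleton_def)
  then obtain f where f: "idempotent_mod x f" "P \<in> supp x f" "Q \<notin> supp x f"
    using separating_idempotent[OF x, of P Q] unfolding supp_def by blast
  note f' = idempotent_mod_compl[OF f(1)]
  have 1: "supp x (g \<otimes> f) = supp x g \<inter> supp x f" by (rule supp_mult[OF g(1) f(1)])
  have "supp x g \<subseteq> supp x \<one>" using max_idealD(3) by (auto simp: supp_def)
  then have 2: "supp x (g \<otimes> (\<one> \<ominus> f)) = supp x g - supp x f"
    unfolding supp_mult[OF g(1) f'] supp_compl[OF f(1)] by blast
  have "infinite (supp x g \<inter> supp x f) \<or> infinite (supp x g - supp x f)"
    using g(2) by (metis Int_Diff_Un finite_UnI)
  then show ?thesis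
  proof
    assume "infinite (supp x g \<inter> supp x f)"
    then show ?thesis using 1 PQ f idempotent_mod_mult[OF x(1) g(1) f(1)] by (intro exI[of _ "g \<otimes> f"]) auto
  next
    assume "infinite (supp x g - supp x f)"
    then show ?thesis using 2 PQ f idempotent_mod_mult[OF x(1) g(1) f'] by (intro exI[of _ "g \<otimes> (\<one> \<ominus> f)"]) auto
  qed
qed

text \<open>
  A sum of products involves only finitely many elements of \<open>I\<close>, and these work for all \<open>P\<close> at once.
\<close>

lemma finite_attaining_set:
  assumes I: "fideal I" and J: "fideal J"
  shows "z \<in> ideal_prod R I J \<Longrightarrow> z \<in> carrier R \<and> (\<exists>E. finite E \<and> E \<subseteq> I - {\<zero>} \<and>
    (z \<noteq> \<zero> \<longrightarrow> (\<forall>P \<in> M. \<exists>a \<in> E. \<exists>b \<in> J - {\<zero>}. v P a + v P b \<le> v P z)))"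
proof (induction rule: ideal_prod.induct)
  case (prod i j)
  have R: "i \<in> carrier R" "j \<in> carrier R" using prod fractional_idealD(4)[OF I] fractional_idealD(4)[OF J] by auto
  show ?case
  proof (intro conjI exI[of _ "{i} - {\<zero>}"] impI ballI)
    assume nz: "i \<otimes> j \<noteq> \<zero>"
    fix P assume P: "P \<in> M"
    have nz': "i \<noteq> \<zero>" "j \<noteq> \<zero>" using R nz by auto
    then show "\<exists>a \<in> {i} - {\<zero>}. \<exists>b \<in> J - {\<zero>}. v P a + v P b \<le> v P (i \<otimes> j)"
      using v_mult[OF P, of i j] R prod by auto
  qed (use prod R in auto)
next
  case (sum s t)
  have R: "s \<in> carrier R" "t \<in> carrier R" using sum.IH by auto
  obtain E E' where E: "finite E" "E \<subseteq> I - {\<zero>}"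
      "s \<noteq> \<zero> \<Longrightarrow> \<forall>P \<in> M. \<exists>a \<in> E. \<exists>b \<in> J - {\<zero>}. v P a + v P b \<le> v P s"
    and E': "finite E'" "E' \<subseteq> I - {\<zero>}"
      "t \<noteq> \<zero> \<Longrightarrow> \<forall>P \<in> M. \<exists>a \<in> E'. \<exists>b \<in> J - {\<zero>}. v P a + v P b \<le> v P t"
    using sum.IH by metis
  show ?case
  proof (intro conjI exI[of _ "E \<union> E'"] impI ballI)
    assume st: "s \<oplus> t \<noteq> \<zero>"
    fix P assume P: "P \<in> M"
    consider "s = \<zero>" | "t = \<zero>" | "s \<noteq> \<zero>" "t \<noteq> \<zero>" by blast
    then show "\<exists>a \<in> E \<union> E'. \<exists>b \<in> J - {\<zero>}. v P a + v P b \<le> v P (s \<oplus> t)"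
    proof cases
      case 1
      then have t: "t \<noteq> \<zero>" "s \<oplus> t = t" using st R by auto
      show ?thesis unfolding t(2) using E'(3)[OF t(1)] P by blast
    next
      case 2
      then have s: "s \<noteq> \<zero>" "s \<oplus> t = s" using st R by auto
      show ?thesis unfolding s(2) using E(3)[OF s(1)] P by blast
    next
      case 3
      obtain a b where ab: "a \<in> E" "b \<in> J - {\<zero>}" "v P a + v P b \<le> v P s" using E(3)[OF 3(1)] P by blast
      obtain a' b' where ab': "a' \<in> E'" "b' \<in> J - {\<zero>}" "v P a' + v P b' \<le> v P t"
        using E'(3)[OF 3(2)] P by blast
      have "v P (s \<oplus> t) \<ge> min (v P s) (v P t)" using v_add[OF P, of s t] R 3 st by simp
      then have "v P a + v P b \<le> v P (s \<oplus> t) \<or> v P a' + v P b' \<le> v P (s \<oplus> t)" using ab ab' by linarith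
      then show ?thesis using ab ab' by blast
    qed
  qed (use R E E' in auto)
qed

text \<open>
  Attained infima cancel in the regularity equation, which exhibits an inverse of \<open>I\<close>. The sum of
  products that represents \<open>1\<close> involves finitely many elements of \<open>I\<close>, and at each \<open>P\<close> one of them must
  have the least value.
\<close>

lemma finitely_attained_if_regular:
  assumes I: "fideal I" and att: "\<And>P. P \<in> M \<Longrightarrow> att P I" and J: "fideal J" and a: "a \<in> nonzero R"
    and reg: "I = ideal_prod R (a <# B) (ideal_prod R (ideal_prod R I J) I)"
  obtains E where "finite E" "E \<subseteq> I - {\<zero>}" "\<And>P. P \<in> M \<Longrightarrow> \<exists>e \<in> E. v P e = ord P I"
proof -
  note aB = principal_invariants[OF a]
  note IJ = frac_ideal_prod[OF I J]
  note IJI = frac_ideal_prod[OF IJ I]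
  (* the inverse of I: the factor a turns the regularity of the class into I = I (I N) *)
  define N where "N = ideal_prod R (a <# B) J"
  have N: "fideal N" unfolding N_def by (rule frac_ideal_prod[OF aB(1) J])
  have val: "ord P N = - ord P I \<and> att P N" if P: "P \<in> M" for P
  proof -
    have "ord P I = v P a + ((ord P I + ord P J) + ord P I)"
      by (subst reg) (simp add: ord_ideal_prod[OF aB(1) IJI P] ord_ideal_prod[OF IJ I P]
          ord_ideal_prod[OF I J P] aB(2)[OF P])
    moreover have "att P (ideal_prod R (a <# B) (ideal_prod R (ideal_prod R I J) I))"
      using att[OF P] reg by simp
    then have "att P J"
      by (simp add: att_ideal_prod[OF aB(1) IJI P] att_ideal_prod[OF IJ I P] att_ideal_prod[OF I J P])
    ultimately show ?thesis
      unfolding N_def by (simp add: ord_ideal_prod[OF aB(1) J P] att_ideal_prod[OF aB(1) J P] aB(2,3)[OF P])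
  qed
  have "ideal_prod R I N = B"
    by (rule frac_eqI[OF frac_ideal_prod[OF I N] frac_B])
      (simp add: ord_ideal_prod[OF I N] att_ideal_prod[OF I N] val att ord_B att_B)
  then have "\<one> \<in> ideal_prod R I N" by simp
  from finite_attaining_set[OF I N this] obtain E where E: "finite E" "E \<subseteq> I - {\<zero>}"
    "\<forall>P \<in> M. \<exists>a \<in> E. \<exists>b \<in> N - {\<zero>}. v P a + v P b \<le> v P \<one>" using one_not_zero by blast
  show ?thesis
  proof (rule that[OF E(1,2)])
    fix P assume P: "P \<in> M"
    obtain e b where eb: "e \<in> E" "b \<in> N - {\<zero>}" "v P e + v P b \<le> v P \<one>" using E(3) P by blast
    have "v P b \<in> vals P N" "v P e \<in> vals P I" using eb E(2) by (auto simp: vals_def)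
    then have "ord P N \<le> v P b" "ord P I \<le> v P e" using vals_facts(3)[OF N P] vals_facts(3)[OF I P] by auto
    then have "v P e = ord P I" using val[OF P] eb(3) v_facts(1)[OF P] by simp
    then show "\<exists>e \<in> E. v P e = ord P I" using eb(1) by blast
  qed
qed

text \<open>
  Let \<open>C\<^sub>n\<close> be the strictly decreasing supports of idempotents \<open>g\<^sub>n\<close> modulo \<open>x\<close>, and \<open>I\<close> the ideal of the elements
  whose value on some \<open>C\<^sub>n\<close> is at least that of \<open>x\<close>. Its infimum is zero outside \<open>C\<^sub>n\<close>, attained by \<open>1 - g\<^sub>n\<close> or,
  where \<open>x\<close> has value zero, by \<open>x\<close>; and it is attained by \<open>x\<close> in the intersection of all \<open>C\<^sub>n\<close>. But a finite subset of
  \<open>I\<close> has values of at least that of \<open>x\<close> on a single \<open>C\<^sub>n\<close>, while the infimum is zero on \<open>C\<^sub>n - C\<^bsub>n+1\<^esub>\<close>.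
\<close>

theorem finite_character_if_regular:
  assumes reg: "\<And>I. fideal I \<Longrightarrow>
    \<exists>J. fideal J \<and> (\<exists>a \<in> nonzero R. I = ideal_prod R (a <# B) (ideal_prod R (ideal_prod R I J) I))"
  shows "finite_character R B"
proof (rule ccontr)
  assume "\<not> finite_character R B"
  then obtain x where x: "x \<in> B" "x \<noteq> \<zero>" and inf: "infinite {P \<in> M. x \<in> P}"
    unfolding finite_character_def by blast
  have xn: "x \<in> nonzero R" using B_nz x by simp
  have "supp x \<one> = {P \<in> M. x \<in> P}" using max_idealD(3) by (auto simp: supp_def)
  then have "idempotent_mod x \<one> \<and> infinite (supp x \<one>)" using idempotent_mod_one[OF x(1)] inf by simp
  then obtain g where g: "\<And>n :: nat. idempotent_mod x (g n) \<and> infinite (supp x (g n))"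
    "\<And>n. supp x (g (Suc n)) \<subset> supp x (g n)"
    using dependent_nat_choice[of "\<lambda>_ h. idempotent_mod x h \<and> infinite (supp x h)" "\<lambda>_ h h'. supp x h' \<subset> supp x h"]
      smaller_infinite_support[OF x] by metis
  have anti: "supp x (g n) \<subseteq> supp x (g m)" if "m \<le> n" for m n
    using lift_Suc_antimono_le[of "\<lambda>n. supp x (g n)", OF psubset_imp_subset[OF g(2)] that] .
  define small where "small n z \<longleftrightarrow> (\<forall>P \<in> supp x (g n). z = \<zero> \<or> v P x \<le> v P z)" for n z
  have small_mono: "small n z" if "small m z" "m \<le> n" for m n z
    using that anti unfolding small_def by blast
  define I where "I = {z \<in> B. \<exists>n. small n z}"
  have sM: "P \<in> M" if "P \<in> supp x h" for P h using that by (simp add: supp_def)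
  have sI: "submodule_of R B I"
  proof (rule submodule_ofI)
    show "z \<in> carrier R" if "z \<in> I" for z using that A_carrier by (simp add: I_def)
    show "\<zero> \<in> I" by (simp add: I_def small_def)
    show "y \<oplus> z \<in> I" if yz: "y \<in> I" "z \<in> I" for y z
    proof -
      obtain m n where mn: "small m y" "small n z" using yz by (auto simp: I_def)
      have R: "y \<in> B" "z \<in> B" "y \<in> carrier R" "z \<in> carrier R" using yz A_carrier by (auto simp: I_def)
      have s: "small (max m n) y" "small (max m n) z" using small_mono mn by (meson max.cobounded1 max.cobounded2)+
      have "small (max m n) (y \<oplus> z)"
        unfolding small_def
      proof
        fix P assume P: "P \<in> supp x (g (max m n))"
        have yz': "y = \<zero> \<or> v P x \<le> v P y" "z = \<zero> \<or> v P x \<le> v P z" using s P by (auto simp: small_def)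
        consider "y = \<zero>" | "z = \<zero>" | "y \<oplus> z = \<zero>" | "y \<noteq> \<zero>" "z \<noteq> \<zero>" "y \<oplus> z \<noteq> \<zero>" by blast
        then show "y \<oplus> z = \<zero> \<or> v P x \<le> v P (y \<oplus> z)"
        proof cases
          case 4
          then have "min (v P y) (v P z) \<le> v P (y \<oplus> z)" using v_add[OF sM[OF P], of y z] R by simp
          then show ?thesis using 4 yz' by linarith
        qed (use yz' R in auto)
      qed
      then show ?thesis using R by (auto simp: I_def)
    qed
    show "b \<otimes> z \<in> I" if bz: "b \<in> B" "z \<in> I" for b z
    proof -
      obtain n where n: "small n z" using bz by (auto simp: I_def)
      have R: "z \<in> B" "z \<in> carrier R" "b \<in> carrier R" using bz A_carrier by (auto simp: I_def)
      have "small n (b \<otimes> z)"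
        unfolding small_def
      proof
        fix P assume P: "P \<in> supp x (g n)"
        show "b \<otimes> z = \<zero> \<or> v P x \<le> v P (b \<otimes> z)"
        proof (cases "b \<otimes> z = \<zero>")
          case False
          then have nz: "b \<noteq> \<zero>" "z \<noteq> \<zero>" using R by auto
          then have "v P x \<le> v P z" using n P by (auto simp: small_def)
          then show ?thesis
            using v_mult[OF sM[OF P], of b z] v_ge_0[OF sM[OF P] bz(1)] nz R by simp
        qed simp
      qed
      then show ?thesis using R bz by (auto simp: I_def)
    qed
  qed
  have xI: "x \<in> I" using x by (auto simp: I_def small_def)
  have fI: "fideal I"
    unfolding fractional_ideal_iff
  proof (intro conjI sI)
    show "I \<noteq> {\<zero>}" using xI x by blast
    have "\<forall>z \<in> I. \<one> \<otimes> z \<in> B" using A_carrier by (simp add: I_def)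
    then show "\<exists>d \<in> nonzero R. \<forall>z \<in> I. d \<otimes> z \<in> B" using one_nz by blast
  qed
  have ge0: "0 \<le> v P z" if "P \<in> M" "z \<in> I - {\<zero>}" for P z using v_ge_0[OF that(1)] that(2) by (simp add: I_def)
  have compl: "\<one> \<ominus> g n \<in> I" for n
  proof -
    note gn = conjunct1[OF g(1)[of n]]
    have "small n (\<one> \<ominus> g n)"
      unfolding small_def
    proof
      fix P assume P: "P \<in> supp x (g n)"
      then have "P \<in> M" "x \<in> P" "\<one> \<ominus> g n \<in> P" using compl_mem_iff[OF gn] by (auto simp: supp_def)
      then show "\<one> \<ominus> g n = \<zero> \<or> v P x \<le> v P (\<one> \<ominus> g n)" by (rule idempotent_mod_value[OF x idempotent_mod_compl[OF gn]])
    qed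
    moreover have "g n \<in> B" using gn by (simp add: idempotent_mod_def)
    ultimately show ?thesis by (auto simp: I_def)
  qed
  have outside: "ord P I = 0" "att P I" if P: "P \<in> M" "x \<in> P" "P \<notin> supp x (g n)" for P n
  proof -
    note gn = conjunct1[OF g(1)[of n]]
    have "g n \<in> P" using P by (simp add: supp_def)
    then have c: "\<one> \<ominus> g n \<notin> P" using compl_mem_iff[OF gn P(1,2)] by simp
    moreover have "\<one> \<ominus> g n \<in> B" using gn by (simp add: idempotent_mod_def)
    ultimately have z: "v P (\<one> \<ominus> g n) = 0" using v_eq_0[OF P(1)] by blast
    have m: "\<one> \<ominus> g n \<in> I - {\<zero>}" using compl c max_idealD(4)[OF P(1)] by auto
    have le: "v P (\<one> \<ominus> g n) \<le> v P b" if "b \<in> I - {\<zero>}" for b using ge0[OF P(1) that] z by simp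
    show "ord P I = 0" "att P I" using ord_att_if_min[OF P(1) m le] z by simp_all
  qed
  have att: "att P I" if P: "P \<in> M" for P
  proof (cases "x \<in> P")
    case False
    have xi: "x \<in> I - {\<zero>}" using xI x by simp
    have z: "v P x = 0" using v_eq_0[OF P, of x] x False by simp
    have le: "v P x \<le> v P b" if "b \<in> I - {\<zero>}" for b using ge0[OF P that] z by simp
    show ?thesis by (rule ord_att_if_min(2)[OF P xi le])
  next
    case True
    show ?thesis
    proof (cases "\<exists>n. P \<notin> supp x (g n)")
      case T: True
      then show ?thesis using outside(2)[OF P True] by blast
    next
      case False
      have xi: "x \<in> I - {\<zero>}" using xI x by simp
      have le: "v P x \<le> v P b" if "b \<in> I - {\<zero>}" for b
        using that False by (auto simp: I_def small_def)
      show ?thesis by (rule ord_att_if_min(2)[OF P xi le])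
    qed
  qed
  obtain J a where J: "fideal J" "a \<in> nonzero R" "I = ideal_prod R (a <# B) (ideal_prod R (ideal_prod R I J) I)"
    using reg[OF fI] by blast
  obtain E where E: "finite E" "E \<subseteq> I - {\<zero>}" "\<And>P. P \<in> M \<Longrightarrow> \<exists>e \<in> E. v P e = ord P I"
    by (rule finitely_attained_if_regular[OF fI att J]) (assumption | rule that)+
  have "\<exists>n. \<forall>e \<in> E. small n e" using E(1,2)
  proof (induction E rule: finite_induct)
    case (insert e E)
    then obtain n m where "\<forall>e \<in> E. small n e" "small m e" by (auto simp: I_def)
    then have "\<forall>e' \<in> insert e E. small (max n m) e'" using small_mono by (metis insert_iff max.cobounded1 max.cobounded2)
    then show ?case by blast
  qed simp
  then obtain n where n: "\<And>e. e \<in> E \<Longrightarrow> small n e" by blast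
  obtain P where P: "P \<in> supp x (g n)" "P \<notin> supp x (g (Suc n))" using g(2)[of n] by blast
  have PM: "P \<in> M" "x \<in> P" using P by (auto simp: supp_def)
  obtain e where e: "e \<in> E" "v P e = ord P I" using E(3)[OF PM(1)] by blast
  have "v P x \<le> v P e" using n[OF e(1)] P(1) E(2) e(1) by (auto simp: small_def)
  then show False using e(2) outside(1)[OF PM P(2)] v_pos[OF PM x(2)] by simp
qed

end

section \<open>Classes modulo invertible ideals\<close>

context valued_domain
begin

lemma real_group_simps [simp]:
  "carrier real_group = UNIV" "a \<otimes>\<^bsub>real_group\<^esub> b = a + b" "\<one>\<^bsub>real_group\<^esub> = 0"
  by (simp_all add: real_group_def)

lemma value_subgroup:
  assumes P: "P \<in> M" shows "submonoid_with_inverses real_group (G P)"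
proof (intro submonoid_with_inverses.intro submonoid_with_inverses_axioms.intro comm_monoidI submonoid.intro)
  show "\<exists>k \<in> G P. k \<otimes>\<^bsub>real_group\<^esub> h = \<one>\<^bsub>real_group\<^esub>" if "h \<in> G P" for h
    using G_group(3)[OF P that] by (intro bexI[of _ "- h"]) simp_all
qed (use G_group(1,2)[OF P] in auto)

definition coset :: "'a set \<Rightarrow> real \<Rightarrow> real set" where
  "coset P r = G P #>\<^bsub>real_group\<^esub> r"

lemma coset_eq_iff: "P \<in> M \<Longrightarrow> coset P r = coset P s \<longleftrightarrow> r - s \<in> G P"
  using submonoid_with_inverses.coset_eq_iff[OF value_subgroup, of P r s]
  by (force simp: coset_def)

lemma coset_add: "P \<in> M \<Longrightarrow> coset P r <#>\<^bsub>real_group\<^esub> coset P s = coset P (r + s)"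
  using submonoid_with_inverses.coset_mult[OF value_subgroup, of P r s] by (simp add: coset_def)

definition dense_primes :: "'a set set" where
  "dense_primes = {P \<in> M. closure (G P) = UNIV}"

lemma dense_primes_iff: "P \<in> dense_primes \<longleftrightarrow> P \<in> M \<and> dense_at P"
  unfolding dense_primes_def dense_at_def closure_eq_UNIV_iff by simp

definition cut_monoid :: "('a set \<Rightarrow> real set option) monoid" where
  "cut_monoid = direct_sum_monoid dense_primes (\<lambda>P. adjoin_identity (real_group Mod G P))"

text \<open>
  Attained infima go to the adjoined identity. They belong to the value group, so they act trivially on
  the classes of the other infima.
\<close>

definition cut_class :: "'a set \<Rightarrow> 'a set \<Rightarrow> real set option" where
  "cut_class I = (\<lambda>P \<in> dense_primes. if att P I then None else Some (coset P (ord P I)))"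

lemma carrier_cut_monoid:
  "carrier cut_monoid = {c \<in> \<Pi>\<^sub>E P \<in> dense_primes. insert None (Some ` range (coset P)).
    finite {P \<in> dense_primes. c P \<noteq> None}}"
  by (simp add: cut_monoid_def direct_sum_monoid_def adjoin_identity_def carrier_FactGroup coset_def[abs_def])

lemma mult_cut_monoid:
  "c \<otimes>\<^bsub>cut_monoid\<^esub> d = (\<lambda>P \<in> dense_primes. case c P of None \<Rightarrow> d P
    | Some a \<Rightarrow> (case d P of None \<Rightarrow> c P | Some b \<Rightarrow> Some (a <#>\<^bsub>real_group\<^esub> b)))"
  by (simp add: cut_monoid_def direct_sum_monoid_def product_group_def adjoin_identity_def FactGroup_def
      cong: option.case_cong)

lemma cut_class_mult:
  assumes I: "fideal I" and J: "fideal J"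
  shows "cut_class (ideal_prod R I J) = cut_class I \<otimes>\<^bsub>cut_monoid\<^esub> cut_class J"
  unfolding mult_cut_monoid
proof (rule extensionalityI[of _ dense_primes])
  fix P assume D: "P \<in> dense_primes"
  then have P: "P \<in> M" by (simp add: dense_primes_def)
  have "coset P (ord P I + ord P J) = coset P (ord P J)" if "att P I"
    using coset_eq_iff[OF P] ord_in_G[OF I P that] by simp
  moreover have "coset P (ord P I + ord P J) = coset P (ord P I)" if "att P J"
    using coset_eq_iff[OF P] ord_in_G[OF J P that] by simp
  ultimately show "cut_class (ideal_prod R I J) P = (\<lambda>P \<in> dense_primes. case cut_class I P of
      None \<Rightarrow> cut_class J P
    | Some a \<Rightarrow> (case cut_class J P of None \<Rightarrow> cut_class I P
      | Some b \<Rightarrow> Some (a <#>\<^bsub>real_group\<^esub> b))) P"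
    using D by (simp add: cut_class_def att_ideal_prod[OF I J P] ord_ideal_prod[OF I J P] coset_add[OF P])
qed (simp_all add: cut_class_def)

lemma cut_class_image:
  assumes fc: "finite_character R B"
  shows "cut_class ` {I. fideal I} = carrier cut_monoid"
proof
  show "cut_class ` {I. fideal I} \<subseteq> carrier cut_monoid"
  proof
    fix c assume "c \<in> cut_class ` {I. fideal I}"
    then obtain I where I: "fideal I" "c = cut_class I" by blast
    have "{P \<in> dense_primes. c P \<noteq> None} \<subseteq> {P \<in> M. \<not> (ord P I = 0 \<and> att P I)}"
      unfolding I(2) by (auto simp: cut_class_def dense_primes_def split: if_splits)
    then have "finite {P \<in> dense_primes. c P \<noteq> None}"
      using finite_nontrivial[OF fc I(1)] finite_subset by blast
    then show "c \<in> carrier cut_monoid" unfolding carrier_cut_monoid I(2) by (simp add: cut_class_def)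
  qed
  show "carrier cut_monoid \<subseteq> cut_class ` {I. fideal I}"
  proof
    fix c assume "c \<in> carrier cut_monoid"
    then have c: "c \<in> (\<Pi>\<^sub>E P \<in> dense_primes. insert None (Some ` range (coset P)))"
      and fin: "finite {P \<in> dense_primes. c P \<noteq> None}" unfolding carrier_cut_monoid by auto
    have "\<exists>r. c P \<noteq> None \<longrightarrow> c P = Some (coset P r)" if "P \<in> dense_primes" for P
      using PiE_mem[OF c that] by auto
    then obtain r where r: "\<And>P. P \<in> dense_primes \<Longrightarrow> c P \<noteq> None \<Longrightarrow> c P = Some (coset P (r P))"
      by metis
    (* attained with infimum zero unless the class at P prescribes an open cut *)
    define \<alpha> where "\<alpha> P \<longleftrightarrow> \<not> (P \<in> dense_primes \<and> c P \<noteq> None)" for P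
    define \<rho> where "\<rho> P = (if \<alpha> P then 0 else r P)" for P
    have 1: "\<rho> P \<in> G P" if "P \<in> M" "\<alpha> P" for P using that G_group(1) by (simp add: \<rho>_def)
    have 2: "dense_at P" if "P \<in> M" "\<not> \<alpha> P" for P using that dense_primes_iff by (auto simp: \<alpha>_def)
    have 3: "finite {P \<in> M. \<not> (\<rho> P = 0 \<and> \<alpha> P)}"
      by (rule finite_subset[OF _ fin]) (auto simp: \<rho>_def \<alpha>_def)
    obtain I where I: "fideal I" "\<And>P. P \<in> M \<Longrightarrow> ord P I = \<rho> P" "\<And>P. P \<in> M \<Longrightarrow> att P I \<longleftrightarrow> \<alpha> P"
      by (rule exists_fractional_ideal[OF fc 1 2 3]) (assumption | rule that)+
    have "c = cut_class I"
    proof (rule extensionalityI[of _ dense_primes])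
      show "c \<in> extensional dense_primes" using c by (simp add: PiE_def)
      show "cut_class I \<in> extensional dense_primes" by (simp add: cut_class_def)
      fix P assume D: "P \<in> dense_primes"
      then have P: "P \<in> M" by (simp add: dense_primes_def)
      show "c P = cut_class I P"
        using D r[OF D] I(2,3)[OF P] by (cases "c P = None") (auto simp: cut_class_def \<rho>_def \<alpha>_def)
    qed
    then show "c \<in> cut_class ` {I. fideal I}" using I(1) by blast
  qed
qed

text \<open>
  Equal classes mean that infima are attained at the same places and differ by elements of the value
  groups. These differences are the infima of an invertible ideal.
\<close>

lemma cut_class_eq_iff:
  assumes fc: "finite_character R B" and I: "fideal I" and J: "fideal J"
  shows "cut_class I = cut_class J \<longleftrightarrow> (\<exists>H \<in> invertible_ideals R B. I = ideal_prod R H J)"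
proof
  assume "\<exists>H \<in> invertible_ideals R B. I = ideal_prod R H J"
  then obtain H where H: "H \<in> invertible_ideals R B" "I = ideal_prod R H J" by blast
  have fH: "fideal H" using H(1) by (simp add: invertible_ideals_def)
  show "cut_class I = cut_class J"
  proof (rule extensionalityI[of _ dense_primes])
    fix P assume D: "P \<in> dense_primes"
    then have P: "P \<in> M" by (simp add: dense_primes_def)
    have a: "att P H" by (rule att_invertible[OF H(1) P])
    have "coset P (ord P H + ord P J) = coset P (ord P J)"
      using coset_eq_iff[OF P] ord_in_G[OF fH P a] by simp
    then show "cut_class I P = cut_class J P"
      unfolding H(2) using D a by (simp add: cut_class_def att_ideal_prod[OF fH J P] ord_ideal_prod[OF fH J P])
  qed (simp_all add: cut_class_def)
next
  assume eq: "cut_class I = cut_class J"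
  have same: "(att P I \<longleftrightarrow> att P J) \<and> ord P I - ord P J \<in> G P" if P: "P \<in> M" for P
  proof (cases "P \<in> dense_primes")
    case True
    have "cut_class I P = cut_class J P" using eq by simp
    then have e: "(if att P I then None else Some (coset P (ord P I))) =
        (if att P J then None else Some (coset P (ord P J)))" using True by (simp add: cut_class_def)
    then have a: "att P I \<longleftrightarrow> att P J" by (auto split: if_splits)
    moreover have "ord P I - ord P J \<in> G P"
    proof (cases "att P I")
      case True
      then show ?thesis using a G_group(4)[OF P] ord_in_G[OF I P] ord_in_G[OF J P] by simp
    next
      case False
      then have "coset P (ord P I) = coset P (ord P J)" using e a by simp
      then show ?thesis by (simp add: coset_eq_iff[OF P])
    qed
    ultimately show ?thesis by simp
  next
    case False
    then have nd: "\<not> dense_at P" using P dense_primes_iff by simp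
    have "att P I" "att P J" using nd dense_if_not_attained[OF I P] dense_if_not_attained[OF J P] by auto
    then show ?thesis using G_group(4)[OF P] ord_in_G[OF I P] ord_in_G[OF J P] by simp
  qed
  (* the infima of the invertible ideal H with I = H J *)
  define \<delta> where "\<delta> P = ord P I - ord P J" for P
  have fin: "finite {P \<in> M. \<not> (\<delta> P = 0 \<and> True)}"
    by (rule finite_subset[OF _ finite_UnI[OF finite_nontrivial[OF fc I] finite_nontrivial[OF fc J]]])
      (auto simp: \<delta>_def)
  have fin': "finite {P \<in> M. \<not> (- \<delta> P = 0 \<and> True)}" using fin by simp
  have G1: "\<delta> P \<in> G P" if "P \<in> M" for P using same[OF that] by (simp add: \<delta>_def)
  have G2: "- \<delta> P \<in> G P" if "P \<in> M" for P using G_group(3)[OF that G1[OF that]] .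
  obtain H where H: "fideal H" "\<And>P. P \<in> M \<Longrightarrow> ord P H = \<delta> P" "\<And>P. P \<in> M \<Longrightarrow> att P H \<longleftrightarrow> True"
    by (rule exists_fractional_ideal[OF fc G1 _ fin]) (assumption | rule that | simp)+
  obtain N where N: "fideal N" "\<And>P. P \<in> M \<Longrightarrow> ord P N = - \<delta> P" "\<And>P. P \<in> M \<Longrightarrow> att P N \<longleftrightarrow> True"
    by (rule exists_fractional_ideal[OF fc G2 _ fin']) (assumption | rule that | simp)+
  have "H \<in> invertible_ideals R B" by (rule invertibleI[OF H(1) N(1)]) (simp add: H N)
  moreover have "I = ideal_prod R H J"
    by (rule frac_eqI[OF I frac_ideal_prod[OF H(1) J]])
      (simp add: ord_ideal_prod[OF H(1) J] att_ideal_prod[OF H(1) J] H same \<delta>_def)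
  ultimately show "\<exists>H \<in> invertible_ideals R B. I = ideal_prod R H J" by blast
qed

theorem Cl_Mod_Pic_iso:
  assumes fc: "finite_character R B"
  shows "Cl R B Mod carrier (Pic R B) \<cong> cut_monoid"
  unfolding Cl_def Pic_def
proof (rule Mod_Mod_iso[OF principal_submonoid invertible_submonoid principal_subset_invertible])
  show "cut_class ` carrier F = carrier cut_monoid" using cut_class_image[OF fc] by simp
qed (use cut_class_mult cut_class_eq_iff[OF fc] in simp_all)

theorem Clifford_iff_finite_character:
  "Reg (Cl R B) = carrier (Cl R B) \<longleftrightarrow> finite_character R B"
  unfolding Cl_regular_iff
proof
  assume "\<forall>I. fideal I \<longrightarrow> (\<exists>J. fideal J \<and>
    (\<exists>a \<in> nonzero R. I = ideal_prod R (a <# B) (ideal_prod R (ideal_prod R I J) I)))"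
  then show "finite_character R B" by (intro finite_character_if_regular) blast
next
  assume fc: "finite_character R B"
  show "\<forall>I. fideal I \<longrightarrow> (\<exists>J. fideal J \<and>
    (\<exists>a \<in> nonzero R. I = ideal_prod R (a <# B) (ideal_prod R (ideal_prod R I J) I)))"
  proof (intro allI impI)
    fix I assume I: "fideal I"
    obtain J where J: "fideal J" "ideal_prod R (ideal_prod R I J) I = I"
      by (rule regular_if_finite_character[OF fc I])
    have "ideal_prod R (\<one> <# B) I = I" using F.l_one[of I] I by (simp add: one_coset_B)
    then have "I = ideal_prod R (\<one> <# B) (ideal_prod R (ideal_prod R I J) I)" using J(2) by simp
    then show "\<exists>J. fideal J \<and>
        (\<exists>a \<in> nonzero R. I = ideal_prod R (a <# B) (ideal_prod R (ideal_prod R I J) I))"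
      using J(1) one_nz by blast
  qed
qed

end

theorem corollary2p9:
  fixes L :: "('a, 'b) ring_scheme" and \<oo> K \<OO> :: "'a set"
  assumes "field L"
    and "subring \<oo> L"
    and "dedekind_domain L \<oo>"
    and "\<not> field (L\<lparr>carrier := \<oo>\<rparr>)"
    and "K = fraction_field L \<oo>"
    and "\<forall>x \<in> carrier L. (ring.algebraic L over K) x"
    and "\<OO> = integral_closure L \<oo> (carrier L)"
  shows "(Reg (Cl L \<OO>) = carrier (Cl L \<OO>) \<longleftrightarrow> finite_character L \<OO>) \<and>
    (finite_character L \<OO> \<longrightarrow>
      Cl L \<OO> Mod carrier (Pic L \<OO>) \<cong>
      direct_sum_monoid {P \<in> max_ideals L \<OO>. closure (value_group L K \<OO> P) = UNIV}
        (\<lambda>P. adjoin_identity (real_group Mod value_group L K \<OO> P)))"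
proof -
  have C: "integral_closure_of_dedekind L \<oo> K \<OO>"
    by (intro integral_closure_of_dedekind.intro integral_closure_of_dedekind_axioms.intro)
      (use assms in auto)
  interpret C: integral_closure_of_dedekind L \<oo> K \<OO> by (rule C)
  have prime: "integral_closure_at_prime L \<oo> K \<OO> P" if "P \<in> max_ideals L \<OO>" for P
    by (intro integral_closure_at_prime.intro integral_closure_at_prime_axioms.intro C that)
  define v where "v P x = real_of_rat (valuation_at L K \<OO> P x)" for P x
  interpret valued_domain L \<OO> v
  proof (intro valued_domain.intro valued_domain_axioms.intro C.\<OO>.subring_of_field_axioms)
    fix P assume P: "P \<in> max_ideals L \<OO>"
    note nv = normalized_valuationD[OF integral_closure_at_prime.normalized_valuation_at[OF prime[OF P]]]
    show "P \<noteq> {\<zero>\<^bsub>L\<^esub>}" by (rule integral_closure_at_prime.P_nonzero[OF prime[OF P]])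
    fix x assume x: "x \<in> nonzero L"
    show "v P x \<ge> 0 \<longleftrightarrow> x \<in> localization_at L \<OO> P" using nv(4)[OF x] by (simp add: v_def)
    fix y assume y: "y \<in> nonzero L"
    show "v P (x \<otimes>\<^bsub>L\<^esub> y) = v P x + v P y" using nv(2)[OF x y] by (simp add: v_def of_rat_add)
    assume "x \<oplus>\<^bsub>L\<^esub> y \<noteq> \<zero>\<^bsub>L\<^esub>"
    from nv(3)[OF x y this] show "v P (x \<oplus>\<^bsub>L\<^esub> y) \<ge> min (v P x) (v P y)"
      by (auto simp: v_def min_def of_rat_less_eq split: if_splits)
  qed
  have "G = value_group L K \<OO>" by (simp add: fun_eq_iff G_def value_group_def v_def)
  then show ?thesis
    using Clifford_iff_finite_character Cl_Mod_Pic_iso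
    unfolding cut_monoid_def dense_primes_def by simp
qed

end
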